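(* Let $T>0$, let $f:\mathbb{R}\to\mathbb{R}$ be a continuous function, let $\alpha\in(1/2,1]$, and put $F(\xi):=\int_0^\xi f(s)\,ds$ for $\xi\in\mathbb{R}$ and $$\kappa_\alpha:=\frac{T^{2\alpha}}{\Gamma(\alpha)^2\,|\cos(\pi\alpha)|\,(2\alpha-1)}.$$ Then, for every $$\mu\in\left(0,\ \frac1{\kappa_\alpha}\sup_{\gamma>0}\frac{\gamma^2}{\max_{|\xi|\le\gamma}F(\xi)}\right),$$ the problem $$\frac{d}{dt}\Big({}_0D_t^{\alpha-1}({}_0^cD_t^{\alpha}u(t))-{}_tD_T^{\alpha-1}({}_t^cD_T^{\alpha}u(t))\Big)+\mu f(u(t))=0\ \text{ for a.e. }t\in[0,T],\qquad u(0)=u(T)=0,$$ admits at least one solution $u_\mu\in E_0^\alpha$.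
   Context: Here $\Gamma$ is the Euler gamma function. The quotient $\gamma^2/\max_{|\xi|\le\gamma}F(\xi)$ is taken to be $+\infty$ when its denominator (which is always $\ge0$) vanishes; if the supremum is $+\infty$, the interval for $\mu$ is $(0,+\infty)$. Fractional integrals: for $\beta>0$, the left and right Riemann–Liouville fractional integrals of order $\beta$ on $[0,T]$ are ${}_0D_t^{-\beta}u(t)=\frac1{\Gamma(\beta)}\int_0^t(t-s)^{\beta-1}u(s)\,ds$ and ${}_tD_T^{-\beta}u(t)=\frac1{\Gamma(\beta)}\int_t^T(s-t)^{\beta-1}u(s)\,ds$. Thus ${}_0D_t^{\alpha-1}$ and ${}_tD_T^{\alpha-1}$ are the fractional integrals of order $1-\alpha$ (the identity if $\alpha=1$). Caputo derivatives: for $\alpha\in(0,1)$ and $u$ absolutely continuous on $[0,T]$, ${}_0^cD_t^\alpha u(t)=\frac1{\Gamma(1-\alpha)}\int_0^t(t-s)^{-\alpha}u'(s)\,ds$ and ${}_t^cD_T^\alpha u(t)=-\frac1{\Gamma(1-\alpha)}\int_t^T(s-t)^{-\alpha}u'(s)\,ds$; for $\alpha=1$, ${}_0^cD_t^1u=u'$ and ${}_t^cD_T^1u=-u'$. The space $E_0^\alpha$ is the closure (completion) of $\{g\in C^\infty([0,T],\mathbb{R}):g(0)=g(T)=0\}$ with respect to the norm $\|u\|=\big(\int_0^T|{}_0^cD_t^\alpha u(t)|^2dt+\int_0^T|u(t)|^2dt\big)^{1/2}$; the Caputo derivatives ${}_0^cD_t^\alpha u,\ {}_t^cD_T^\alpha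 u\in L^2(0,T)$ of $u\in E_0^\alpha$ are understood by continuous extension. $E_0^\alpha$ is a Hilbert space with the equivalent norm $\|u\|_\alpha=\big(\int_0^T|{}_0^cD_t^\alpha u(t)|^2dt\big)^{1/2}$, and for $\alpha>1/2$ its elements are continuous functions on $[0,T]$. Solution: an absolutely continuous function $u:[0,T]\to\mathbb{R}$ such that $t\mapsto{}_0D_t^{\alpha-1}({}_0^cD_t^\alpha u(t))-{}_tD_T^{\alpha-1}({}_t^cD_T^\alpha u(t))$ is differentiable (in the classical sense) for almost every $t\in[0,T]$, the equation holds for a.e. $t\in[0,T]$, and $u(0)=u(T)=0$. *)

theory Defs
  imports "HOL-Analysis.Analysis"
begin

text \<open>
  All functions on \<open>[0,T]\<close> are represented by total functions on the reals, whose values outside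
  \<open>[0,T]\<close> play no role.  Lebesgue integrals are taken with respect to the complete measure
  \<open>lebesgue\<close>, so that the arbitrary values of \<open>deriv u\<close> at the points where \<open>u\<close> is not
  differentiable (a null set for absolutely continuous \<open>u\<close>) do not affect measurability.
\<close>

definition absolutely_continuous_on_interval :: "real \<Rightarrow> real \<Rightarrow> (real \<Rightarrow> real) \<Rightarrow> bool" where
  "absolutely_continuous_on_interval c d u \<longleftrightarrow>
    (\<forall>\<epsilon>>0. \<exists>\<delta>>0. \<forall>(n::nat) a b.
       (\<forall>i<n. c \<le> a i \<and> a i \<le> b i \<and> b i \<le> d) \<longrightarrow>
       (\<forall>i<n. \<forall>j<n. i \<noteq> j \<longrightarrow> {a i<..<b i} \<inter> {a j<..<b j} = {}) \<longrightarrow>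
       (\<Sum>i<n. b i - a i) < \<delta> \<longrightarrow>
       (\<Sum>i<n. \<bar>u (b i) - u (a i)\<bar>) < \<epsilon>)"

text \<open>Riemann--Liouville fractional integrals of order \<open>\<beta> \<ge> 0\<close>; order \<open>0\<close> is the identity.\<close>

definition frac_integral_left :: "real \<Rightarrow> (real \<Rightarrow> real) \<Rightarrow> real \<Rightarrow> real" where
  "frac_integral_left \<beta> u t =
    (if \<beta> = 0 then u t
     else 1 / Gamma \<beta> * (LINT s:{0..t}|lebesgue. (t - s) powr (\<beta> - 1) * u s))"

definition frac_integral_right :: "real \<Rightarrow> real \<Rightarrow> (real \<Rightarrow> real) \<Rightarrow> real \<Rightarrow> real" where
  "frac_integral_right T \<beta> u t =
    (if \<beta> = 0 then u t
     else 1 / Gamma \<beta> * (LINT s:{t..T}|lebesgue. (s - t) powr (\<beta> - 1) * u s))"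

text \<open>Caputo derivatives of order \<open>0 < \<alpha> \<le> 1\<close> of an absolutely continuous function.\<close>

definition caputo_left :: "real \<Rightarrow> (real \<Rightarrow> real) \<Rightarrow> real \<Rightarrow> real" where
  "caputo_left \<alpha> u t =
    (if \<alpha> = 1 then deriv u t
     else 1 / Gamma (1 - \<alpha>) * (LINT s:{0..t}|lebesgue. (t - s) powr (- \<alpha>) * deriv u s))"

definition caputo_right :: "real \<Rightarrow> real \<Rightarrow> (real \<Rightarrow> real) \<Rightarrow> real \<Rightarrow> real" where
  "caputo_right T \<alpha> u t =
    (if \<alpha> = 1 then - deriv u t
     else - (1 / Gamma (1 - \<alpha>)) * (LINT s:{t..T}|lebesgue. (s - t) powr (- \<alpha>) * deriv u s))"

text \<open>\<open>C\<^sup>\<infinity>([0,T])\<close>, with one-sided derivatives at the endpoints; \<open>G n\<close> is the \<open>n\<close>-th derivative.\<close>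

definition smooth_on_interval :: "real \<Rightarrow> (real \<Rightarrow> real) \<Rightarrow> bool" where
  "smooth_on_interval T g \<longleftrightarrow>
    (\<exists>G :: nat \<Rightarrow> real \<Rightarrow> real. G 0 = g \<and>
       (\<forall>n. \<forall>t\<in>{0..T}. (G n has_real_derivative G (Suc n) t) (at t within {0..T})))"

definition square_integrable :: "real \<Rightarrow> (real \<Rightarrow> real) \<Rightarrow> bool" where
  "square_integrable T u \<longleftrightarrow>
    u \<in> borel_measurable (lebesgue_on {0..T}) \<and>
    integrable (lebesgue_on {0..T}) (\<lambda>t. (u t)\<^sup>2)"

text \<open>
  \<open>v\<close> is the left Caputo derivative of \<open>u\<close> by continuous extension: some sequence of smooth
  functions vanishing at the endpoints converges to \<open>u\<close> in \<open>L\<^sup>2(0,T)\<close> while its Caputo derivatives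
  converge to \<open>v\<close> in \<open>L\<^sup>2(0,T)\<close>.  By completeness of \<open>L\<^sup>2\<close> such sequences are exactly the Cauchy
  sequences for the norm \<open>(\<integral>|D g|\<^sup>2 + \<integral>|g|\<^sup>2)\<^sup>1\<^sup>/\<^sup>2\<close>.
\<close>

definition has_extended_caputo :: "real \<Rightarrow> real \<Rightarrow> (real \<Rightarrow> real) \<Rightarrow> (real \<Rightarrow> real) \<Rightarrow> bool" where
  "has_extended_caputo T \<alpha> u v \<longleftrightarrow>
    square_integrable T u \<and> square_integrable T v \<and>
    (\<exists>g :: nat \<Rightarrow> real \<Rightarrow> real.
       (\<forall>n. smooth_on_interval T (g n) \<and> g n 0 = 0 \<and> g n T = 0) \<and>
       (\<lambda>n. LINT t|lebesgue_on {0..T}. \<bar>caputo_left \<alpha> (g n) t - v t\<bar>\<^sup>2) \<longlonglongrightarrow> 0 \<and>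
       (\<lambda>n. LINT t|lebesgue_on {0..T}. \<bar>g n t - u t\<bar>\<^sup>2) \<longlonglongrightarrow> 0)"

text \<open>
  The space \<open>E\<^sub>0\<^sup>\<alpha>\<close> for \<open>\<alpha> > 1/2\<close>, whose elements are identified with their continuous
  representatives.
\<close>

definition E_space :: "real \<Rightarrow> real \<Rightarrow> (real \<Rightarrow> real) set" where
  "E_space T \<alpha> = {u. continuous_on {0..T} u \<and> (\<exists>v. has_extended_caputo T \<alpha> u v)}"

definition flux :: "real \<Rightarrow> real \<Rightarrow> (real \<Rightarrow> real) \<Rightarrow> real \<Rightarrow> real" where
  "flux T \<alpha> u t =
    frac_integral_left (1 - \<alpha>) (caputo_left \<alpha> u) t
    - frac_integral_right T (1 - \<alpha>) (caputo_right T \<alpha> u) t"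

definition is_solution :: "real \<Rightarrow> real \<Rightarrow> real \<Rightarrow> (real \<Rightarrow> real) \<Rightarrow> (real \<Rightarrow> real) \<Rightarrow> bool" where
  "is_solution T \<alpha> \<mu> f u \<longleftrightarrow>
    absolutely_continuous_on_interval 0 T u \<and>
    (AE t in lebesgue_on {0..T}. flux T \<alpha> u differentiable at t) \<and>
    (AE t in lebesgue_on {0..T}. deriv (flux T \<alpha> u) t + \<mu> * f (u t) = 0) \<and>
    u 0 = 0 \<and> u T = 0"

text \<open>The interval integral is oriented, so this is also right for \<open>\<xi> < 0\<close>.\<close>

definition primitive :: "(real \<Rightarrow> real) \<Rightarrow> real \<Rightarrow> real" where
  "primitive f \<xi> = (LBINT s=ereal 0..ereal \<xi>. f s)"

text \<open>For continuous \<open>f\<close> the supremum is attained, i.e. it is the maximum.\<close>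

definition max_primitive :: "(real \<Rightarrow> real) \<Rightarrow> real \<Rightarrow> real" where
  "max_primitive f \<gamma> = (SUP \<xi>\<in>{\<xi>. \<bar>\<xi>\<bar> \<le> \<gamma>}. primitive f \<xi>)"

definition growth_quotient :: "(real \<Rightarrow> real) \<Rightarrow> real \<Rightarrow> ereal" where
  "growth_quotient f \<gamma> =
    (if max_primitive f \<gamma> = 0 then \<infinity> else ereal (\<gamma>\<^sup>2 / max_primitive f \<gamma>))"

definition kappa :: "real \<Rightarrow> real \<Rightarrow> real" where
  "kappa T \<alpha> = T powr (2 * \<alpha>) / ((Gamma \<alpha>)\<^sup>2 * \<bar>cos (pi * \<alpha>)\<bar> * (2 * \<alpha> - 1))"

end

theory Submission
  imports Defs "HOL-Complex_Analysis.Great_Picard" "HOL-Computational_Algebra.Polynomial"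
begin

text \<open>
  For \<open>\<alpha> < 1\<close> the flux of \<open>u\<close> is the Riesz potential \<open>1 / \<Gamma>(2 - 2\<alpha>) \<integral> |t - s| powr (1 - 2\<alpha>) u'(s) ds\<close> over
  \<open>[0,T]\<close>, so a solution with right-hand side \<open>g\<close> is obtained by solving for \<open>u'\<close> a first-kind integral
  equation.  Copson's factorisation of the kernel into two Abel operators turns polynomials into
  the weight \<open>(x (T - x)) powr (\<alpha> - 1)\<close> times polynomials, with bounds that pass to the limit, so that
  \<open>u'\<close> is the weight times a continuous function for every continuous \<open>g\<close>.  A second factorisation
  of the kernel, over the half-line \<open>(-\<infinity>,T]\<close>, shows that the energy \<open>\<integral> u g\<close> is a square norm and gives
  \<open>u(t)\<^sup>2 \<le> \<kappa> / (2 T) \<integral> u g\<close> with exactly the constant of the theorem.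

  The functional \<open>\<integral> u g / 2 - \<mu> \<integral> F(u)\<close> is minimised over the energy ball on which \<open>|u| \<le> \<gamma>\<close>.  The condition on
  \<open>\<mu>\<close> keeps approximate minimisers away from the boundary of the ball, they solve the equation up to an error
  tending to zero, and by Arzela-Ascoli a subsequence converges to a solution; neither
  completeness nor weak compactness of the energy space is used.
\<close>

section \<open>Kernel identities\<close>

text \<open>The unknown is the pair of a continuous datum g and a density P with u' = weight * P.
  The datum gives the energy as the integral of u g, without fractional derivatives of u.
  Integrating the equation once leaves a free constant; since the weight itself has constant
  potential, adding a multiple of it brings the mean of u' to zero, that is u(T) = 0, and changes
  only that constant. The main obstacle is a bound: on polynomials the two Abel operators are
  diagonal, but dividing coefficients by their eigenvalues gives no estimate independent of the
  degree. Written as singular integrals of differences, the two inversions take Lipschitz data to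
  Hoelder-1/2 functions and these to bounded ones, and the integral of g is Lipschitz with constant
  sup |g|. The exponent \<alpha> - 3/2 met there is integrable, and the weight square integrable,
  because \<alpha> > 1/2. In the pointwise bound, T^(2\<alpha>-1)/(2\<alpha>-1) is a squared norm of
  an Abel test function, and the reflection formula for Gamma produces |cos(\<pi>\<alpha>)|.\<close>

definition tpow :: "real \<Rightarrow> real \<Rightarrow> real" where
  "tpow s x = (if x > 0 then x powr s else 0)"

lemma tpow_nonneg [simp]: "0 \<le> tpow s x"
  by (simp add: tpow_def)

lemma tpow_pos: "0 < x \<Longrightarrow> tpow s x = x powr s"
  by (simp add: tpow_def)

lemma tpow_zero: "x \<le> 0 \<Longrightarrow> tpow s x = 0"
  by (simp add: tpow_def)

lemma measurable_tpow [measurable]: "tpow s \<in> borel_measurable borel"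
  unfolding tpow_def by measurable

text \<open>The change of variables formula concerns absolute integrability on a set for Lebesgue
  measure, Fubini's theorem concerns \<open>lborel\<close>. A Borel function that carries the
  cut-off to \<open>S\<close> in itself passes from one to the other.\<close>

lemma has_bochner_integral_lborelI:
  fixes f g :: "real \<Rightarrow> real"
  assumes "f absolutely_integrable_on S" "integral S f = b"
    and S: "S \<in> sets borel" and g[measurable]: "g \<in> borel_measurable borel"
    and eq: "\<And>x. g x = (if x \<in> S then f x else 0)"
  shows "has_bochner_integral lborel g b"
proof -
  have g': "g = (\<lambda>x. indicat_real S x *\<^sub>R f x)"
    using eq by (auto simp: fun_eq_iff)
  have "integrable lebesgue g"
    using assms(1) unfolding set_integrable_def g' by simp
  then have "integrable lborel g" 
    by (subst (asm) integrable_completion) auto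
  moreover have "integral\<^sup>L lborel g = b"
  proof -
    have "integral\<^sup>L lborel g = integral\<^sup>L lebesgue g"
      by (rule integral_completion[symmetric]) auto
    also have "\<dots> = (LINT x:S|lebesgue. f x)"
      unfolding set_lebesgue_integral_def g' by simp
    also have "\<dots> = integral S f"
      by (rule set_lebesgue_integral_eq_integral(2)[OF assms(1)])
    finally show ?thesis using assms(2) by simp
  qed
  ultimately show ?thesis by (simp add: has_bochner_integral_iff)
qed

lemma absolutely_integrable_Beta:
  fixes p q :: real
  assumes "p > 0" "q > 0"
  shows "(\<lambda>t. t powr (p - 1) * (1 - t) powr (q - 1)) absolutely_integrable_on {0<..<1}"
    and "integral {0<..<1} (\<lambda>t. t powr (p - 1) * (1 - t) powr (q - 1)) = Beta p q"
proof -
  have *: "((\<lambda>t. t powr (p - 1) * (1 - t) powr (q - 1)) has_integral Beta p q) {0<..<1}"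
    using has_integral_Beta_real[OF assms] by (simp add: has_integral_Icc_iff_Ioo)
  show "(\<lambda>t. t powr (p - 1) * (1 - t) powr (q - 1)) absolutely_integrable_on {0<..<1}"
    by (rule nonnegative_absolutely_integrable_1) (use * in auto)
  show "integral {0<..<1} (\<lambda>t. t powr (p - 1) * (1 - t) powr (q - 1)) = Beta p q"
    using * by (rule integral_unique)
qed

text \<open>Truncated powers absorb the interval of integration into the integrand, so that all
  kernel integrals run over the whole line and can be exchanged without set integrals. In particular
  \<open>tpow 0\<close> is the indicator of the positive half-line.\<close>

lemma has_bochner_integral_Beta01:
  fixes p q :: real
  assumes "p > 0" "q > 0"
  shows "has_bochner_integral lborel (\<lambda>t. tpow (p - 1) t * tpow (q - 1) (1 - t)) (Beta p q)"
  by (rule has_bochner_integral_lborelI[OF absolutely_integrable_Beta[OF assms]])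
     (auto simp: tpow_def)

lemma has_bochner_integral_Beta:
  fixes p q a b :: real
  assumes "p > 0" "q > 0" "a < b"
  shows "has_bochner_integral lborel (\<lambda>t. tpow (p - 1) (t - a) * tpow (q - 1) (b - t))
           ((b - a) powr (p + q - 1) * Beta p q)"
proof -
  let ?f = "\<lambda>t. tpow (p - 1) (t - a) * tpow (q - 1) (b - t)"
  have scale: "?f (a + (b - a) * t) = (b - a) powr (p + q - 2) * (tpow (p - 1) t * tpow (q - 1) (1 - t))" for t
  proof -
    have 1: "b - (a + (b - a) * t) = (b - a) * (1 - t)" "a + (b - a) * t - a = (b - a) * t"
      by (simp_all add: algebra_simps)
    have 2: "(b - a) powr (p + q - 2) = (b-a) powr (p-1) * (b-a) powr (q-1)"
      by (simp add: powr_add [symmetric] algebra_simps)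
    show ?thesis
      unfolding 1 2 using \<open>a < b\<close> by (auto simp: tpow_def powr_mult zero_less_mult_iff)
  qed
  have "has_bochner_integral lborel (\<lambda>t. (b - a) powr (p + q - 2) * (tpow (p - 1) t * tpow (q - 1) (1 - t)))
     ((b - a) powr (p + q - 2) * Beta p q)"
    by (intro has_bochner_integral_mult_right has_bochner_integral_Beta01 assms)
  then have "has_bochner_integral lborel (\<lambda>t. ?f (a + (b - a) * t)) ((b - a) powr (p + q - 2) * Beta p q)"
    unfolding scale .
  then have "has_bochner_integral lborel (\<lambda>t. ?f (a + (b - a) * t))
     (((b - a) powr (p + q - 1) * Beta p q) /\<^sub>R \<bar>b - a\<bar>)"
    using \<open>a < b\<close> by (simp add: powr_diff field_simps power2_eq_square)
  then show ?thesis
    using \<open>a < b\<close> by (subst lborel_has_bochner_integral_real_affine_iff[of "b - a" _ _ a]) auto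
qed

text \<open>The substitution \<open>s = (x - \<tau>) / (y - \<tau>)\<close> turns both kernel identities into Beta integrals.\<close>

lemma kernel_substitution:
  fixes x y :: real and h :: "real \<Rightarrow> real"
  assumes "x < y" and S: "S \<subseteq> {0<..<1}" "S \<in> sets borel"
    and h: "h absolutely_integrable_on S" "integral S h = b"
    and f: "\<And>s. s \<in> S \<Longrightarrow> (y - x) / (1 - s)^2 * f ((x - s * y) / (1 - s)) = h s"
  shows "f absolutely_integrable_on ((\<lambda>s. (x - s * y) / (1 - s)) ` S)"
    and "integral ((\<lambda>s. (x - s * y) / (1 - s)) ` S) f = b"
proof -
  let ?g = "\<lambda>s. (x - s * y) / (1 - s)"
  have der: "(?g has_field_derivative (- (y - x) / (1 - s)^2)) (at s within S)" if "s \<in> S" for s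
    using that S by (auto intro!: derivative_eq_intros simp: power2_eq_square algebra_simps)
  have inj: "inj_on ?g S"
  proof (rule inj_onI)
    fix s t assume st: "s \<in> S" "t \<in> S" "?g s = ?g t"
    then have "s < 1" "t < 1" using S by auto
    then have "(x - s * y) * (1 - t) = (x - t * y) * (1 - s)" using st(3) by (simp add: divide_simps)
    then have "(y - x) * (s - t) = 0" by (simp add: algebra_simps)
    then show "s = t" using assms(1) by simp
  qed
  have 1: "\<bar>- (y - x) / (1 - s)^2\<bar> * f (?g s) = h s" if "s \<in> S" for s
  proof -
    have "\<bar>- (y - x) / (1 - s)^2\<bar> = (y - x) / (1 - s)^2" using assms(1) by (simp add: abs_divide)
    then show ?thesis using f[OF that] by (simp only:)
  qed
  have "integral S (\<lambda>s. \<bar>- (y - x) / (1 - s)^2\<bar> * f (?g s)) = integral S h"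
    by (rule integral_cong[OF 1])
  moreover have "(\<lambda>s. \<bar>- (y - x) / (1 - s)^2\<bar> * f (?g s)) absolutely_integrable_on S \<longleftrightarrow>
      h absolutely_integrable_on S"
    by (rule set_integrable_cong[OF refl refl 1])
  ultimately have "(\<lambda>s. \<bar>- (y - x) / (1 - s)^2\<bar> * f (?g s)) absolutely_integrable_on S \<and>
    integral S (\<lambda>s. \<bar>- (y - x) / (1 - s)^2\<bar> * f (?g s)) = b"
    using h by simp
  then have "f absolutely_integrable_on (?g ` S) \<and> integral (?g ` S) f = b"
    by (subst (asm) has_absolute_integral_change_of_variables_1'[OF _ der inj]) (use S in auto)
  then show "f absolutely_integrable_on (?g ` S)" "integral (?g ` S) f = b" by auto
qed

text \<open>The integral runs over \<tau> < x. It converges at \<tau> = x because \<alpha> < 1 and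
  at minus infinity because 2\<alpha> > 1. The substitution maps this half-line onto s in
  (0,1).\<close>

lemma has_bochner_integral_halfline_kernel:
  fixes x y \<alpha> :: real
  assumes "x < y" "1/2 < \<alpha>" "\<alpha> < 1"
  shows "has_bochner_integral lborel (\<lambda>\<tau>. tpow (-\<alpha>) (x - \<tau>) * tpow (-\<alpha>) (y - \<tau>))
           (Beta (1 - \<alpha>) (2 * \<alpha> - 1) * (y - x) powr (1 - 2 * \<alpha>))"
proof -
  let ?g = "\<lambda>s. (x - s * y) / (1 - s)"
  let ?h = "\<lambda>s. (y - x) powr (1 - 2 * \<alpha>) * (s powr ((1 - \<alpha>) - 1) * (1 - s) powr ((2*\<alpha>-1) - 1))"
  let ?f = "\<lambda>\<tau>. (x - \<tau>) powr (-\<alpha>) * (y - \<tau>) powr (-\<alpha>)"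
  have B: "?h absolutely_integrable_on {0<..<1}" 
    by (intro set_integrable_mult_right absolutely_integrable_Beta(1)) (use assms in auto)
  have B2: "integral {0<..<1} ?h = Beta (1 - \<alpha>) (2 * \<alpha> - 1) * (y - x) powr (1 - 2 * \<alpha>)"
    using assms by (simp only: integral_mult_right) (subst absolutely_integrable_Beta(2), auto)
  have f: "(y - x) / (1 - s)^2 * ?f (?g s) = ?h s" if "s \<in> {0<..<1}" for s
  proof -
    have 1: "x - ?g s = (y - x) * (s / (1 - s))" "y - ?g s = (y - x) * (1 / (1 - s))"
      using that by (auto simp: field_simps)
    have 2: "(1 - s)^2 = (1-s) powr 2" using that by (simp add: powr_numeral)
    have 3: "(1-s) powr ((2*\<alpha>-1) - 1) = (1-s) powr \<alpha> * (1-s) powr \<alpha> / (1-s) powr 2"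
      by (simp flip: powr_add powr_diff)
    have 4: "(y - x) powr (1 - 2 * \<alpha>) = (y-x) * (y - x) powr (-\<alpha>) * (y - x) powr (-\<alpha>)"
      using assms by (simp flip: powr_add add: powr_mult_base)
    show ?thesis unfolding 1 2 3 4 using that assms
      by (simp add: powr_mult powr_divide powr_minus_divide)
  qed
  have img: "?g ` {0<..<1} = {..<x}"
  proof (intro equalityI subsetI)
    fix t assume "t \<in> ?g ` {0<..<1}"
    then obtain s where s: "0 < s" "s < 1" "t = ?g s" by auto
    have "x - ?g s = (y - x) * s / (1 - s)"
      using s by (auto simp: field_simps)
    moreover have "\<dots> > 0" using s assms by simp
    ultimately show "t \<in> {..<x}" using s by simp
  next
    fix t assume t: "t \<in> {..<x}"
    have "t = ?g ((x - t) / (y - t))" using t assms by (simp add: divide_simps) (simp add: algebra_simps)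
    moreover have "(x - t) / (y - t) \<in> {0<..<1}" using t assms by (auto simp: field_simps)
    ultimately show "t \<in> ?g ` {0<..<1}" by blast
  qed
  note k = kernel_substitution[where S="{0<..<1}" and f = ?f and h = ?h, OF assms(1) _ _ B B2 f, unfolded img]
  show ?thesis
    by (rule has_bochner_integral_lborelI[OF k]) (use assms in \<open>auto simp: tpow_def\<close>)
qed

text \<open>The factor \<tau>^(2\<alpha>-2) is chosen so that all powers of 1 - s cancel after the
  substitution. The point \<tau> = 0 corresponds to s = x/y, so what remains is a Beta integral over
  (0, x/y) instead of (0,1).\<close>

lemma has_bochner_integral_copson_kernel:
  fixes x y \<alpha> :: real
  assumes "0 < x" "x < y" "1/2 < \<alpha>" "\<alpha> < 1"
  shows "has_bochner_integral lborel
           (\<lambda>\<tau>. tpow (2 * \<alpha> - 2) \<tau> * (tpow (-\<alpha>) (x - \<tau>) * tpow (-\<alpha>) (y - \<tau>)))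
           (Beta (1 - \<alpha>) (2 * \<alpha> - 1) * (x * y) powr (\<alpha> - 1) * (y - x) powr (1 - 2 * \<alpha>))"
proof -
  let ?g = "\<lambda>s. (x - s * y) / (1 - s)"
  define h where "h = (\<lambda>s. (y - x) powr (1 - 2 * \<alpha>) * (s powr (- \<alpha>) * (x - s * y) powr (2*\<alpha>-2)))"
  let ?f = "\<lambda>\<tau>. \<tau> powr (2 * \<alpha> - 2) * ((x - \<tau>) powr (-\<alpha>) * (y - \<tau>) powr (-\<alpha>))"
  have "x / y < 1" using assms by simp
  have f: "(y - x) / (1 - s)^2 * ?f (?g s) = h s" if "s \<in> {0<..<x/y}" for s
  proof -
    have "0 < s" "s < x / y" using that by auto
    with \<open>x / y < 1\<close> have "0 < s" "s < 1" by linarith+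
    moreover have "x - s * y > 0" using that assms by (auto simp: field_simps)
    ultimately have s: "0 < s" "s < 1" "x - s * y > 0" by auto
    have 1: "x - ?g s = (y - x) * (s / (1 - s))" "y - ?g s = (y - x) * (1 / (1 - s))"
      using s by (auto simp: field_simps)
    have 2: "(1 - s)^2 = (1-s) powr 2" using s by (simp add: powr_numeral)
    have 3: "(1 - s) powr (2*\<alpha>-2) = (1-s) powr \<alpha> * (1-s) powr \<alpha> / (1-s) powr 2"
      by (simp flip: powr_add powr_diff)
    have 4: "(y - x) powr (1 - 2 * \<alpha>) = (y-x) * (y - x) powr (-\<alpha>) * (y - x) powr (-\<alpha>)"
      using assms by (simp flip: powr_add add: powr_mult_base)
    have 5: "?g s powr (2*\<alpha>-2) = (x - s * y) powr (2*\<alpha>-2) / (1 - s) powr (2*\<alpha>-2)"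
      using s by (simp add: powr_divide)
    show ?thesis unfolding 1 5 unfolding 2 3 4 h_def using s assms
      by (simp add: powr_mult powr_divide powr_minus_divide)
  qed
  have "has_bochner_integral lborel (\<lambda>s. tpow ((1-\<alpha>) - 1) (s - 0) * tpow ((2*\<alpha>-1)-1) (x/y - s))
      ((x/y - 0) powr ((1-\<alpha>) + (2*\<alpha>-1) - 1) * Beta (1-\<alpha>) (2*\<alpha>-1))"
    by (rule has_bochner_integral_Beta) (use assms in auto)
  then have "has_bochner_integral lborel (\<lambda>s. (y - x) powr (1 - 2 * \<alpha>) * y powr (2*\<alpha>-2) * (tpow (-\<alpha>) s * tpow (2*\<alpha>-2) (x/y - s)))
     ((y - x) powr (1 - 2 * \<alpha>) * y powr (2*\<alpha>-2) * ((x/y) powr (\<alpha>-1) * Beta (1-\<alpha>) (2*\<alpha>-1)))"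
    by (intro has_bochner_integral_mult_right) simp
  also have "(\<lambda>s. (y - x) powr (1 - 2 * \<alpha>) * y powr (2*\<alpha>-2) * (tpow (-\<alpha>) s * tpow (2*\<alpha>-2) (x/y - s)))
      = (\<lambda>s. indicator {0<..<x/y} s *\<^sub>R h s)"
  proof
    fix s
    have "y * (x / y - s) = x - s * y" using assms by (simp add: field_simps)
    then have "y powr (2*\<alpha>-2) * (x / y - s) powr (2*\<alpha>-2) = (x - s * y) powr (2*\<alpha>-2)" if "s < x/y"
      using assms that by (subst powr_mult[symmetric]) auto
    then show "(y - x) powr (1 - 2 * \<alpha>) * y powr (2*\<alpha>-2) * (tpow (-\<alpha>) s * tpow (2*\<alpha>-2) (x/y - s)) = 
      indicator {0<..<x/y} s *\<^sub>R h s"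
      by (auto simp: h_def tpow_def indicator_def)
  qed
  also have "(y - x) powr (1 - 2 * \<alpha>) * y powr (2*\<alpha>-2) * ((x/y) powr (\<alpha>-1) * Beta (1-\<alpha>) (2*\<alpha>-1))
      = Beta (1 - \<alpha>) (2 * \<alpha> - 1) * (x * y) powr (\<alpha> - 1) * (y - x) powr (1 - 2 * \<alpha>)"
  proof -
    have "y powr (2*\<alpha>-2) = y powr (\<alpha>-1) * y powr (\<alpha>-1)"
      by (simp flip: powr_add)
    then show ?thesis using assms by (simp add: powr_mult powr_divide field_simps)
  qed
  finally have hb: "has_bochner_integral lborel (\<lambda>s. indicator {0<..<x/y} s *\<^sub>R h s)
     (Beta (1 - \<alpha>) (2 * \<alpha> - 1) * (x * y) powr (\<alpha> - 1) * (y - x) powr (1 - 2 * \<alpha>))" .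
  have B1: "h absolutely_integrable_on {0<..<x/y}"
    unfolding set_integrable_def using hb
    by (subst integrable_completion) (auto simp: has_bochner_integral_iff intro: borel_measurable_integrable)
  have B2: "integral {0<..<x/y} h = Beta (1 - \<alpha>) (2 * \<alpha> - 1) * (x * y) powr (\<alpha> - 1) * (y - x) powr (1 - 2 * \<alpha>)"
    using hb unfolding set_lebesgue_integral_eq_integral(2)[OF B1, symmetric] set_lebesgue_integral_def
    by (subst integral_completion) (auto simp: has_bochner_integral_iff intro: borel_measurable_integrable)
  have img: "?g ` {0<..<x/y} = {0<..<x}"
  proof (intro equalityI subsetI)
    fix t assume "t \<in> ?g ` {0<..<x/y}"
    then obtain s where s: "0 < s" "s < x/y" "t = ?g s" by auto
    then have s1: "s < 1" using \<open>x / y < 1\<close> by linarith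
    have s2: "s * y < x" using s assms by (auto simp: field_simps)
    have "x - ?g s = (y - x) * s / (1 - s)"
      using s1 by (auto simp: field_simps)
    moreover have "\<dots> > 0" using s s1 assms by simp
    ultimately show "t \<in> {0<..<x}" using s s1 s2 by simp
  next
    fix t assume t: "t \<in> {0<..<x}"
    have "t = ?g ((x - t) / (y - t))" using t assms by (simp add: divide_simps) (simp add: algebra_simps)
    moreover have "(x - t) / (y - t) \<in> {0<..<x/y}" using t assms by (auto simp: divide_simps) (simp add: algebra_simps)
    ultimately show "t \<in> ?g ` {0<..<x/y}" by blast
  qed
  have S: "{0<..<x/y} \<subseteq> {0<..<1}" using \<open>x / y < 1\<close> by auto
  note k = kernel_substitution[where S="{0<..<x/y}" and f = ?f and h = h, OF assms(2) S _ B1 B2 f, unfolded img]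
  show ?thesis
    by (rule has_bochner_integral_lborelI[OF k]) (use assms in \<open>auto simp: tpow_def\<close>)
qed

section \<open>Potentials of weighted polynomials\<close>

lemma tpow_add: "tpow (s + t) x = tpow s x * tpow t x"
  by (simp add: tpow_def powr_add)

lemma tpow_add_nat: "tpow (s + real n) x = tpow s x * x ^ n"
  by (simp add: tpow_def powr_add powr_realpow)

lemma Gamma_plus1_pos: "(x::real) > 0 \<Longrightarrow> Gamma (x + 1) = x * Gamma x"
  by (rule Gamma_plus1) (auto elim!: nonpos_Ints_cases)

text \<open>The factor x^(\<alpha>-1) cancels against (x y)^(\<alpha>-1) in Copson's identity, and
  (T - x)^(\<alpha>-1) makes the right Abel integral act diagonally on powers of T - x. For \<alpha>
  < 1 this is, up to a factor, the equilibrium density of the Riesz kernel on the interval; for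
  \<alpha> = 1 it is the indicator of (0,T).\<close>

definition weight :: "real \<Rightarrow> real \<Rightarrow> real \<Rightarrow> real" where
  "weight T \<alpha> x = tpow (\<alpha> - 1) x * tpow (\<alpha> - 1) (T - x)"

lemma weight_nonneg [simp]: "0 \<le> weight T \<alpha> x"
  by (simp add: weight_def)

lemma weight_eq_0: "x \<notin> {0<..<T} \<Longrightarrow> weight T \<alpha> x = 0"
  by (auto simp: weight_def tpow_def)

lemma measurable_weight [measurable]: "weight T \<alpha> \<in> borel_measurable borel"
  unfolding weight_def by measurable

text \<open>Primitives of weighted functions, their absolute continuity and their membership in the
  energy space are treated here for \<alpha> = 1 as well. The Riesz kernel is introduced only under
  \<alpha> < 1, since |x - y|^(-1) is not integrable.\<close>

locale weighted_interval =
  fixes T \<alpha> :: real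
  assumes T_pos: "0 < T" and \<alpha>_gt: "1/2 < \<alpha>" and \<alpha>_le: "\<alpha> \<le> 1"
begin

lemma bounded_on_interval:
  assumes "continuous_on UNIV (P :: real \<Rightarrow> real)"
  obtains b where "b > 0" "\<And>y. y \<in> {0..T} \<Longrightarrow> \<bar>P y\<bar> \<le> b"
proof -
  have "compact (P ` {0..T})"
    by (intro compact_continuous_image continuous_on_subset[OF assms]) auto
  then have "bounded (P ` {0..T})" by (rule compact_imp_bounded)
  then obtain b where "b > 0" "\<forall>z\<in>P ` {0..T}. norm z \<le> b" by (meson bounded_pos)
  then show ?thesis using that[of b] by auto
qed

end

locale riesz_interval = weighted_interval +
  assumes \<alpha>_lt: "\<alpha> < 1"
begin

definition K :: "real \<Rightarrow> real \<Rightarrow> real" where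
  "K x y = \<bar>x - y\<bar> powr (1 - 2 * \<alpha>)"

lemma K_nonneg [simp]: "0 \<le> K x y"
  by (simp add: K_def)

lemma K_commute: "K x y = K y x"
  by (simp add: K_def abs_minus_commute)

lemma measurable_K [measurable]: "(\<lambda>z. K (fst z) (snd z)) \<in> borel_measurable (borel \<Otimes>\<^sub>M borel)"
  "K x \<in> borel_measurable borel"
  unfolding K_def by measurable

text \<open>Eigenvalues of the two Abel operators of Copson's factorisation: after removal of the
  weights, the right one multiplies (T - y)^n by \<open>\<beta> n\<close> and the left one
  multiplies x^n by \<open>\<gamma> n\<close>.\<close>

definition \<beta> :: "nat \<Rightarrow> real" where "\<beta> n = Beta (1 - \<alpha>) (\<alpha> + real n)"
definition \<gamma> :: "nat \<Rightarrow> real" where "\<gamma> n = Beta (1 - \<alpha>) (2 * \<alpha> - 1 + real n)"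

lemma \<beta>_pos: "\<beta> n > 0" and \<gamma>_pos: "\<gamma> n > 0"
  using \<alpha>_gt \<alpha>_lt by (auto simp: \<beta>_def \<gamma>_def Beta_def intro!: mult_pos_pos divide_pos_pos Gamma_real_pos)

lemma K_copson:
  assumes "0 < x" "0 < y" "x \<noteq> y"
  shows "has_bochner_integral lborel
           (\<lambda>\<tau>. tpow (2 * \<alpha> - 2) \<tau> * (tpow (-\<alpha>) (x - \<tau>) * tpow (-\<alpha>) (y - \<tau>)))
           (\<gamma> 0 * (x * y) powr (\<alpha> - 1) * K x y)"
proof (cases "x < y")
  case True
  then show ?thesis
    using has_bochner_integral_copson_kernel[of x y \<alpha>] assms \<alpha>_gt \<alpha>_lt by (simp add: \<gamma>_def K_def)
next
  case False
  then show ?thesis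
    using has_bochner_integral_copson_kernel[of y x \<alpha>] assms \<alpha>_gt \<alpha>_lt by (simp add: \<gamma>_def K_def mult_ac)
qed

lemma has_bochner_integral_\<beta>:
  assumes "\<tau> < T"
  shows "has_bochner_integral lborel (\<lambda>y. tpow (-\<alpha>) (y - \<tau>) * tpow (\<alpha> - 1) (T - y) * (T - y) ^ n)
           (\<beta> n * (T - \<tau>) ^ n)"
proof -
  have "has_bochner_integral lborel (\<lambda>y. tpow ((1-\<alpha>) - 1) (y - \<tau>) * tpow ((\<alpha> + n) - 1) (T - y))
     ((T - \<tau>) powr ((1-\<alpha>) + (\<alpha> + n) - 1) * Beta (1-\<alpha>) (\<alpha> + n))"
    by (rule has_bochner_integral_Beta) (use assms \<alpha>_gt \<alpha>_lt in auto)
  moreover have "tpow ((\<alpha> + n) - 1) z = tpow (\<alpha> - 1) z * z ^ n" for z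
    using tpow_add_nat[of "\<alpha> - 1" n z] by (simp add: algebra_simps)
  ultimately show ?thesis using assms by (simp add: \<beta>_def powr_realpow mult_ac)
qed

lemma has_bochner_integral_\<gamma>:
  assumes "0 < x"
  shows "has_bochner_integral lborel (\<lambda>\<tau>. tpow (2 * \<alpha> - 2) \<tau> * tpow (-\<alpha>) (x - \<tau>) * \<tau> ^ n)
           (\<gamma> n * (x powr (\<alpha> - 1) * x ^ n))"
proof -
  have "has_bochner_integral lborel (\<lambda>\<tau>. tpow ((2*\<alpha>-1+n) - 1) (\<tau> - 0) * tpow ((1-\<alpha>) - 1) (x - \<tau>))
     ((x - 0) powr ((2*\<alpha>-1+n) + (1-\<alpha>) - 1) * Beta (2*\<alpha>-1+n) (1-\<alpha>))"
    by (rule has_bochner_integral_Beta) (use assms \<alpha>_gt \<alpha>_lt in auto)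
  moreover have "tpow ((2*\<alpha>-1+n) - 1) z = tpow (2*\<alpha> - 2) z * z ^ n" for z
    using tpow_add_nat[of "2*\<alpha> - 2" n z] by (simp add: algebra_simps)
  moreover have "x powr ((2*\<alpha>-1+n) + (1-\<alpha>) - 1) = x powr (\<alpha> - 1) * x ^ n"
    using assms powr_add[of x "\<alpha> - 1" "real n"] by (simp add: powr_realpow algebra_simps)
  ultimately show ?thesis by (simp add: \<gamma>_def mult_ac Beta_commute)
qed

text \<open>For P = 1 both iterated integrals are the explicit Beta values for n = 0, and all
  factors are nonnegative. A general P enters only through its bound on [0,T], outside of which the
  truncated powers vanish.\<close>

lemma copson_integrable:
  assumes "0 < x" "x < T" and P: "continuous_on UNIV P"
  shows "integrable (lborel \<Otimes>\<^sub>M lborel) (\<lambda>(\<tau>, y). (tpow (2 * \<alpha> - 2) \<tau> * tpow (-\<alpha>) (x - \<tau>)) * 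
          (tpow (-\<alpha>) (y - \<tau>) * tpow (\<alpha> - 1) (T - y) * P y))"
proof -
  have [measurable]: "P \<in> borel_measurable borel" using P by (rule borel_measurable_continuous_onI)
  let ?g = "\<lambda>(\<tau>, y). (tpow (2 * \<alpha> - 2) \<tau> * tpow (-\<alpha>) (x - \<tau>)) * (tpow (-\<alpha>) (y - \<tau>) * tpow (\<alpha> - 1) (T - y))"
  have inner: "has_bochner_integral lborel (\<lambda>y. ?g (\<tau>, y)) (tpow (2 * \<alpha> - 2) \<tau> * tpow (-\<alpha>) (x - \<tau>) * \<beta> 0)" for \<tau>
  proof (cases "\<tau> < x")
    case True
    then show ?thesis using has_bochner_integral_\<beta>[of \<tau> 0] assms 
      by (auto intro!: has_bochner_integral_mult_right)
  next
    case False
    then show ?thesis by (simp add: tpow_zero has_bochner_integral_zero)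
  qed
  have "integrable (lborel \<Otimes>\<^sub>M lborel) ?g"
  proof (rule lborel_pair.Fubini_integrable)
    have "(\<lambda>\<tau>. \<integral>y. norm (?g (\<tau>, y)) \<partial>lborel) = (\<lambda>\<tau>. \<beta> 0 * (tpow (2 * \<alpha> - 2) \<tau> * tpow (-\<alpha>) (x - \<tau>) * \<tau> ^ 0))"
      using inner by (auto simp: has_bochner_integral_iff)
    then show "integrable lborel (\<lambda>\<tau>. \<integral>y. norm (?g (\<tau>, y)) \<partial>lborel)"
      using has_bochner_integral_\<gamma>[OF assms(1), of 0] by (auto simp: has_bochner_integral_iff)
    show "AE \<tau> in lborel. integrable lborel (\<lambda>y. ?g (\<tau>, y))"
      using inner by (auto simp: has_bochner_integral_iff)
  qed auto
  then have g: "integrable (lborel \<Otimes>\<^sub>M lborel) (\<lambda>z. b * ?g z)" for b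
    by (rule integrable_mult_right)
  obtain b where b: "b > 0" "\<And>y. y \<in> {0..T} \<Longrightarrow> \<bar>P y\<bar> \<le> b"
    using bounded_on_interval[OF P] by blast
  show ?thesis
  proof (rule Bochner_Integration.integrable_bound[OF g[of b]])
    have "norm (?g (\<tau>, y) * P y) \<le> norm (b * ?g (\<tau>, y))" for \<tau> y
    proof (cases "y \<in> {0..T}")
      case True
      then show ?thesis using b(1) b(2)[OF True] by (simp add: abs_mult mult_mono mult.commute)
    next
      case False
      then have "?g (\<tau>, y) = 0" by (auto simp: tpow_def)
      then show ?thesis by auto
    qed
    then show "AE z in lborel \<Otimes>\<^sub>M lborel. norm ((\<lambda>(\<tau>, y). (tpow (2 * \<alpha> - 2) \<tau> * tpow (-\<alpha>) (x - \<tau>)) * 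
          (tpow (-\<alpha>) (y - \<tau>) * tpow (\<alpha> - 1) (T - y) * P y)) z) \<le> norm (b * ?g z)"
      by (intro AE_I2) (auto simp: mult_ac)
  qed auto
qed

text \<open>Inserting Copson's identity for the kernel and exchanging the integrals writes the
  potential as a composition of two Abel operators: a right one in y, then a left one in \<tau>.
  Each of them is of Volterra type and can be inverted separately.\<close>

lemma potential_copson:
  assumes x: "0 < x" "x < T" and P: "continuous_on UNIV P"
  shows "integrable lborel (\<lambda>y. K x y * (weight T \<alpha> y * P y))"
    and "(\<integral>y. K x y * (weight T \<alpha> y * P y) \<partial>lborel) =
      x powr (1 - \<alpha>) / \<gamma> 0 * (\<integral>\<tau>. tpow (2 * \<alpha> - 2) \<tau> * tpow (-\<alpha>) (x - \<tau>) * 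
        (\<integral>y. tpow (-\<alpha>) (y - \<tau>) * tpow (\<alpha> - 1) (T - y) * P y \<partial>lborel) \<partial>lborel)"
proof -
  have [measurable]: "P \<in> borel_measurable borel" using P by (rule borel_measurable_continuous_onI)
  let ?f = "\<lambda>\<tau> y. (tpow (2 * \<alpha> - 2) \<tau> * tpow (-\<alpha>) (x - \<tau>)) * (tpow (-\<alpha>) (y - \<tau>) * tpow (\<alpha> - 1) (T - y) * P y)"
  note int = copson_integrable[OF assms]
  let ?c = "x powr (1 - \<alpha>) / \<gamma> 0"
  have eq: "?c * (\<integral>\<tau>. ?f \<tau> y \<partial>lborel) = K x y * (weight T \<alpha> y * P y)" if "y \<noteq> x" for y
  proof (cases "y \<in> {0<..<T}")
    case True
    have "(\<integral>\<tau>. ?f \<tau> y \<partial>lborel) = (\<integral>\<tau>. (tpow (\<alpha> - 1) (T - y) * P y) * (tpow (2 * \<alpha> - 2) \<tau> * (tpow (-\<alpha>) (x - \<tau>) * tpow (-\<alpha>) (y - \<tau>))) \<partial>lborel)"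
      by (intro Bochner_Integration.integral_cong) (auto simp: mult_ac)
    also have "\<dots> = (tpow (\<alpha> - 1) (T - y) * P y) * (\<gamma> 0 * (x * y) powr (\<alpha> - 1) * K x y)"
      using K_copson[OF x(1), of y] True that by (simp add: has_bochner_integral_iff)
    finally have *: "(\<integral>\<tau>. ?f \<tau> y \<partial>lborel) = (tpow (\<alpha> - 1) (T - y) * P y) * (\<gamma> 0 * (x * y) powr (\<alpha> - 1) * K x y)" .
    have "x powr (1 - \<alpha>) * (x * y) powr (\<alpha> - 1) = tpow (\<alpha> - 1) y"
      using x True by (simp add: tpow_pos powr_mult powr_diff)
    then have "weight T \<alpha> y = x powr (1 - \<alpha>) * (x * y) powr (\<alpha> - 1) * tpow (\<alpha> - 1) (T - y)"
      by (simp add: weight_def)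
    then show ?thesis using * \<gamma>_pos[of 0] by simp
  next
    case False
    then have 1: "weight T \<alpha> y = 0" by (rule weight_eq_0)
    have "?f \<tau> y = 0" for \<tau> using False by (auto simp: tpow_def)
    then have "(\<integral>\<tau>. ?f \<tau> y \<partial>lborel) = 0" by (simp only: Bochner_Integration.integral_zero)
    with 1 show ?thesis by simp
  qed
  \<comment> \<open>Copson's identity fails only at the diagonal point y = x, a null set.\<close>
  have AE: "AE y in lborel. ?c * (\<integral>\<tau>. ?f \<tau> y \<partial>lborel) = K x y * (weight T \<alpha> y * P y)"
    using AE_lborel_singleton[of x] by eventually_elim (use eq in auto)
  have "integrable lborel (\<lambda>y. ?c * (\<integral>\<tau>. ?f \<tau> y \<partial>lborel))"
    by (intro integrable_mult_right lborel_pair.integrable_snd[OF int])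
  then show "integrable lborel (\<lambda>y. K x y * (weight T \<alpha> y * P y))"
    by (rule integrable_cong_AE_imp) (use AE in auto)
  have "(\<integral>y. K x y * (weight T \<alpha> y * P y) \<partial>lborel) = (\<integral>y. ?c * (\<integral>\<tau>. ?f \<tau> y \<partial>lborel) \<partial>lborel)"
    by (rule integral_cong_AE) (use AE in \<open>auto\<close>)
  also have "\<dots> = ?c * (\<integral>\<tau>. (\<integral>y. ?f \<tau> y \<partial>lborel) \<partial>lborel)"
    using lborel_pair.Fubini_integral[OF int] by simp
  finally show "(\<integral>y. K x y * (weight T \<alpha> y * P y) \<partial>lborel) =
      x powr (1 - \<alpha>) / \<gamma> 0 * (\<integral>\<tau>. tpow (2 * \<alpha> - 2) \<tau> * tpow (-\<alpha>) (x - \<tau>) * 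
        (\<integral>y. tpow (-\<alpha>) (y - \<tau>) * tpow (\<alpha> - 1) (T - y) * P y \<partial>lborel) \<partial>lborel)"
    by simp
qed

text \<open>The hypothesis expresses one polynomial both in powers of \<tau> and in powers of T -
  \<tau>, the bases in which the left and the right Abel operator are diagonal. Hence prescribing a
  polynomial potential amounts to dividing by \<open>\<gamma> i\<close>, re-expanding about T and
  dividing by \<open>\<beta> j\<close>.\<close>

lemma potential_polynomial:
  fixes r c :: "nat \<Rightarrow> real"
  assumes Q: "\<And>\<tau>. (\<Sum>i\<le>n. r i / \<gamma> i * \<tau> ^ i) = (\<Sum>j\<le>m. c j * \<beta> j * (T - \<tau>) ^ j)"
    and x: "0 < x" "x < T"
  shows "(\<integral>y. K x y * (weight T \<alpha> y * (\<gamma> 0 * (\<Sum>j\<le>m. c j * (T - y) ^ j))) \<partial>lborel) = (\<Sum>i\<le>n. r i * x ^ i)"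
proof -
  let ?P = "\<lambda>y. \<gamma> 0 * (\<Sum>j\<le>m. c j * (T - y) ^ j)"
  have cont: "continuous_on UNIV ?P" by (intro continuous_intros)
  have inner: "(\<integral>y. tpow (-\<alpha>) (y - \<tau>) * tpow (\<alpha> - 1) (T - y) * ?P y \<partial>lborel) = \<gamma> 0 * (\<Sum>i\<le>n. r i / \<gamma> i * \<tau> ^ i)"
    if "\<tau> < T" for \<tau>
  proof -
    have "has_bochner_integral lborel (\<lambda>y. \<gamma> 0 * (\<Sum>j\<le>m. c j * (tpow (-\<alpha>) (y - \<tau>) * tpow (\<alpha> - 1) (T - y) * (T - y) ^ j)))
        (\<gamma> 0 * (\<Sum>j\<le>m. c j * (\<beta> j * (T - \<tau>) ^ j)))"
      by (intro has_bochner_integral_mult_right has_bochner_integral_sum has_bochner_integral_\<beta> that)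
    also have "(\<lambda>y. \<gamma> 0 * (\<Sum>j\<le>m. c j * (tpow (-\<alpha>) (y - \<tau>) * tpow (\<alpha> - 1) (T - y) * (T - y) ^ j))) =
       (\<lambda>y. tpow (-\<alpha>) (y - \<tau>) * tpow (\<alpha> - 1) (T - y) * ?P y)"
      by (simp add: sum_distrib_left mult_ac)
    finally show ?thesis unfolding Q has_bochner_integral_iff mult.assoc by (rule conjunct2)
  qed
  have "(\<integral>\<tau>. tpow (2 * \<alpha> - 2) \<tau> * tpow (-\<alpha>) (x - \<tau>) * 
        (\<integral>y. tpow (-\<alpha>) (y - \<tau>) * tpow (\<alpha> - 1) (T - y) * ?P y \<partial>lborel) \<partial>lborel) = 
     (\<integral>\<tau>. \<gamma> 0 * (\<Sum>i\<le>n. r i / \<gamma> i * (tpow (2 * \<alpha> - 2) \<tau> * tpow (-\<alpha>) (x - \<tau>) * \<tau> ^ i)) \<partial>lborel)"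
  proof (rule Bochner_Integration.integral_cong[OF refl])
    fix \<tau>
    show "tpow (2 * \<alpha> - 2) \<tau> * tpow (-\<alpha>) (x - \<tau>) * 
        (\<integral>y. tpow (-\<alpha>) (y - \<tau>) * tpow (\<alpha> - 1) (T - y) * ?P y \<partial>lborel) = 
      \<gamma> 0 * (\<Sum>i\<le>n. r i / \<gamma> i * (tpow (2 * \<alpha> - 2) \<tau> * tpow (-\<alpha>) (x - \<tau>) * \<tau> ^ i))"
    proof (cases "\<tau> < x")
      case True
      then have "\<tau> < T" using x by simp
      show ?thesis unfolding inner[OF \<open>\<tau> < T\<close>] by (simp add: sum_distrib_left mult_ac)
    next
      case False
      then show ?thesis by (simp add: tpow_zero)
    qed
  qed
  also have "has_bochner_integral lborel (\<lambda>\<tau>. \<gamma> 0 * (\<Sum>i\<le>n. r i / \<gamma> i * (tpow (2 * \<alpha> - 2) \<tau> * tpow (-\<alpha>) (x - \<tau>) * \<tau> ^ i)))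
     (\<gamma> 0 * (\<Sum>i\<le>n. r i / \<gamma> i * (\<gamma> i * (x powr (\<alpha> - 1) * x ^ i))))"
    by (intro has_bochner_integral_mult_right has_bochner_integral_sum has_bochner_integral_\<gamma> x)
  then have "(\<integral>\<tau>. \<gamma> 0 * (\<Sum>i\<le>n. r i / \<gamma> i * (tpow (2 * \<alpha> - 2) \<tau> * tpow (-\<alpha>) (x - \<tau>) * \<tau> ^ i)) \<partial>lborel) 
      = \<gamma> 0 * (\<Sum>i\<le>n. r i / \<gamma> i * (\<gamma> i * (x powr (\<alpha> - 1) * x ^ i)))"
    by (simp add: has_bochner_integral_iff)
  also have "\<dots> = \<gamma> 0 * x powr (\<alpha> - 1) * (\<Sum>i\<le>n. r i * x ^ i)"
    using \<gamma>_pos by (simp add: sum_distrib_left mult_ac less_imp_neq[symmetric])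
  finally have *: "(\<integral>\<tau>. tpow (2 * \<alpha> - 2) \<tau> * tpow (-\<alpha>) (x - \<tau>) * 
        (\<integral>y. tpow (-\<alpha>) (y - \<tau>) * tpow (\<alpha> - 1) (T - y) * ?P y \<partial>lborel) \<partial>lborel) = 
      \<gamma> 0 * x powr (\<alpha> - 1) * (\<Sum>i\<le>n. r i * x ^ i)" .
  have "x powr (1 - \<alpha>) * x powr (\<alpha> - 1) = 1"
    using x by (simp flip: powr_add)
  then show ?thesis
    unfolding potential_copson(2)[OF x cont] * using \<gamma>_pos[of 0] by simp
qed

text \<open>The increments of 1/\<gamma> are themselves Beta values, so the multiplier 1/\<gamma> is
  a constant plus a sum of moments. This is what allows the coefficientwise division to be read as
  an integral operator; \<open>inverse_\<beta>\<close> does the same for the other factor.\<close>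

lemma inverse_\<gamma>:
  "1 / \<gamma> n = 1 / \<gamma> 0 + (1 - \<alpha>) / (Gamma (1 - \<alpha>) * Gamma \<alpha>) * (\<Sum>k<n. Beta (\<alpha> + real k) \<alpha>)"
proof (induction n)
  case (Suc n)
  have G: "1 / \<gamma> n = Gamma (\<alpha> + n) / (Gamma (1-\<alpha>) * Gamma (2*\<alpha>-1+n))" for n
    using \<alpha>_gt \<alpha>_lt by (simp add: \<gamma>_def Beta_def algebra_simps)
  have pos: "Gamma (\<alpha> + n) > 0" "Gamma (1-\<alpha>) > 0" "Gamma (2*\<alpha>-1+n) > 0" "2*\<alpha>-1+n > 0" "\<alpha> + n > 0" "Gamma \<alpha> > 0"
    using \<alpha>_gt \<alpha>_lt by (auto intro!: Gamma_real_pos)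
  have 1: "Gamma (\<alpha> + Suc n) = (\<alpha> + n) * Gamma (\<alpha> + n)"
    using Gamma_plus1_pos[of "\<alpha> + n"] pos by (simp add: algebra_simps)
  have 2: "Gamma (2*\<alpha>-1+Suc n) = (2*\<alpha>-1+n) * Gamma (2*\<alpha>-1+n)"
    using Gamma_plus1_pos[of "2*\<alpha>-1+n"] pos by (simp add: algebra_simps)
  have 3: "Gamma (\<alpha> + n + \<alpha>) = (2*\<alpha>-1+n) * Gamma (2*\<alpha>-1+n)"
    using Gamma_plus1_pos[of "2*\<alpha>-1+n"] pos by (simp add: algebra_simps)
  have "1 / \<gamma> (Suc n) = 1 / \<gamma> n + (1 - \<alpha>) / (Gamma (1 - \<alpha>) * Gamma \<alpha>) * Beta (\<alpha> + n) \<alpha>"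
    unfolding G Beta_def 1 2 3 using pos by (simp add: divide_simps) (simp add: algebra_simps)
  then show ?case using Suc by (simp add: algebra_simps)
qed simp

lemma inverse_\<beta>:
  "\<beta> 0 / \<beta> n = 1 + (1 - \<alpha>) * (\<Sum>k<n. Beta \<alpha> (real k + 1))"
proof (induction n)
  case 0
  then show ?case using \<beta>_pos[of 0] by simp
next
  case (Suc n)
  have G: "\<beta> 0 / \<beta> n = Gamma \<alpha> * fact n / Gamma (\<alpha> + n)" for n
  proof -
    have "Gamma (1 - \<alpha>) > 0" using \<alpha>_lt by (simp add: Gamma_real_pos)
    then show ?thesis using Gamma_fact[of n, where 'a = real] by (simp add: \<beta>_def Beta_def algebra_simps)
  qed
  have pos: "Gamma (\<alpha> + n) > 0" "\<alpha> + n > 0" "Gamma \<alpha> > 0"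
    using \<alpha>_gt \<alpha>_lt by (auto intro!: Gamma_real_pos)
  have 1: "Gamma (\<alpha> + Suc n) = (\<alpha> + n) * Gamma (\<alpha> + n)"
    using Gamma_plus1_pos[of "\<alpha> + n"] pos by (simp add: algebra_simps)
  have 2: "Gamma (\<alpha> + (real n + 1)) = (\<alpha> + n) * Gamma (\<alpha> + n)"
    using Gamma_plus1_pos[of "\<alpha> + n"] pos by (simp add: algebra_simps)
  have 3: "Gamma (real n + 1) = fact n" using Gamma_fact[of n, where 'a = real] by (simp add: add.commute)
  have "\<beta> 0 / \<beta> (Suc n) = \<beta> 0 / \<beta> n + (1 - \<alpha>) * Beta \<alpha> (real n + 1)"
    unfolding G Beta_def 1 2 3 using pos by (simp add: divide_simps) (simp add: algebra_simps)
  then show ?case using Suc by (simp add: algebra_simps)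
qed

end

section \<open>Bounds for the inverse potential\<close>

lemma tpow_mult_self: "tpow (s - 1) x * x = tpow s x"
  using tpow_add_nat[of "s - 1" 1 x] by simp

lemma tpow_mult_sqrt: "tpow s x * sqrt x = tpow (s + 1/2) x"
  by (simp add: tpow_def powr_add powr_half_sqrt)

text \<open>Interpolation between two bounds: half a power of each is kept.\<close>

lemma min_le_sqrt_mult:
  fixes z a b :: real
  assumes "0 \<le> z" "z \<le> a" "z \<le> b"
  shows "z \<le> sqrt (a * b)"
  using assms by (intro real_le_rsqrt) (auto simp: power2_eq_square intro!: mult_mono)

lemma has_bochner_integral_norm_le:
  fixes f g :: "real \<Rightarrow> real"
  assumes "has_bochner_integral lborel f a" "has_bochner_integral lborel g b" "\<And>x. \<bar>f x\<bar> \<le> g x"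
  shows "\<bar>a\<bar> \<le> b"
proof -
  have "\<bar>integral\<^sup>L lborel f\<bar> \<le> integral\<^sup>L lborel g"
    using assms integral_abs_bound_integral[of lborel f g] by (auto simp: has_bochner_integral_iff)
  then show ?thesis using assms by (auto simp: has_bochner_integral_iff)
qed

context riesz_interval begin

text \<open>The exponent \<alpha> - 2 at \<sigma> = 1 is not integrable by itself; the factor 1 -
  \<sigma>^n supplies one power of 1 - \<sigma>, and the geometric sum for the quotient gives the
  Beta values.\<close>

lemma has_bochner_integral_diff_power_left:
  "has_bochner_integral lborel (\<lambda>\<sigma>. tpow (\<alpha> - 1) \<sigma> * tpow (\<alpha> - 2) (1 - \<sigma>) * (1 - \<sigma> ^ n))
     (\<Sum>k<n. Beta (\<alpha> + real k) \<alpha>)"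
proof -
  have "has_bochner_integral lborel (\<lambda>\<sigma>. \<Sum>k<n. tpow ((\<alpha> + real k) - 1) \<sigma> * tpow (\<alpha> - 1) (1 - \<sigma>))
     (\<Sum>k<n. Beta (\<alpha> + real k) \<alpha>)"
    by (intro has_bochner_integral_sum has_bochner_integral_Beta01) (use \<alpha>_gt in auto)
  moreover have "(\<Sum>k<n. tpow ((\<alpha> + real k) - 1) \<sigma> * tpow (\<alpha> - 1) (1 - \<sigma>)) =
      tpow (\<alpha> - 1) \<sigma> * tpow (\<alpha> - 2) (1 - \<sigma>) * (1 - \<sigma> ^ n)" for \<sigma>
  proof -
    have "tpow ((\<alpha> + real k) - 1) \<sigma> = tpow (\<alpha> - 1) \<sigma> * \<sigma> ^ k" for k
      using tpow_add_nat[of "\<alpha> - 1" k \<sigma>] by (simp add: algebra_simps)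
    moreover have "tpow (\<alpha> - 1) (1 - \<sigma>) = tpow (\<alpha> - 2) (1 - \<sigma>) * (1 - \<sigma>)"
      using tpow_mult_self[of "\<alpha> - 1" "1 - \<sigma>"] by simp
    ultimately show ?thesis
      by (simp add: one_diff_power_eq sum_distrib_left mult_ac)
  qed
  ultimately show ?thesis by simp
qed

lemma has_bochner_integral_diff_power_right:
  "has_bochner_integral lborel (\<lambda>v. tpow (\<alpha> - 2) v * tpow 0 (1 - v) * (1 - (1 - v) ^ n))
     (\<Sum>k<n. Beta \<alpha> (real k + 1))"
proof -
  have "has_bochner_integral lborel (\<lambda>v. \<Sum>k<n. tpow (\<alpha> - 1) v * tpow ((real k + 1) - 1) (1 - v))
     (\<Sum>k<n. Beta \<alpha> (real k + 1))"
    by (intro has_bochner_integral_sum has_bochner_integral_Beta01) (use \<alpha>_gt in auto)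
  moreover have "(\<Sum>k<n. tpow (\<alpha> - 1) v * tpow ((real k + 1) - 1) (1 - v)) =
      tpow (\<alpha> - 2) v * tpow 0 (1 - v) * (1 - (1 - v) ^ n)" for v
  proof -
    have "tpow ((real k + 1) - 1) (1 - v) = tpow 0 (1 - v) * (1 - v) ^ k" for k
      using tpow_add_nat[of 0 k "1 - v"] by simp
    moreover have "tpow (\<alpha> - 1) v = tpow (\<alpha> - 2) v * v"
      using tpow_mult_self[of "\<alpha> - 1" v] by simp
    ultimately show ?thesis
      by (simp add: one_diff_power_eq sum_distrib_left mult_ac)
  qed
  ultimately show ?thesis by simp
qed

definition C\<^sub>0 :: real where "C\<^sub>0 = (1 - \<alpha>) / (Gamma (1 - \<alpha>) * Gamma \<alpha>)"

lemma C0_nonneg: "0 \<le> C\<^sub>0"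
  using \<alpha>_gt \<alpha>_lt by (auto simp: C\<^sub>0_def intro!: divide_nonneg_nonneg mult_nonneg_nonneg Gamma_real_nonneg)

text \<open>
  The two Abel inversions in Marchaud form: on monomials they multiply by \<open>1 / \<gamma> n\<close> and \<open>1 / \<beta> n\<close>,
  and they need no more than Hoelder continuity of the inverted function.
\<close>

lemma marchaud_left:
  fixes r :: "nat \<Rightarrow> real" and n :: nat
  defines "R \<equiv> \<lambda>x. \<Sum>i\<le>n. r i * x ^ i"
  shows "has_bochner_integral lborel 
    (\<lambda>\<sigma>. tpow (\<alpha> - 1) \<sigma> * tpow (\<alpha> - 2) (1 - \<sigma>) * (C\<^sub>0 * (R \<tau> - R (\<tau> * \<sigma>))))
    ((\<Sum>i\<le>n. r i / \<gamma> i * \<tau> ^ i) - R \<tau> / \<gamma> 0)"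
proof -
  have "has_bochner_integral lborel (\<lambda>\<sigma>. \<Sum>i\<le>n. (C\<^sub>0 * r i * \<tau> ^ i) * (tpow (\<alpha> - 1) \<sigma> * tpow (\<alpha> - 2) (1 - \<sigma>) * (1 - \<sigma> ^ i)))
    (\<Sum>i\<le>n. (C\<^sub>0 * r i * \<tau> ^ i) * (\<Sum>k<i. Beta (\<alpha> + real k) \<alpha>))"
    by (intro has_bochner_integral_sum has_bochner_integral_mult_right has_bochner_integral_diff_power_left)
  also have "(\<lambda>\<sigma>. \<Sum>i\<le>n. (C\<^sub>0 * r i * \<tau> ^ i) * (tpow (\<alpha> - 1) \<sigma> * tpow (\<alpha> - 2) (1 - \<sigma>) * (1 - \<sigma> ^ i))) =
     (\<lambda>\<sigma>. tpow (\<alpha> - 1) \<sigma> * tpow (\<alpha> - 2) (1 - \<sigma>) * (C\<^sub>0 * (R \<tau> - R (\<tau> * \<sigma>))))"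
  proof
    fix \<sigma>
    have "R \<tau> - R (\<tau> * \<sigma>) = (\<Sum>i\<le>n. r i * \<tau> ^ i * (1 - \<sigma> ^ i))"
      unfolding R_def by (simp only: power_mult_distrib right_diff_distrib sum_subtractf mult.assoc mult_1_right)
    then show "(\<Sum>i\<le>n. (C\<^sub>0 * r i * \<tau> ^ i) * (tpow (\<alpha> - 1) \<sigma> * tpow (\<alpha> - 2) (1 - \<sigma>) * (1 - \<sigma> ^ i))) =
      tpow (\<alpha> - 1) \<sigma> * tpow (\<alpha> - 2) (1 - \<sigma>) * (C\<^sub>0 * (R \<tau> - R (\<tau> * \<sigma>)))"
      by (simp add: sum_distrib_left mult_ac)
  qed
  also have "(\<Sum>i\<le>n. (C\<^sub>0 * r i * \<tau> ^ i) * (\<Sum>k<i. Beta (\<alpha> + real k) \<alpha>)) = (\<Sum>i\<le>n. r i * \<tau> ^ i * (1 / \<gamma> i - 1 / \<gamma> 0))"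
  proof (rule sum.cong[OF refl])
    fix i
    have "1 / \<gamma> i - 1 / \<gamma> 0 = C\<^sub>0 * (\<Sum>k<i. Beta (\<alpha> + real k) \<alpha>)"
      using inverse_\<gamma>[of i] unfolding C\<^sub>0_def by linarith
    then show "(C\<^sub>0 * r i * \<tau> ^ i) * (\<Sum>k<i. Beta (\<alpha> + real k) \<alpha>) = r i * \<tau> ^ i * (1 / \<gamma> i - 1 / \<gamma> 0)"
      by (simp only: mult_ac)
  qed
  also have "\<dots> = (\<Sum>i\<le>n. r i / \<gamma> i * \<tau> ^ i) - R \<tau> / \<gamma> 0"
    by (simp add: R_def sum_subtractf sum_divide_distrib algebra_simps)
  finally show ?thesis .
qed

lemma marchaud_right:
  fixes c :: "nat \<Rightarrow> real" and m :: nat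
  defines "Q \<equiv> \<lambda>x. \<Sum>j\<le>m. c j * \<beta> j * (T - x) ^ j"
  shows "has_bochner_integral lborel 
    (\<lambda>v. tpow (\<alpha> - 2) v * tpow 0 (1 - v) * ((1 - \<alpha>) * (Q x - Q (x + (T - x) * v))))
    (\<beta> 0 * (\<Sum>j\<le>m. c j * (T - x) ^ j) - Q x)"
proof -
  have "has_bochner_integral lborel (\<lambda>v. \<Sum>j\<le>m. ((1 - \<alpha>) * (c j * \<beta> j) * (T - x) ^ j) * (tpow (\<alpha> - 2) v * tpow 0 (1 - v) * (1 - (1 - v) ^ j)))
    (\<Sum>j\<le>m. ((1 - \<alpha>) * (c j * \<beta> j) * (T - x) ^ j) * (\<Sum>k<j. Beta \<alpha> (real k + 1)))"
    by (intro has_bochner_integral_sum has_bochner_integral_mult_right has_bochner_integral_diff_power_right)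
  also have "(\<lambda>v. \<Sum>j\<le>m. ((1 - \<alpha>) * (c j * \<beta> j) * (T - x) ^ j) * (tpow (\<alpha> - 2) v * tpow 0 (1 - v) * (1 - (1 - v) ^ j))) =
    (\<lambda>v. tpow (\<alpha> - 2) v * tpow 0 (1 - v) * ((1 - \<alpha>) * (Q x - Q (x + (T - x) * v))))"
  proof
    fix v
    have "T - (x + (T - x) * v) = (T - x) * (1 - v)" by (simp add: algebra_simps)
    then have "(T - (x + (T - x) * v)) ^ j = (T - x) ^ j * (1 - v) ^ j" for j
      by (simp only: power_mult_distrib)
    then have "Q x - Q (x + (T - x) * v) = (\<Sum>j\<le>m. c j * \<beta> j * (T - x) ^ j * (1 - (1 - v) ^ j))"
      unfolding Q_def by (simp only: right_diff_distrib sum_subtractf mult.assoc mult_1_right)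
    then show "(\<Sum>j\<le>m. ((1 - \<alpha>) * (c j * \<beta> j) * (T - x) ^ j) * (tpow (\<alpha> - 2) v * tpow 0 (1 - v) * (1 - (1 - v) ^ j))) =
      tpow (\<alpha> - 2) v * tpow 0 (1 - v) * ((1 - \<alpha>) * (Q x - Q (x + (T - x) * v)))"
      by (simp add: sum_distrib_left mult_ac)
  qed
  also have "(\<Sum>j\<le>m. ((1 - \<alpha>) * (c j * \<beta> j) * (T - x) ^ j) * (\<Sum>k<j. Beta \<alpha> (real k + 1))) = 
     (\<Sum>j\<le>m. (c j * \<beta> j) * (T - x) ^ j * (\<beta> 0 / \<beta> j - 1))"
    by (rule sum.cong) (auto simp: inverse_\<beta>)
  also have "\<dots> = \<beta> 0 * (\<Sum>j\<le>m. c j * (T - x) ^ j) - Q x"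
    using \<beta>_pos by (simp add: Q_def right_diff_distrib sum_subtractf sum_distrib_left mult_ac less_imp_neq[symmetric])
  finally show ?thesis .
qed

lemma Beta_nonneg: "p > 0 \<Longrightarrow> q > 0 \<Longrightarrow> 0 \<le> Beta p (q::real)"
  by (auto simp: Beta_def intro!: divide_nonneg_nonneg mult_nonneg_nonneg Gamma_real_nonneg)

definition C\<^sub>1 :: real where "C\<^sub>1 = sqrt T / \<gamma> 0 + 2 * C\<^sub>0 * sqrt T * Beta \<alpha> (\<alpha> - 1/2)"

text \<open>For the sup bound, Lipschitz continuity supplies a full power of 1 - \<sigma> against
  the singular factor. For the Hoelder bound the double difference is at most 2 L T (1 - \<sigma>)
  and at most 2 L |x - y|; the geometric mean of the two leaves (1 - \<sigma>)^(\<alpha>-3/2),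
  integrable since \<alpha> > 1/2, times the square root of |x - y|. The constants involve only a,
  L, T and \<alpha>, not the degree.\<close>

lemma Q_bounds:
  fixes r :: "nat \<Rightarrow> real" and n :: nat
  defines "R \<equiv> \<lambda>x. \<Sum>i\<le>n. r i * x ^ i" and "Q \<equiv> \<lambda>x. \<Sum>i\<le>n. r i / \<gamma> i * x ^ i"
  assumes a: "\<And>x. x \<in> {0..T} \<Longrightarrow> \<bar>R x\<bar> \<le> a"
    and L: "\<And>x y. x \<in> {0..T} \<Longrightarrow> y \<in> {0..T} \<Longrightarrow> \<bar>R x - R y\<bar> \<le> L * \<bar>x - y\<bar>"
    and x: "x \<in> {0..T}" and y: "y \<in> {0..T}"
  shows "\<bar>Q x\<bar> \<le> a / \<gamma> 0 + C\<^sub>0 * L * T * Beta \<alpha> \<alpha>"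
    and "\<bar>Q x - Q y\<bar> \<le> L * C\<^sub>1 * sqrt \<bar>x - y\<bar>"
proof -
  let ?J = "\<lambda>\<sigma>. tpow (\<alpha> - 1) \<sigma> * tpow (\<alpha> - 2) (1 - \<sigma>)"
  have hb: "has_bochner_integral lborel (\<lambda>\<sigma>. ?J \<sigma> * (C\<^sub>0 * (R \<tau> - R (\<tau> * \<sigma>)))) (Q \<tau> - R \<tau> / \<gamma> 0)" for \<tau>
    unfolding R_def Q_def by (rule marchaud_left)
  have L0: "0 \<le> L" 
  proof -
    have "0 \<le> \<bar>R 0 - R T\<bar>" by simp
    also have "\<dots> \<le> L * T" using L[of 0 T] T_pos by simp
    finally show ?thesis using T_pos by (simp add: zero_le_mult_iff)
  qed
  have J0: "?J \<sigma> = 0" if "\<sigma> \<notin> {0<..<1}" for \<sigma> using that by (auto simp: tpow_def)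
  have in_T: "t * \<sigma> \<in> {0..T}" if "t \<in> {0..T}" "\<sigma> \<in> {0<..<1}" for t \<sigma>
    using that mult_left_le[of \<sigma> t] by auto
  have d: "\<bar>R t - R (t * \<sigma>)\<bar> \<le> L * (T * (1 - \<sigma>))" if "t \<in> {0..T}" "\<sigma> \<in> {0<..<1}" for t \<sigma>
  proof -
    have "\<bar>R t - R (t * \<sigma>)\<bar> \<le> L * \<bar>t - t * \<sigma>\<bar>" using L[OF that(1) in_T[OF that]] .
    also have "t - t * \<sigma> = t * (1 - \<sigma>)" by (simp add: algebra_simps)
    also have "\<bar>t * (1 - \<sigma>)\<bar> \<le> T * (1 - \<sigma>)" using that by (auto simp: abs_mult intro!: mult_mono)
    finally show ?thesis using L0 by (simp add: mult_left_mono)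
  qed
  have "\<bar>Q x - R x / \<gamma> 0\<bar> \<le> C\<^sub>0 * L * T * Beta \<alpha> \<alpha>"
  proof (rule has_bochner_integral_norm_le[OF hb])
    show "has_bochner_integral lborel (\<lambda>\<sigma>. C\<^sub>0 * L * T * (tpow (\<alpha> - 1) \<sigma> * tpow (\<alpha> - 1) (1 - \<sigma>))) (C\<^sub>0 * L * T * Beta \<alpha> \<alpha>)"
      by (intro has_bochner_integral_mult_right has_bochner_integral_Beta01) (use \<alpha>_gt in auto)
    fix \<sigma>
    show "\<bar>?J \<sigma> * (C\<^sub>0 * (R x - R (x * \<sigma>)))\<bar> \<le> C\<^sub>0 * L * T * (tpow (\<alpha> - 1) \<sigma> * tpow (\<alpha> - 1) (1 - \<sigma>))"
    proof (cases "\<sigma> \<in> {0<..<1}")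
      case True
      have "\<bar>?J \<sigma> * (C\<^sub>0 * (R x - R (x * \<sigma>)))\<bar> = ?J \<sigma> * (C\<^sub>0 * \<bar>R x - R (x * \<sigma>)\<bar>)"
        using C0_nonneg by (simp add: abs_mult)
      also have "\<dots> \<le> ?J \<sigma> * (C\<^sub>0 * (L * (T * (1 - \<sigma>))))"
        by (intro mult_left_mono d x True C0_nonneg) auto
      also have "\<dots> = C\<^sub>0 * L * T * (tpow (\<alpha> - 1) \<sigma> * (tpow ((\<alpha> - 1) - 1) (1 - \<sigma>) * (1 - \<sigma>)))"
        by (simp add: mult_ac)
      also have "\<dots> = C\<^sub>0 * L * T * (tpow (\<alpha> - 1) \<sigma> * tpow (\<alpha> - 1) (1 - \<sigma>))"
        by (subst tpow_mult_self) simp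
      finally show ?thesis .
    next
      case False
      then have "tpow (\<alpha> - 1) \<sigma> * tpow (\<alpha> - 1) (1 - \<sigma>) = 0" by (auto simp: tpow_def)
      then show ?thesis using J0[OF False] by auto
    qed
  qed
  moreover have "\<bar>R x / \<gamma> 0\<bar> \<le> a / \<gamma> 0"
    using a[OF x] \<gamma>_pos[of 0] by (simp add: divide_right_mono)
  ultimately show "\<bar>Q x\<bar> \<le> a / \<gamma> 0 + C\<^sub>0 * L * T * Beta \<alpha> \<alpha>" by linarith
  define D where "D = \<bar>x - y\<bar>"
  have D: "0 \<le> D" "D \<le> T" using x y by (auto simp: D_def)
  have "\<bar>(Q x - R x / \<gamma> 0) - (Q y - R y / \<gamma> 0)\<bar> \<le> 2 * C\<^sub>0 * L * sqrt (T * D) * Beta \<alpha> (\<alpha> - 1/2)"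
  proof (rule has_bochner_integral_norm_le[OF has_bochner_integral_diff[OF hb hb]])
    have "has_bochner_integral lborel (\<lambda>\<sigma>. 2 * C\<^sub>0 * L * sqrt (T * D) * (tpow (\<alpha> - 1) \<sigma> * tpow ((\<alpha> - 1/2) - 1) (1 - \<sigma>))) 
      (2 * C\<^sub>0 * L * sqrt (T * D) * Beta \<alpha> (\<alpha> - 1/2))"
      by (intro has_bochner_integral_mult_right has_bochner_integral_Beta01) (use \<alpha>_gt in auto)
    then show "has_bochner_integral lborel (\<lambda>\<sigma>. 2 * C\<^sub>0 * L * sqrt (T * D) * (tpow (\<alpha> - 1) \<sigma> * tpow (\<alpha> - 3/2) (1 - \<sigma>))) 
      (2 * C\<^sub>0 * L * sqrt (T * D) * Beta \<alpha> (\<alpha> - 1/2))" by simp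
    fix \<sigma>
    show "\<bar>?J \<sigma> * (C\<^sub>0 * (R x - R (x * \<sigma>))) - ?J \<sigma> * (C\<^sub>0 * (R y - R (y * \<sigma>)))\<bar> \<le> 
       2 * C\<^sub>0 * L * sqrt (T * D) * (tpow (\<alpha> - 1) \<sigma> * tpow (\<alpha> - 3/2) (1 - \<sigma>))"
    proof (cases "\<sigma> \<in> {0<..<1}")
      case True
      let ?e = "(R x - R (x * \<sigma>)) - (R y - R (y * \<sigma>))"
      have 1: "\<bar>?e\<bar> \<le> 2 * L * (T * (1 - \<sigma>))"
        using d[OF x True] d[OF y True] by linarith
      have "\<bar>R (x * \<sigma>) - R (y * \<sigma>)\<bar> \<le> L * \<bar>x * \<sigma> - y * \<sigma>\<bar>" using L[OF in_T[OF x True] in_T[OF y True]] .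
      also have "\<bar>x * \<sigma> - y * \<sigma>\<bar> = D * \<sigma>" unfolding D_def left_diff_distrib[symmetric] abs_mult using True by simp
      also have "D * \<sigma> \<le> D" using D True by (simp add: mult_left_le)
      finally have "\<bar>R (x * \<sigma>) - R (y * \<sigma>)\<bar> \<le> L * D" using L0 by (simp add: mult_left_mono)
      moreover have "\<bar>R x - R y\<bar> \<le> L * D" using L[OF x y] by (simp add: D_def)
      ultimately have 2: "\<bar>?e\<bar> \<le> 2 * L * D" by linarith
      have "\<bar>?e\<bar> \<le> sqrt ((2 * L * (T * (1 - \<sigma>))) * (2 * L * D))"
        by (rule min_le_sqrt_mult[OF _ 1 2]) simp
      also have "(2 * L * (T * (1 - \<sigma>))) * (2 * L * D) = (2 * L)^2 * ((T * D) * (1 - \<sigma>))"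
        by (simp add: power2_eq_square)
      also have "sqrt \<dots> = 2 * L * sqrt (T * D) * sqrt (1 - \<sigma>)"
        using L0 by (simp add: real_sqrt_mult)
      finally have e: "\<bar>?e\<bar> \<le> 2 * L * sqrt (T * D) * sqrt (1 - \<sigma>)" .
      have "?J \<sigma> * (C\<^sub>0 * (R x - R (x * \<sigma>))) - ?J \<sigma> * (C\<^sub>0 * (R y - R (y * \<sigma>))) = ?J \<sigma> * (C\<^sub>0 * ?e)"
        by (simp add: algebra_simps)
      also have "\<bar>\<dots>\<bar> = ?J \<sigma> * (C\<^sub>0 * \<bar>?e\<bar>)" using C0_nonneg by (simp add: abs_mult)
      also have "\<dots> \<le> ?J \<sigma> * (C\<^sub>0 * (2 * L * sqrt (T * D) * sqrt (1 - \<sigma>)))"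
        by (intro mult_left_mono e C0_nonneg) auto
      also have "\<dots> = 2 * C\<^sub>0 * L * sqrt (T * D) * (tpow (\<alpha> - 1) \<sigma> * (tpow (\<alpha> - 2) (1 - \<sigma>) * sqrt (1 - \<sigma>)))"
        by (simp add: mult_ac)
      also have "\<dots> = 2 * C\<^sub>0 * L * sqrt (T * D) * (tpow (\<alpha> - 1) \<sigma> * tpow (\<alpha> - 3/2) (1 - \<sigma>))"
        by (subst tpow_mult_sqrt) (simp add: algebra_simps)
      finally show ?thesis .
    next
      case False
      then have "tpow (\<alpha> - 1) \<sigma> * tpow (\<alpha> - 3/2) (1 - \<sigma>) = 0" by (auto simp: tpow_def)
      then show ?thesis using J0[OF False] by auto
    qed
  qed
  moreover have "\<bar>R x / \<gamma> 0 - R y / \<gamma> 0\<bar> \<le> L * sqrt (T * D) / \<gamma> 0"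
  proof -
    have "R x / \<gamma> 0 - R y / \<gamma> 0 = (R x - R y) / \<gamma> 0" by (simp add: diff_divide_distrib)
    moreover have "\<bar>R x - R y\<bar> \<le> L * sqrt (T * D)"
    proof -
      \<comment> \<open>As D \<le> T, the Lipschitz term is also of Hoelder-1/2 form.\<close>
      have "D \<le> sqrt (T * D)" by (rule min_le_sqrt_mult) (use D in auto)
      then have "L * D \<le> L * sqrt (T * D)" using L0 by (rule mult_left_mono)
      then show ?thesis using L[OF x y] by (simp add: D_def)
    qed
    ultimately show ?thesis using \<gamma>_pos[of 0] by (simp add: divide_right_mono)
  qed
  ultimately have "\<bar>Q x - Q y\<bar> \<le> L * sqrt (T * D) / \<gamma> 0 + 2 * C\<^sub>0 * L * sqrt (T * D) * Beta \<alpha> (\<alpha> - 1/2)"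
    by linarith
  also have "\<dots> = L * C\<^sub>1 * sqrt D"
    by (simp add: C\<^sub>1_def real_sqrt_mult algebra_simps)
  finally show "\<bar>Q x - Q y\<bar> \<le> L * C\<^sub>1 * sqrt \<bar>x - y\<bar>" by (simp add: D_def)
qed

text \<open>The Hoelder-1/2 bound of Q gives a factor sqrt v against v^(\<alpha>-2), and
  v^(\<alpha>-3/2) is integrable. Thus the regularity left by the first inversion suffices for the
  second.\<close>

lemma P_bound:
  fixes c :: "nat \<Rightarrow> real" and m :: nat
  defines "Q \<equiv> \<lambda>x. \<Sum>j\<le>m. c j * \<beta> j * (T - x) ^ j"
  assumes a: "\<And>x. x \<in> {0..T} \<Longrightarrow> \<bar>Q x\<bar> \<le> a"
    and H: "\<And>x y. x \<in> {0..T} \<Longrightarrow> y \<in> {0..T} \<Longrightarrow> \<bar>Q x - Q y\<bar> \<le> H * sqrt \<bar>x - y\<bar>"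
    and H0: "0 \<le> H"
    and x: "x \<in> {0..T}"
  shows "\<bar>\<Sum>j\<le>m. c j * (T - x) ^ j\<bar> \<le> (a + H * sqrt T * Beta (\<alpha> - 1/2) 1) / \<beta> 0"
proof -
  let ?P = "\<Sum>j\<le>m. c j * (T - x) ^ j"
  have hb: "has_bochner_integral lborel (\<lambda>v. tpow (\<alpha> - 2) v * tpow 0 (1 - v) * ((1 - \<alpha>) * (Q x - Q (x + (T - x) * v))))
    (\<beta> 0 * ?P - Q x)" unfolding Q_def by (rule marchaud_right)
  have "\<bar>\<beta> 0 * ?P - Q x\<bar> \<le> H * sqrt T * Beta (\<alpha> - 1/2) 1"
  proof (rule has_bochner_integral_norm_le[OF hb])
    have "has_bochner_integral lborel (\<lambda>v. H * sqrt T * (tpow ((\<alpha> - 1/2) - 1) v * tpow (1 - 1) (1 - v))) (H * sqrt T * Beta (\<alpha> - 1/2) 1)"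
      by (intro has_bochner_integral_mult_right has_bochner_integral_Beta01) (use \<alpha>_gt in auto)
    then show "has_bochner_integral lborel (\<lambda>v. H * sqrt T * (tpow (\<alpha> - 3/2) v * tpow 0 (1 - v))) (H * sqrt T * Beta (\<alpha> - 1/2) 1)"
      by simp
    fix v
    show "\<bar>tpow (\<alpha> - 2) v * tpow 0 (1 - v) * ((1 - \<alpha>) * (Q x - Q (x + (T - x) * v)))\<bar> \<le> H * sqrt T * (tpow (\<alpha> - 3/2) v * tpow 0 (1 - v))"
    proof (cases "v \<in> {0<..<1}")
      case True
      have 1: "0 \<le> (T - x) * v" "(T - x) * v \<le> T - x" using x True mult_left_le[of v "T - x"] by auto
      then have "x + (T - x) * v \<in> {0..T}" using x by auto
      from H[OF x this] have "\<bar>Q x - Q (x + (T - x) * v)\<bar> \<le> H * sqrt ((T - x) * v)" using 1 by simp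
      also have "\<dots> \<le> H * (sqrt T * sqrt v)"
        using x True H0 by (auto simp: real_sqrt_mult intro!: mult_left_mono mult_right_mono)
      finally have 2: "\<bar>Q x - Q (x + (T - x) * v)\<bar> \<le> H * (sqrt T * sqrt v)" .
      have "(1 - \<alpha>) * \<bar>Q x - Q (x + (T - x) * v)\<bar> \<le> 1 * (H * (sqrt T * sqrt v))"
        using \<alpha>_gt \<alpha>_lt by (intro mult_mono 2) auto
      then have 3: "\<bar>(1 - \<alpha>) * (Q x - Q (x + (T - x) * v))\<bar> \<le> H * (sqrt T * sqrt v)"
        using \<alpha>_lt by (simp add: abs_mult)
      have "\<bar>tpow (\<alpha> - 2) v * tpow 0 (1 - v) * ((1 - \<alpha>) * (Q x - Q (x + (T - x) * v)))\<bar> =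
        tpow (\<alpha> - 2) v * tpow 0 (1 - v) * \<bar>(1 - \<alpha>) * (Q x - Q (x + (T - x) * v))\<bar>"
        by (subst abs_mult) simp
      also have "\<dots> \<le> tpow (\<alpha> - 2) v * tpow 0 (1 - v) * (H * (sqrt T * sqrt v))"
        by (intro mult_left_mono 3) auto
      also have "\<dots> = H * sqrt T * ((tpow (\<alpha> - 2) v * sqrt v) * tpow 0 (1 - v))" by (simp add: mult_ac)
      also have "\<dots> = H * sqrt T * (tpow (\<alpha> - 3/2) v * tpow 0 (1 - v))"
        by (subst tpow_mult_sqrt) (simp add: algebra_simps)
      finally show ?thesis .
    next
      case False
      then have "tpow (\<alpha> - 2) v * tpow 0 (1 - v) = 0" "tpow (\<alpha> - 3/2) v * tpow 0 (1 - v) = 0" by (auto simp: tpow_def)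
      then show ?thesis by auto
    qed
  qed
  then have "\<bar>\<beta> 0 * ?P\<bar> \<le> a + H * sqrt T * Beta (\<alpha> - 1/2) 1" using a[OF x] by linarith
  then show ?thesis using \<beta>_pos[of 0] by (simp add: abs_mult field_simps)
qed

text \<open>Re-expansion about T. The new coefficients may be large and are never estimated; only
  the values of the polynomial are.\<close>

lemma real_polynomial_flip:
  fixes q :: "nat \<Rightarrow> real"
  obtains m c where "\<And>\<tau>. (\<Sum>i\<le>n. q i * \<tau> ^ i) = (\<Sum>j\<le>m. c j * (T - \<tau>) ^ j)"
proof -
  have "real_polynomial_function (\<lambda>s. \<Sum>i\<le>n. q i * (T - s) ^ i)"
    by (intro real_polynomial_function_sum real_polynomial_function.intros(4) real_polynomial_function_power 
         real_polynomial_function_diff real_polynomial_function.intros(1,2)) (auto simp: bounded_linear_ident)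
  then obtain c m where *: "(\<lambda>s. \<Sum>i\<le>n. q i * (T - s) ^ i) = (\<lambda>s. \<Sum>j\<le>m. c j * s ^ j)"
    unfolding real_polynomial_function_iff_sum by auto
  have "(\<Sum>i\<le>n. q i * \<tau> ^ i) = (\<Sum>j\<le>m. c j * (T - \<tau>) ^ j)" for \<tau>
    using fun_cong[OF *, of "T - \<tau>"] by simp
  then show ?thesis by (rule that)
qed

definition C\<^sub>2 :: real where "C\<^sub>2 = 1 + \<gamma> 0 / \<beta> 0 * (1 / \<gamma> 0 + C\<^sub>0 * T * Beta \<alpha> \<alpha> + C\<^sub>1 * sqrt T * Beta (\<alpha> - 1/2) 1)"

lemma C1_nonneg: "0 \<le> C\<^sub>1"
  unfolding C\<^sub>1_def using \<gamma>_pos[of 0] T_pos C0_nonneg \<alpha>_gt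
  by (auto intro!: add_nonneg_nonneg mult_nonneg_nonneg Beta_nonneg)

lemma C2_pos: "0 < C\<^sub>2"
  unfolding C\<^sub>2_def using \<gamma>_pos[of 0] \<beta>_pos[of 0] T_pos C0_nonneg C1_nonneg \<alpha>_gt
  by (intro add_pos_nonneg add_nonneg_nonneg mult_nonneg_nonneg divide_nonneg_nonneg Beta_nonneg) auto

text \<open>The bound depends on R only through its sup norm and Lipschitz constant, which is what
  makes it survive the passage from polynomials to their uniform limits.\<close>

lemma potential_polynomial_solve:
  fixes r :: "nat \<Rightarrow> real" and n :: nat
  defines "R \<equiv> \<lambda>x. \<Sum>i\<le>n. r i * x ^ i"
  assumes a: "\<And>x. x \<in> {0..T} \<Longrightarrow> \<bar>R x\<bar> \<le> a"
    and L: "\<And>x y. x \<in> {0..T} \<Longrightarrow> y \<in> {0..T} \<Longrightarrow> \<bar>R x - R y\<bar> \<le> L * \<bar>x - y\<bar>"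
  obtains P where "continuous_on UNIV P" "\<And>x. x \<in> {0..T} \<Longrightarrow> \<bar>P x\<bar> \<le> C\<^sub>2 * (a + L)"
    "\<And>x. x \<in> {0<..<T} \<Longrightarrow> (\<integral>y. K x y * (weight T \<alpha> y * P y) \<partial>lborel) = R x"
proof -
  obtain m c where c: "\<And>\<tau>. (\<Sum>i\<le>n. r i / \<gamma> i * \<tau> ^ i) = (\<Sum>j\<le>m. c j * (T - \<tau>) ^ j)"
    using real_polynomial_flip[of "\<lambda>i. r i / \<gamma> i" n] by blast
  define d where "d j = c j / \<beta> j" for j
  have d: "(\<Sum>i\<le>n. r i / \<gamma> i * \<tau> ^ i) = (\<Sum>j\<le>m. d j * \<beta> j * (T - \<tau>) ^ j)" for \<tau>
    unfolding c using \<beta>_pos by (simp add: d_def less_imp_neq[symmetric])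
  let ?P = "\<lambda>y. \<gamma> 0 * (\<Sum>j\<le>m. d j * (T - y) ^ j)"
  have L0: "0 \<le> L" 
  proof -
    have "0 \<le> \<bar>R 0 - R T\<bar>" by simp
    also have "\<dots> \<le> L * T" using L[of 0 T] T_pos by simp
    finally show ?thesis using T_pos by (simp add: zero_le_mult_iff)
  qed
  have a0: "0 \<le> a" using a[of 0] T_pos abs_ge_zero[of "R 0"] by (meson atLeastAtMost_iff less_eq_real_def order.trans order.refl)
  show thesis
  proof (rule that[of ?P])
    show "continuous_on UNIV ?P" by (intro continuous_intros)
    show "(\<integral>y. K x y * (weight T \<alpha> y * ?P y) \<partial>lborel) = R x" if "x \<in> {0<..<T}" for x
      unfolding R_def by (rule potential_polynomial[OF d]) (use that in auto)
    fix x assume x: "x \<in> {0..T}"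
    let ?Q = "\<lambda>x. \<Sum>j\<le>m. d j * \<beta> j * (T - x) ^ j"
    note Qb = Q_bounds[where n = n and r = r and a = a and L = L, OF a[unfolded R_def] L[unfolded R_def], unfolded d]
    have b1: "\<bar>\<Sum>j\<le>m. d j * (T - x) ^ j\<bar> \<le> ((a / \<gamma> 0 + C\<^sub>0 * L * T * Beta \<alpha> \<alpha>) + L * C\<^sub>1 * sqrt T * Beta (\<alpha> - 1/2) 1) / \<beta> 0"
      by (rule P_bound[OF Qb(1) Qb(2) _ x]) (use L0 C1_nonneg x in auto)
    have "\<bar>?P x\<bar> \<le> \<gamma> 0 * (((a / \<gamma> 0 + C\<^sub>0 * L * T * Beta \<alpha> \<alpha>) + L * C\<^sub>1 * sqrt T * Beta (\<alpha> - 1/2) 1) / \<beta> 0)"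
      using mult_left_mono[OF b1, of "\<gamma> 0"] \<gamma>_pos[of 0] by (simp add: abs_mult)
    also have "\<dots> \<le> C\<^sub>2 * (a + L)"
    proof -
      define A where "A = \<gamma> 0 / \<beta> 0 * (1 / \<gamma> 0)"
      define E where "E = \<gamma> 0 / \<beta> 0 * (C\<^sub>0 * T * Beta \<alpha> \<alpha> + C\<^sub>1 * sqrt T * Beta (\<alpha> - 1/2) 1)"
      have A: "0 \<le> A" unfolding A_def using \<gamma>_pos[of 0] \<beta>_pos[of 0] by simp
      have E: "0 \<le> E" unfolding E_def using \<gamma>_pos[of 0] \<beta>_pos[of 0] C0_nonneg T_pos C1_nonneg \<alpha>_gt
        by (intro mult_nonneg_nonneg add_nonneg_nonneg divide_nonneg_nonneg Beta_nonneg) auto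
      have "\<gamma> 0 * (((a / \<gamma> 0 + C\<^sub>0 * L * T * Beta \<alpha> \<alpha>) + L * C\<^sub>1 * sqrt T * Beta (\<alpha> - 1/2) 1) / \<beta> 0) = A * a + E * L"
        unfolding A_def E_def by (simp add: algebra_simps add_divide_distrib)
      moreover have "C\<^sub>2 = 1 + A + E" unfolding C\<^sub>2_def A_def E_def by (simp add: algebra_simps add_divide_distrib)
      moreover have "0 \<le> A * L" "0 \<le> E * a" using A E a0 L0 by auto
      ultimately show ?thesis using a0 L0 by (simp add: algebra_simps)
    qed
    finally show "\<bar>?P x\<bar> \<le> C\<^sub>2 * (a + L)" .
  qed
qed

end

section \<open>Weighted primitives and the linear problem\<close>

lemma has_real_derivative_antiderivative_sum:
  fixes a :: "nat \<Rightarrow> real"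
  shows "((\<lambda>x. \<Sum>i\<le>n. a i / (1 + real i) * x ^ Suc i) has_real_derivative (\<Sum>i\<le>n. a i * x ^ i)) (at x within S)"
proof (rule DERIV_sum)
  fix i
  have "1 + real i \<noteq> 0" by linarith
  then have "a i / (1 + real i) * (real (Suc i) * x ^ (Suc i - Suc 0)) = a i * x ^ i" by simp
  then show "((\<lambda>x. a i / (1 + real i) * x ^ Suc i) has_real_derivative a i * x ^ i) (at x within S)"
    using DERIV_cmult[OF DERIV_pow[of "Suc i" x S], of "a i / (1 + real i)"] by (simp only:)
qed

text \<open>The quadratic s -> \<integral> (f - s g)^2 is nonnegative. If its leading coefficient c
  is positive, its value at s = b/c gives the claim; if c = 0, it is affine in s and must have slope
  zero.\<close>

lemma Cauchy_Schwarz_integral: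
  fixes f g :: "'a \<Rightarrow> real"
  assumes f: "integrable M (\<lambda>x. (f x)\<^sup>2)" and g: "integrable M (\<lambda>x. (g x)\<^sup>2)"
    and fg: "integrable M (\<lambda>x. f x * g x)"
  shows "(\<integral>x. f x * g x \<partial>M)\<^sup>2 \<le> (\<integral>x. (f x)\<^sup>2 \<partial>M) * (\<integral>x. (g x)\<^sup>2 \<partial>M)"
proof -
  let ?a = "\<integral>x. (f x)\<^sup>2 \<partial>M" and ?b = "\<integral>x. f x * g x \<partial>M" and ?c = "\<integral>x. (g x)\<^sup>2 \<partial>M"
  have q: "0 \<le> ?a - 2 * s * ?b + s\<^sup>2 * ?c" for s
  proof -
    have "0 \<le> (\<integral>x. (f x - s * g x)\<^sup>2 \<partial>M)" by (rule integral_nonneg_AE) simp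
    also have "(\<lambda>x. (f x - s * g x)\<^sup>2) = (\<lambda>x. (f x)\<^sup>2 - 2 * s * (f x * g x) + s\<^sup>2 * (g x)\<^sup>2)"
      by (auto simp: power2_eq_square algebra_simps)
    also have "(\<integral>x. (f x)\<^sup>2 - 2 * s * (f x * g x) + s\<^sup>2 * (g x)\<^sup>2 \<partial>M) = ?a - 2 * s * ?b + s\<^sup>2 * ?c"
      using f g fg by simp
    finally show ?thesis .
  qed
  have c0: "0 \<le> ?c" by (rule integral_nonneg_AE) simp
  show ?thesis
  proof (cases "?c = 0")
    case True
    have "?b = 0"
    proof (rule ccontr)
      assume "?b \<noteq> 0"
      \<comment> \<open>This value of s makes a - 2 s b equal to -1.\<close>
      then show False using q[of "(?a + 1) / (2 * ?b)"] True by (simp add: field_simps)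
    qed
    then show ?thesis using True by simp
  next
    case False
    then have "?c > 0" using c0 by linarith
    moreover have "?a - 2 * (?b / ?c) * ?b + (?b / ?c)\<^sup>2 * ?c = ?a - ?b\<^sup>2 / ?c"
      using False by (simp add: power2_eq_square field_simps)
    ultimately have "?b\<^sup>2 / ?c \<le> ?a" using q[of "?b / ?c"] by linarith
    then show ?thesis using \<open>?c > 0\<close> by (simp add: pos_divide_le_eq)
  qed
qed

context weighted_interval begin

definition primitive_of :: "(real \<Rightarrow> real) \<Rightarrow> real \<Rightarrow> real" where
  "primitive_of P t = integral {0..t} (\<lambda>y. weight T \<alpha> y * P y)"

lemma integrable_weight: "integrable lborel (weight T \<alpha>)"
  using has_bochner_integral_Beta[of \<alpha> \<alpha> 0 T] \<alpha>_gt T_pos by (auto simp: weight_def[abs_def] has_bochner_integral_iff)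

lemma integral_weight_pos: "0 < (\<integral>y. weight T \<alpha> y \<partial>lborel)"
  using has_bochner_integral_Beta[of \<alpha> \<alpha> 0 T] \<alpha>_gt T_pos
  by (auto simp: weight_def[abs_def] has_bochner_integral_iff Beta_def intro!: mult_pos_pos divide_pos_pos Gamma_real_pos)

lemma weighted_bound:
  assumes "\<And>y. y \<in> {0..T} \<Longrightarrow> \<bar>P y\<bar> \<le> b"
  shows "\<bar>weight T \<alpha> y * P y\<bar> \<le> weight T \<alpha> y * b"
proof (cases "y \<in> {0<..<T}")
  case True
  then show ?thesis using assms[of y] by (simp add: abs_mult mult_left_mono)
qed (simp add: weight_eq_0)

lemma integrable_weighted:
  assumes P: "continuous_on UNIV P"
  shows "integrable lborel (\<lambda>y. weight T \<alpha> y * P y)"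
proof -
  have [measurable]: "P \<in> borel_measurable borel" using P by (rule borel_measurable_continuous_onI)
  obtain b where b: "b > 0" "\<And>y. y \<in> {0..T} \<Longrightarrow> \<bar>P y\<bar> \<le> b"
    using bounded_on_interval[OF P] by blast
  have "\<bar>weight T \<alpha> y * P y\<bar> \<le> weight T \<alpha> y * b" for y
    by (rule weighted_bound[OF b(2)])
  then show ?thesis
    by (intro Bochner_Integration.integrable_bound[OF integrable_mult_left[OF integrable_weight, of b]])
       (use b(1) in \<open>auto simp: abs_mult\<close>)
qed

lemma integrable_on_weighted:
  assumes P: "continuous_on UNIV P"
  shows "(\<lambda>y. weight T \<alpha> y * P y) integrable_on {a..b}"
proof -
  have "(\<lambda>y. weight T \<alpha> y * P y) integrable_on UNIV"
    using integrable_weighted[OF P] by (rule integrable_on_lborel)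
  then show ?thesis by (rule integrable_on_subinterval) auto
qed

lemma integral_weighted:
  assumes P: "continuous_on UNIV P"
  shows "integral {0..T} (\<lambda>y. weight T \<alpha> y * P y) = (\<integral>y. weight T \<alpha> y * P y \<partial>lborel)"
proof -
  have "((\<lambda>y. weight T \<alpha> y * P y) has_integral (\<integral>y. weight T \<alpha> y * P y \<partial>lborel)) UNIV"
    using integrable_weighted[OF P] by (rule has_integral_integral_lborel)
  then have "((\<lambda>y. weight T \<alpha> y * P y) has_integral (\<integral>y. weight T \<alpha> y * P y \<partial>lborel)) {0..T}"
    by (rule has_integral_restrict_UNIV[THEN iffD1, OF has_integral_eq[rotated]]) (auto simp: weight_eq_0)
  then show ?thesis by (rule integral_unique)
qed

lemma continuous_weight: "x \<in> {0<..<T} \<Longrightarrow> isCont (weight T \<alpha>) x"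
proof -
  assume x: "x \<in> {0<..<T}"
  have "continuous_on {0<..<T} (\<lambda>x. x powr (\<alpha> - 1) * (T - x) powr (\<alpha> - 1))"
    by (intro continuous_intros) auto
  then have "continuous_on {0<..<T} (weight T \<alpha>)"
    by (rule continuous_on_eq) (auto simp: weight_def tpow_def)
  then show "isCont (weight T \<alpha>) x" using x by (simp add: continuous_on_eq_continuous_at)
qed

lemma primitive_of_deriv:
  assumes P: "continuous_on UNIV P" and x: "x \<in> {0<..<T}"
  shows "(primitive_of P has_real_derivative weight T \<alpha> x * P x) (at x)"
proof -
  have "isCont P x" using P by (simp add: continuous_on_eq_continuous_at)
  then have "isCont (\<lambda>y. weight T \<alpha> y * P y) x"
    using continuous_weight[OF x] by (intro continuous_intros)
  then have c: "continuous (at x within {0..T}) (\<lambda>y. weight T \<alpha> y * P y)"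
    by (rule continuous_at_imp_continuous_at_within)
  have "((\<lambda>t. integral {0..t} (\<lambda>y. weight T \<alpha> y * P y)) has_vector_derivative weight T \<alpha> x * P x) (at x within ({0..T} - {}))"
    by (rule integral_has_vector_derivative_continuous_at[OF integrable_on_weighted[OF P]]) (use x c in auto)
  moreover have "at x within {0..T} = at x"
    using x by (intro at_within_interior) auto
  ultimately show ?thesis
    unfolding primitive_of_def[abs_def] by (simp add: has_real_derivative_iff_has_vector_derivative)
qed

lemma continuous_primitive_of:
  assumes P: "continuous_on UNIV P"
  shows "continuous_on {0..T} (primitive_of P)"
  unfolding primitive_of_def[abs_def] by (rule indefinite_integral_continuous_1[OF integrable_on_weighted[OF P]])

lemma primitive_of_0 [simp]: "primitive_of P 0 = 0"
  by (simp add: primitive_of_def)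

lemma primitive_of_T: "continuous_on UNIV P \<Longrightarrow> primitive_of P T = (\<integral>y. weight T \<alpha> y * P y \<partial>lborel)"
  by (simp add: primitive_of_def integral_weighted)

lemma primitive_of_lincomb:
  assumes P: "continuous_on UNIV P" and Q: "continuous_on UNIV Q"
  shows "primitive_of (\<lambda>x. a * P x + b * Q x) t = a * primitive_of P t + b * primitive_of Q t"
proof -
  have "primitive_of (\<lambda>x. a * P x + b * Q x) t = integral {0..t} (\<lambda>y. a * (weight T \<alpha> y * P y) + b * (weight T \<alpha> y * Q y))"
    unfolding primitive_of_def by (simp add: algebra_simps)
  also have "\<dots> = a * primitive_of P t + b * primitive_of Q t"
    unfolding primitive_of_def using integrable_on_weighted[OF P, of 0 t] integrable_on_weighted[OF Q, of 0 t]
    by (intro integral_unique has_integral_add has_integral_mult_right integrable_integral)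
  finally show ?thesis .
qed

end

section \<open>The first-kind integral equation with polynomial data\<close>

context riesz_interval begin

text \<open>The normalisation 1 / \<Gamma>(2 - 2\<alpha>) makes this, on (0,T), the flux of
  \<open>primitive_of P\<close>; see \<open>flux_primitive_of\<close>.\<close>

definition potential :: "(real \<Rightarrow> real) \<Rightarrow> real \<Rightarrow> real" where
  "potential P x = 1 / Gamma (2 - 2 * \<alpha>) * (\<integral>y. K x y * (weight T \<alpha> y * P y) \<partial>lborel)"

text \<open>The equation flux' = -g, integrated once with a free constant; the vanishing weighted
  mean of P is the boundary condition u(T) = 0. Continuity of P on the whole line keeps integrands
  measurable, and the weight hides the values outside the interval.\<close>

definition solves :: "(real \<Rightarrow> real) \<Rightarrow> (real \<Rightarrow> real) \<Rightarrow> bool" where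
  "solves g P \<longleftrightarrow> continuous_on {0..T} g \<and> continuous_on UNIV P \<and> (\<integral>y. weight T \<alpha> y * P y \<partial>lborel) = 0 \<and>
     (\<exists>c. \<forall>x\<in>{0<..<T}. potential P x = c - integral {0..x} g)"

lemma Gamma_2_pos: "0 < Gamma (2 - 2 * \<alpha>)"
  using \<alpha>_lt by (intro Gamma_real_pos) auto

text \<open>The case of degree zero, where both Abel operators act by a scalar. It shows that the
  weight is an equilibrium density: its potential is constant on (0,T).\<close>

lemma potential_one:
  assumes "x \<in> {0<..<T}"
  shows "(\<integral>y. K x y * weight T \<alpha> y \<partial>lborel) = \<beta> 0"
proof -
  have "(\<integral>y. K x y * (weight T \<alpha> y * (\<gamma> 0 * (\<Sum>j\<le>0. (1 / (\<gamma> 0 * \<beta> 0)) * (T - y) ^ j))) \<partial>lborel) = (\<Sum>i\<le>0. 1 * x ^ i)"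
    by (rule potential_polynomial) (use assms \<beta>_pos[of 0] in auto)
  then have "(\<integral>y. (1 / \<beta> 0) * (K x y * weight T \<alpha> y) \<partial>lborel) = 1"
    using \<gamma>_pos[of 0] by (simp add: mult_ac)
  then show ?thesis using \<beta>_pos[of 0] by (simp add: field_simps)
qed

lemma integrable_K_weighted:
  assumes "x \<in> {0<..<T}" "continuous_on UNIV P"
  shows "integrable lborel (\<lambda>y. K x y * (weight T \<alpha> y * P y))"
  using potential_copson(1)[of x P] assms by auto

lemma integrable_K_weight:
  assumes "x \<in> {0<..<T}"
  shows "integrable lborel (\<lambda>y. K x y * weight T \<alpha> y)"
  using integrable_K_weighted[OF assms, of "\<lambda>_. 1"] by simp

text \<open>Both functionals of P are integrals against a nonnegative density whose total mass is
  known, by \<open>potential_one\<close> in the case of the potential. They are therefore continuous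
  for uniform convergence of P on [0,T], uniformly in x.\<close>

lemma potential_diff_bound:
  assumes x: "x \<in> {0<..<T}" and P: "continuous_on UNIV P" and Q: "continuous_on UNIV Q"
    and b: "\<And>y. y \<in> {0..T} \<Longrightarrow> \<bar>P y - Q y\<bar> \<le> b"
  shows "\<bar>potential P x - potential Q x\<bar> \<le> \<beta> 0 / Gamma (2 - 2 * \<alpha>) * b"
    and "\<bar>(\<integral>y. weight T \<alpha> y * P y \<partial>lborel) - (\<integral>y. weight T \<alpha> y * Q y \<partial>lborel)\<bar> \<le> (\<integral>y. weight T \<alpha> y \<partial>lborel) * b"
proof -
  define Z where "Z = (\<integral>y. K x y * (weight T \<alpha> y * P y) - K x y * (weight T \<alpha> y * Q y) \<partial>lborel)"
  have "potential P x - potential Q x = Z / Gamma (2 - 2 * \<alpha>)"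
    unfolding Z_def potential_def using integrable_K_weighted[OF x P] integrable_K_weighted[OF x Q]
    by (simp add: diff_divide_distrib)
  moreover have "\<bar>Z\<bar> \<le> (\<integral>y. b * (K x y * weight T \<alpha> y) \<partial>lborel)"
    unfolding Z_def
  proof (rule integral_abs_bound_integral)
    fix y
    have "\<bar>K x y * (weight T \<alpha> y * P y) - K x y * (weight T \<alpha> y * Q y)\<bar> = K x y * \<bar>weight T \<alpha> y * (P y - Q y)\<bar>"
      by (simp add: right_diff_distrib[symmetric] abs_mult)
    also have "\<dots> \<le> K x y * (weight T \<alpha> y * b)"
      by (intro mult_left_mono weighted_bound b) auto
    finally show "\<bar>K x y * (weight T \<alpha> y * P y) - K x y * (weight T \<alpha> y * Q y)\<bar> \<le> b * (K x y * weight T \<alpha> y)"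
      by (simp add: mult_ac)
  qed (intro integrable_K_weighted[OF x] P Q integrable_K_weight[OF x] Bochner_Integration.integrable_diff integrable_mult_right)+
  then have "\<bar>Z\<bar> \<le> b * \<beta> 0"
    using potential_one[OF x] by simp
  ultimately show "\<bar>potential P x - potential Q x\<bar> \<le> \<beta> 0 / Gamma (2 - 2 * \<alpha>) * b"
    using Gamma_2_pos by (simp add: abs_divide divide_right_mono mult.commute)
  have "(\<integral>y. weight T \<alpha> y * P y \<partial>lborel) - (\<integral>y. weight T \<alpha> y * Q y \<partial>lborel) = (\<integral>y. weight T \<alpha> y * (P y - Q y) \<partial>lborel)"
    using integrable_weighted[OF P] integrable_weighted[OF Q] by (simp add: right_diff_distrib)
  also have "\<bar>\<dots>\<bar> \<le> (\<integral>y. weight T \<alpha> y * b \<partial>lborel)"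
  proof (rule integral_abs_bound_integral)
    show "integrable lborel (\<lambda>y. weight T \<alpha> y * (P y - Q y))"
      by (intro integrable_weighted continuous_intros P Q)
  qed (auto intro!: integrable_weight weighted_bound b)
  finally show "\<bar>(\<integral>y. weight T \<alpha> y * P y \<partial>lborel) - (\<integral>y. weight T \<alpha> y * Q y \<partial>lborel)\<bar> \<le> (\<integral>y. weight T \<alpha> y \<partial>lborel) * b"
    by simp
qed

lemma solves_lincomb:
  assumes g: "solves g P" and h: "solves h Q"
  shows "solves (\<lambda>x. a * g x + b * h x) (\<lambda>x. a * P x + b * Q x)"
proof -
  have P: "continuous_on UNIV P" and Q: "continuous_on UNIV Q" and cg: "continuous_on {0..T} g" and ch: "continuous_on {0..T} h"
    using assms by (auto simp: solves_def)
  obtain c where c: "\<And>x. x \<in> {0<..<T} \<Longrightarrow> potential P x = c - integral {0..x} g" using g by (auto simp: solves_def)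
  obtain d where d: "\<And>x. x \<in> {0<..<T} \<Longrightarrow> potential Q x = d - integral {0..x} h" using h by (auto simp: solves_def)
  have "potential (\<lambda>x. a * P x + b * Q x) x = (a * c + b * d) - integral {0..x} (\<lambda>x. a * g x + b * h x)"
    if x: "x \<in> {0<..<T}" for x
  proof -
    have "potential (\<lambda>x. a * P x + b * Q x) x = 1 / Gamma (2 - 2 * \<alpha>) * 
       (\<integral>y. a * (K x y * (weight T \<alpha> y * P y)) + b * (K x y * (weight T \<alpha> y * Q y)) \<partial>lborel)"
      unfolding potential_def by (simp add: algebra_simps)
    also have "\<dots> = a * potential P x + b * potential Q x"
      unfolding potential_def using integrable_K_weighted[OF x P] integrable_K_weighted[OF x Q]
      by (simp add: algebra_simps)
    moreover have "integral {0..x} (\<lambda>x. a * g x + b * h x) = a * integral {0..x} g + b * integral {0..x} h"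
    proof -
      have "g integrable_on {0..x}" "h integrable_on {0..x}"
        using x by (auto intro!: integrable_continuous_real continuous_on_subset[OF cg] continuous_on_subset[OF ch])
      then show ?thesis
        by (intro integral_unique has_integral_add has_integral_mult_right integrable_integral)
    qed
    ultimately show ?thesis using c[OF x] d[OF x] by (simp add: algebra_simps)
  qed
  moreover have "(\<integral>y. weight T \<alpha> y * (a * P y + b * Q y) \<partial>lborel) = 0"
  proof -
    have "(\<integral>y. weight T \<alpha> y * (a * P y + b * Q y) \<partial>lborel) = (\<integral>y. a * (weight T \<alpha> y * P y) + b * (weight T \<alpha> y * Q y) \<partial>lborel)"
      by (simp add: algebra_simps)
    also have "\<dots> = 0" using g h integrable_weighted[OF P] integrable_weighted[OF Q] by (simp add: solves_def)
    finally show ?thesis .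
  qed
  ultimately show ?thesis
    unfolding solves_def using P Q cg ch by (intro conjI exI[of _ "a * c + b * d"] continuous_intros) auto
qed

text \<open>The prescribed potential R is a multiple of the antiderivative of g, so its Lipschitz
  constant and sup norm are controlled by sup |g| alone. The factor T + 1 collects these two
  contributions, and the factor 2 pays for the correction of the mean.\<close>

lemma solves_polynomial:
  assumes g: "real_polynomial_function g" and b: "\<And>x. x \<in> {0..T} \<Longrightarrow> \<bar>g x\<bar> \<le> b"
  shows "\<exists>P. solves g P \<and> (\<forall>x\<in>{0..T}. \<bar>P x\<bar> \<le> 2 * C\<^sub>2 * Gamma (2 - 2 * \<alpha>) * (T + 1) * b)"
proof -
  let ?N = "Gamma (2 - 2 * \<alpha>)"
  obtain a n where a: "g = (\<lambda>x. \<Sum>i\<le>n. a i * x ^ i)"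
    using g unfolding real_polynomial_function_iff_sum by auto
  \<comment> \<open>Coefficients of the antiderivative of g that vanishes at 0, multiplied by
    \<Gamma>(2 - 2\<alpha>) to cancel the normalisation of \<open>potential\<close>.\<close>
  define r where "r i = (case i of 0 \<Rightarrow> 0 | Suc k \<Rightarrow> ?N * (a k / (1 + real k)))" for i :: nat
  define R where "R = (\<lambda>x. \<Sum>i\<le>Suc n. r i * x ^ i)"
  have R_eq: "R x = ?N * (\<Sum>i\<le>n. a i / (1 + real i) * x ^ Suc i)" for x
    unfolding R_def by (simp add: sum.atMost_Suc_shift r_def sum_distrib_left mult_ac del: sum.atMost_Suc)
  have dR: "(R has_real_derivative ?N * g x) (at x within S)" for x S
  proof -
    have "((\<lambda>x. ?N * (\<Sum>i\<le>n. a i / (1 + real i) * x ^ Suc i)) has_real_derivative ?N * (\<Sum>i\<le>n. a i * x ^ i)) (at x within S)"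
      by (intro DERIV_cmult has_real_derivative_antiderivative_sum)
    then show ?thesis unfolding R_eq[abs_def] a .
  qed
  have R: "R x = ?N * integral {0..x} g" if "0 \<le> x" for x
  proof -
    have "((\<lambda>x. ?N * g x) has_integral (R x - R 0)) {0..x}"
      by (rule fundamental_theorem_of_calculus) (use that dR in \<open>auto simp: has_real_derivative_iff_has_vector_derivative[symmetric]\<close>)
    from integral_unique[OF this] show ?thesis by (simp add: R_eq[of 0])
  qed
  have b0: "0 \<le> b" using b[of 0] T_pos by (auto intro: order_trans[OF abs_ge_zero])
  have lip: "\<bar>R x - R y\<bar> \<le> (?N * b) * \<bar>x - y\<bar>" if "x \<in> {0..T}" "y \<in> {0..T}" for x y
  proof -
    have "norm (R x - R y) \<le> (?N * b) * norm (x - y)"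
    proof (rule field_differentiable_bound[of "{0..T}"])
      show "norm (?N * g z) \<le> ?N * b" if "z \<in> {0..T}" for z
        using b[OF that] Gamma_2_pos by (simp add: abs_mult mult_left_mono)
    qed (use that dR in auto)
    then show ?thesis by simp
  qed
  have bd: "\<bar>R x\<bar> \<le> ?N * b * T" if "x \<in> {0..T}" for x
  proof -
    have "\<bar>R x\<bar> \<le> (?N * b) * \<bar>x\<bar>" using lip[OF that, of 0] T_pos R_eq[of 0] by simp
    also have "\<dots> \<le> (?N * b) * T" using that b0 Gamma_2_pos by (intro mult_left_mono) auto
    finally show ?thesis .
  qed
  obtain P where P: "continuous_on UNIV P" "\<And>x. x \<in> {0..T} \<Longrightarrow> \<bar>P x\<bar> \<le> C\<^sub>2 * (?N * b * T + ?N * b)"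
    "\<And>x. x \<in> {0<..<T} \<Longrightarrow> (\<integral>y. K x y * (weight T \<alpha> y * P y) \<partial>lborel) = R x"
    using potential_polynomial_solve[where r = r and n = "Suc n", OF bd[unfolded R_def] lip[unfolded R_def]] 
    unfolding R_def by blast
  let ?B = "C\<^sub>2 * (?N * b * T + ?N * b)"
  let ?W = "\<integral>y. weight T \<alpha> y \<partial>lborel"
  \<comment> \<open>The weighted mean of P. The density e - P has mean zero, the constant e
    contributes only a constant potential, and the sign of P produces minus the integral of
    g.\<close>
  define e where "e = (\<integral>y. weight T \<alpha> y * P y \<partial>lborel) / ?W"
  have e: "\<bar>e\<bar> \<le> ?B"
  proof -
    have "T / 2 \<in> {0<..<T}" using T_pos by auto
    from potential_diff_bound(2)[OF this P(1) continuous_on_const[of _ 0], of ?B] P(2)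
    have "\<bar>\<integral>y. weight T \<alpha> y * P y \<partial>lborel\<bar> \<le> ?W * ?B" by simp
    then show ?thesis using integral_weight_pos by (simp add: e_def abs_divide field_simps)
  qed
  define Q where "Q = (\<lambda>y. e * 1 + (-1) * P y)"
  have Q: "continuous_on UNIV Q" unfolding Q_def by (intro continuous_intros P)
  have "solves g Q"
    unfolding solves_def
  proof (intro conjI exI ballI)
    show "continuous_on {0..T} g" unfolding a by (intro continuous_intros)
    show "(\<integral>y. weight T \<alpha> y * Q y \<partial>lborel) = 0"
    proof -
      have "(\<integral>y. weight T \<alpha> y * Q y \<partial>lborel) = (\<integral>y. e * weight T \<alpha> y - weight T \<alpha> y * P y \<partial>lborel)"
        by (simp add: Q_def algebra_simps)
      also have "\<dots> = e * ?W - (\<integral>y. weight T \<alpha> y * P y \<partial>lborel)"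
        using integrable_weight integrable_weighted[OF P(1)] by simp
      also have "\<dots> = 0" using integral_weight_pos by (simp add: e_def)
      finally show ?thesis .
    qed
    fix x assume x: "x \<in> {0<..<T}"
    have "(\<integral>y. K x y * (weight T \<alpha> y * Q y) \<partial>lborel) = (\<integral>y. e * (K x y * weight T \<alpha> y) - K x y * (weight T \<alpha> y * P y) \<partial>lborel)"
      by (simp add: Q_def algebra_simps)
    also have "\<dots> = e * \<beta> 0 - R x"
      using integrable_K_weight[OF x] integrable_K_weighted[OF x P(1)] P(3)[OF x] potential_one[OF x] by simp
    finally show "potential Q x = e * \<beta> 0 / ?N - integral {0..x} g"
      using R[of x] x Gamma_2_pos by (simp add: potential_def diff_divide_distrib)
  qed (rule Q)
  moreover have "\<bar>Q x\<bar> \<le> 2 * C\<^sub>2 * ?N * (T + 1) * b" if "x \<in> {0..T}" for x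
  proof -
    have "\<bar>Q x\<bar> \<le> ?B + ?B" using e P(2)[OF that] unfolding Q_def by linarith
    then show ?thesis by (simp add: algebra_simps)
  qed
  ultimately show ?thesis by blast
qed

end

section \<open>Energy and the pointwise bound\<close>

context riesz_interval begin

text \<open>Integration by parts against H, the integral of h. The boundary terms vanish because the
  primitive of Q is zero at both ends, and the unknown constant c drops out because the weighted
  mean of Q is zero.\<close>

lemma pairing:
  assumes h: "solves h P" and Q: "continuous_on UNIV Q" and Q0: "(\<integral>y. weight T \<alpha> y * Q y \<partial>lborel) = 0"
  shows "integral {0..T} (\<lambda>x. primitive_of Q x * h x) = (\<integral>x. weight T \<alpha> x * Q x * potential P x \<partial>lborel)"
proof -
  have ch: "continuous_on {0..T} h" using h by (simp add: solves_def)
  obtain c where c: "\<And>x. x \<in> {0<..<T} \<Longrightarrow> potential P x = c - integral {0..x} h" using h by (auto simp: solves_def)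
  define H where "H x = integral {0..x} h" for x
  have dH: "(H has_real_derivative h x) (at x)" if "x \<in> {0<..<T}" for x
  proof -
    have "(H has_real_derivative h x) (at x within {0..T})"
      unfolding H_def[abs_def] by (rule integral_has_real_derivative[OF ch]) (use that in auto)
    moreover have "at x within {0..T} = at x" using that by (intro at_within_interior) auto
    ultimately show ?thesis by simp
  qed
  have cH: "continuous_on {0..T} H"
    unfolding H_def[abs_def] by (intro indefinite_integral_continuous_1 integrable_continuous_real ch)
  \<comment> \<open>H is frozen outside [0,T] to obtain continuity on the whole line;
    \<open>uc\<close>, \<open>R\<close> and \<open>P\<close> in later proofs are clamped in the same
    way.\<close>
  define H' where "H' x = H (max 0 (min T x))" for x
  have cH': "continuous_on UNIV H'"
    unfolding H'_def[abs_def] using T_pos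
    by (intro continuous_on_compose2[OF cH]) (auto intro!: continuous_intros)
  have H': "H' x = H x" if "x \<in> {0..T}" for x using that by (simp add: H'_def)
  have "((\<lambda>x. weight T \<alpha> x * Q x * H x + primitive_of Q x * h x) has_integral (primitive_of Q T * H T - primitive_of Q 0 * H 0)) {0..T}"
  proof (rule fundamental_theorem_of_calculus_interior)
    fix x assume "x \<in> {0<..<T}"
    then have "((\<lambda>x. primitive_of Q x * H x) has_real_derivative (weight T \<alpha> x * Q x * H x + primitive_of Q x * h x)) (at x)"
      using DERIV_mult'[OF primitive_of_deriv[OF Q] dH] by (simp add: add.commute)
    then show "((\<lambda>x. primitive_of Q x * H x) has_vector_derivative (weight T \<alpha> x * Q x * H x + primitive_of Q x * h x)) (at x)"
      by (simp add: has_real_derivative_iff_has_vector_derivative)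
  qed (use T_pos in \<open>auto intro!: continuous_intros continuous_primitive_of Q cH\<close>)
  then have 1: "((\<lambda>x. weight T \<alpha> x * Q x * H x + primitive_of Q x * h x) has_integral 0) {0..T}"
    using primitive_of_T[OF Q] Q0 by simp
  have QH: "continuous_on UNIV (\<lambda>x. Q x * H' x)" by (intro continuous_intros Q cH')
  have "((\<lambda>x. weight T \<alpha> x * (Q x * H' x)) has_integral (\<integral>x. weight T \<alpha> x * (Q x * H' x) \<partial>lborel)) {0..T}"
    using integrable_on_weighted[OF QH, of 0 T] integral_weighted[OF QH] by (metis integrable_integral)
  then have 2: "((\<lambda>x. weight T \<alpha> x * Q x * H x) has_integral (\<integral>x. weight T \<alpha> x * (Q x * H' x) \<partial>lborel)) {0..T}"
    by (rule has_integral_eq[rotated]) (simp add: H')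
  have "((\<lambda>x. primitive_of Q x * h x) has_integral (0 - (\<integral>x. weight T \<alpha> x * (Q x * H' x) \<partial>lborel))) {0..T}"
    using has_integral_diff[OF 1 2] by simp
  then have "integral {0..T} (\<lambda>x. primitive_of Q x * h x) = 0 - (\<integral>x. weight T \<alpha> x * (Q x * H' x) \<partial>lborel)"
    by (rule integral_unique)
  also have "\<dots> = (\<integral>x. c * (weight T \<alpha> x * Q x) - weight T \<alpha> x * (Q x * H' x) \<partial>lborel)"
    using integrable_weighted[OF Q] integrable_weighted[OF QH] Q0 by simp
  also have "\<dots> = (\<integral>x. weight T \<alpha> x * Q x * potential P x \<partial>lborel)"
  proof (rule Bochner_Integration.integral_cong[OF refl])
    fix x
    show "c * (weight T \<alpha> x * Q x) - weight T \<alpha> x * (Q x * H' x) = weight T \<alpha> x * Q x * potential P x"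
    proof (cases "x \<in> {0<..<T}")
      case True
      then have cc: "c = potential P x + H' x" using c[OF True] H'[of x] by (simp add: H_def)
      show ?thesis by (subst cc) (simp add: algebra_simps)
    qed (simp add: weight_eq_0)
  qed
  finally show ?thesis .
qed

text \<open>For P = Q = 1 the inner integral is the constant potential of the weight, so the double
  integral is finite; the general case follows by boundedness of P and Q on the interval.\<close>

lemma integrable_double:
  assumes P: "continuous_on UNIV P" and Q: "continuous_on UNIV Q"
  shows "integrable (lborel \<Otimes>\<^sub>M lborel) (\<lambda>(x, y). K x y * ((weight T \<alpha> x * P x) * (weight T \<alpha> y * Q y)))"
proof -
  have [measurable]: "P \<in> borel_measurable borel" "Q \<in> borel_measurable borel" 
    using P Q by (auto intro: borel_measurable_continuous_onI)
  have K': "(\<lambda>x. K (fst x) (snd x)) \<in> borel_measurable (borel \<Otimes>\<^sub>M borel)" by (rule measurable_K)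
  have [measurable]: "(\<lambda>(x, y). K x y) \<in> borel_measurable (borel \<Otimes>\<^sub>M borel)"
    using K' by (simp add: case_prod_beta')
  obtain b where b: "b > 0" "\<And>y. y \<in> {0..T} \<Longrightarrow> \<bar>P y\<bar> \<le> b"
    using bounded_on_interval[OF P] by blast
  obtain d where d: "d > 0" "\<And>y. y \<in> {0..T} \<Longrightarrow> \<bar>Q y\<bar> \<le> d"
    using bounded_on_interval[OF Q] by blast
  let ?g = "\<lambda>(x, y). K x y * (weight T \<alpha> x * weight T \<alpha> y)"
  have inner: "integrable lborel (\<lambda>y. ?g (x, y))" "(\<integral>y. norm (?g (x, y)) \<partial>lborel) = weight T \<alpha> x * \<beta> 0" for x
  proof -
    have eq: "(\<lambda>y. ?g (x, y)) = (\<lambda>y. weight T \<alpha> x * (K x y * weight T \<alpha> y))" by (auto simp: mult_ac)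
    have eq2: "(\<lambda>y. norm (?g (x, y))) = (\<lambda>y. weight T \<alpha> x * (K x y * weight T \<alpha> y))" by (auto simp: mult_ac abs_mult)
    have "integrable lborel (\<lambda>y. weight T \<alpha> x * (K x y * weight T \<alpha> y)) \<and> (\<integral>y. weight T \<alpha> x * (K x y * weight T \<alpha> y) \<partial>lborel) = weight T \<alpha> x * \<beta> 0"
    proof (cases "x \<in> {0<..<T}")
      case True
      then show ?thesis using integrable_K_weight[OF True] potential_one[OF True] by simp
    qed (simp add: weight_eq_0)
    then show "integrable lborel (\<lambda>y. ?g (x, y))" "(\<integral>y. norm (?g (x, y)) \<partial>lborel) = weight T \<alpha> x * \<beta> 0"
      unfolding eq eq2 by auto
  qed
  have "integrable (lborel \<Otimes>\<^sub>M lborel) ?g"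
  proof (rule lborel_pair.Fubini_integrable)
    show "integrable lborel (\<lambda>x. \<integral>y. norm (?g (x, y)) \<partial>lborel)"
      unfolding inner(2) using integrable_weight by simp
    show "AE x in lborel. integrable lborel (\<lambda>y. ?g (x, y))" using inner(1) by simp
  qed measurable
  then have g: "integrable (lborel \<Otimes>\<^sub>M lborel) (\<lambda>z. (b * d) * ?g z)" by (rule integrable_mult_right)
  show ?thesis
  proof (rule Bochner_Integration.integrable_bound[OF g])
    have "\<bar>K x y * ((weight T \<alpha> x * P x) * (weight T \<alpha> y * Q y))\<bar> \<le> \<bar>(b * d) * ?g (x, y)\<bar>" for x y
    proof -
      have "\<bar>K x y * ((weight T \<alpha> x * P x) * (weight T \<alpha> y * Q y))\<bar> = K x y * (\<bar>weight T \<alpha> x * P x\<bar> * \<bar>weight T \<alpha> y * Q y\<bar>)"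
        by (simp only: abs_mult) simp
      also have "\<dots> \<le> K x y * ((weight T \<alpha> x * b) * (weight T \<alpha> y * d))"
        using b d by (intro mult_left_mono mult_mono weighted_bound) auto
      also have "\<dots> = \<bar>(b * d) * ?g (x, y)\<bar>" using b(1) d(1) by (simp add: abs_mult)
      finally show ?thesis .
    qed
    then show "AE z in lborel \<Otimes>\<^sub>M lborel. norm ((\<lambda>(x, y). K x y * ((weight T \<alpha> x * P x) * (weight T \<alpha> y * Q y))) z) \<le> norm ((b * d) * ?g z)"
      by (intro AE_I2) auto
  qed measurable
qed

lemma potential_symmetric:
  assumes P: "continuous_on UNIV P" and Q: "continuous_on UNIV Q"
  shows "(\<integral>x. weight T \<alpha> x * Q x * potential P x \<partial>lborel) = (\<integral>x. weight T \<alpha> x * P x * potential Q x \<partial>lborel)"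
proof -
  let ?N = "Gamma (2 - 2 * \<alpha>)"
  have eq: "(\<integral>x. weight T \<alpha> x * Q x * potential P x \<partial>lborel) = 
    1 / ?N * (\<integral>x. (\<integral>y. K x y * ((weight T \<alpha> x * Q x) * (weight T \<alpha> y * P y)) \<partial>lborel) \<partial>lborel)" for P Q
    unfolding potential_def
    by (subst integral_mult_right_zero[symmetric], rule Bochner_Integration.integral_cong[OF refl],
        subst integral_mult_right_zero[symmetric], subst integral_mult_right_zero[symmetric], 
        subst integral_mult_right_zero[symmetric], rule Bochner_Integration.integral_cong[OF refl]) simp
  have "(\<integral>x. (\<integral>y. K x y * ((weight T \<alpha> x * Q x) * (weight T \<alpha> y * P y)) \<partial>lborel) \<partial>lborel) =
    (\<integral>y. (\<integral>x. K x y * ((weight T \<alpha> x * Q x) * (weight T \<alpha> y * P y)) \<partial>lborel) \<partial>lborel)"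
    using lborel_pair.Fubini_integral[OF integrable_double[OF Q P]] by simp
  also have "\<dots> = (\<integral>y. (\<integral>x. K y x * ((weight T \<alpha> y * P y) * (weight T \<alpha> x * Q x)) \<partial>lborel) \<partial>lborel)"
    by (simp add: K_commute mult_ac)
  finally show ?thesis unfolding eq by simp
qed

text \<open>The right Abel operator applied to u' = weight * P, with \<tau> ranging over the whole
  line. The kernel is the composition of this operator's adjoint with the operator itself, up to
  \<open>\<gamma> 0\<close>.\<close>

definition halfline_adjoint :: "(real \<Rightarrow> real) \<Rightarrow> real \<Rightarrow> real" where
  "halfline_adjoint P \<tau> = (\<integral>x. tpow (-\<alpha>) (x - \<tau>) * (weight T \<alpha> x * P x) \<partial>lborel)"

lemma halfline_adjoint_eq_0: "T \<le> \<tau> \<Longrightarrow> halfline_adjoint P \<tau> = 0"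
proof -
  assume "T \<le> \<tau>"
  then have "tpow (-\<alpha>) (x - \<tau>) * (weight T \<alpha> x * P x) = 0" for x
    by (auto simp: tpow_def weight_def)
  then show ?thesis unfolding halfline_adjoint_def by (simp only: Bochner_Integration.integral_zero)
qed

lemma K_halfline:
  assumes "x \<noteq> y"
  shows "has_bochner_integral lborel (\<lambda>\<tau>. tpow (-\<alpha>) (x - \<tau>) * tpow (-\<alpha>) (y - \<tau>)) (\<gamma> 0 * K x y)"
proof (cases "x < y")
  case True
  then show ?thesis using has_bochner_integral_halfline_kernel[of x y \<alpha>] \<alpha>_gt \<alpha>_lt by (simp add: \<gamma>_def K_def)
next
  case False
  then show ?thesis using has_bochner_integral_halfline_kernel[of y x \<alpha>] assms \<alpha>_gt \<alpha>_lt by (simp add: \<gamma>_def K_def mult.commute)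
qed

text \<open>Replacing the kernel by its half-line integral and exchanging \<tau> with (x,y)
  separates the variables, and the integrand becomes a product of two equal factors. Positivity of
  the energy is a consequence.\<close>

lemma energy_halfline:
  assumes P: "continuous_on UNIV P"
  shows "integrable lborel (\<lambda>\<tau>. (halfline_adjoint P \<tau>)\<^sup>2)"
    and "(\<integral>\<tau>. (halfline_adjoint P \<tau>)\<^sup>2 \<partial>lborel) = 
      \<gamma> 0 * Gamma (2 - 2 * \<alpha>) * (\<integral>x. weight T \<alpha> x * P x * potential P x \<partial>lborel)"
proof -
  have [measurable]: "P \<in> borel_measurable borel" 
    using P by (auto intro: borel_measurable_continuous_onI)
  interpret LL: pair_sigma_finite "lborel \<Otimes>\<^sub>M lborel :: (real \<times> real) measure" "lborel :: real measure"
    by (simp add: lborel_prod pair_sigma_finite.intro lborel.sigma_finite_measure_axioms)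
  define w where "w x = weight T \<alpha> x * P x" for x
  have [measurable]: "w \<in> borel_measurable borel" unfolding w_def by measurable
  let ?F = "\<lambda>z \<tau>. (tpow (-\<alpha>) (fst z - \<tau>) * w (fst z)) * (tpow (-\<alpha>) (snd z - \<tau>) * w (snd z))"
  have dbl: "integrable (lborel \<Otimes>\<^sub>M lborel) (\<lambda>z. K (fst z) (snd z) * (w (fst z) * w (snd z)))"
    using integrable_double[OF P P] by (simp add: w_def case_prod_beta')
  have hb: "has_bochner_integral lborel (\<lambda>\<tau>. ?F z \<tau>) (\<gamma> 0 * (K (fst z) (snd z) * (w (fst z) * w (snd z))))"
    and hbn: "has_bochner_integral lborel (\<lambda>\<tau>. norm (?F z \<tau>)) (\<gamma> 0 * \<bar>K (fst z) (snd z) * (w (fst z) * w (snd z))\<bar>)"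
    if "fst z \<noteq> snd z" for z
  proof -
    obtain x y where z: "z = (x, y)" by (cases z)
    have "has_bochner_integral lborel (\<lambda>\<tau>. (tpow (-\<alpha>) (x - \<tau>) * tpow (-\<alpha>) (y - \<tau>)) * c) (\<gamma> 0 * K x y * c)" for c
      using K_halfline[of x y] that by (intro has_bochner_integral_mult_left) (auto simp: z)
    from this[of "w x * w y"] this[of "\<bar>w x * w y\<bar>"]
    show "has_bochner_integral lborel (\<lambda>\<tau>. ?F z \<tau>) (\<gamma> 0 * (K (fst z) (snd z) * (w (fst z) * w (snd z))))"
      "has_bochner_integral lborel (\<lambda>\<tau>. norm (?F z \<tau>)) (\<gamma> 0 * \<bar>K (fst z) (snd z) * (w (fst z) * w (snd z))\<bar>)"
      by (simp_all add: z abs_mult mult_ac)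
  qed
  \<comment> \<open>On the diagonal the kernel integral diverges because 2\<alpha> > 1, so the
    diagonal of the plane has to be discarded as a null set.\<close>
  have AE: "AE z in (lborel \<Otimes>\<^sub>M lborel :: (real \<times> real) measure). fst z \<noteq> snd z"
  proof (rule lborel_pair.AE_pair_measure)
    have "AE y in lborel. x \<noteq> y" for x :: real
      using AE_lborel_singleton[of x] by eventually_elim auto
    then show "AE x in lborel. AE y in lborel. fst (x, y) \<noteq> snd (x, y :: real)" by simp
  qed measurable
  have int: "integrable ((lborel \<Otimes>\<^sub>M lborel) \<Otimes>\<^sub>M lborel) (\<lambda>(z, \<tau>). ?F z \<tau>)"
  proof (rule LL.Fubini_integrable)
    have "integrable (lborel \<Otimes>\<^sub>M lborel) (\<lambda>z. \<gamma> 0 * \<bar>K (fst z) (snd z) * (w (fst z) * w (snd z))\<bar>)"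
      using dbl by auto
    then show "integrable (lborel \<Otimes>\<^sub>M lborel) (\<lambda>z. \<integral>\<tau>. norm ((\<lambda>(z, \<tau>). ?F z \<tau>) (z, \<tau>)) \<partial>lborel)"
      apply (rule integrable_cong_AE_imp)
      subgoal by measurable
      subgoal using AE by eventually_elim (use hbn in \<open>auto simp: has_bochner_integral_iff\<close>)
      done
    show "AE z in lborel \<Otimes>\<^sub>M lborel. integrable lborel (\<lambda>\<tau>. (\<lambda>(z, \<tau>). ?F z \<tau>) (z, \<tau>))"
      using AE by eventually_elim (use hb in \<open>auto simp: has_bochner_integral_iff\<close>)
  qed measurable
  \<comment> \<open>The product can be split only at those \<tau> for which the section is
    integrable, which is almost every \<tau>.\<close>
  have sq: "(\<integral>z. ?F z \<tau> \<partial>(lborel \<Otimes>\<^sub>M lborel)) = (halfline_adjoint P \<tau>)\<^sup>2" 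
    if "integrable (lborel \<Otimes>\<^sub>M lborel) (\<lambda>z. ?F z \<tau>)" for \<tau>
  proof -
    have "(\<integral>z. ?F z \<tau> \<partial>(lborel \<Otimes>\<^sub>M lborel)) = (\<integral>x. (\<integral>y. (tpow (-\<alpha>) (x - \<tau>) * w x) * (tpow (-\<alpha>) (y - \<tau>) * w y) \<partial>lborel) \<partial>lborel)"
      using lborel_pair.integral_fst'[OF that] by simp
    also have "\<dots> = (halfline_adjoint P \<tau>)\<^sup>2"
      by (simp add: halfline_adjoint_def w_def power2_eq_square)
    finally show ?thesis .
  qed
  have AEint: "AE \<tau> in lborel. integrable (lborel \<Otimes>\<^sub>M lborel) (\<lambda>z. ?F z \<tau>)"
    using LL.AE_integrable_snd[OF int] .
  have m: "(\<lambda>\<tau>. (halfline_adjoint P \<tau>)\<^sup>2) \<in> borel_measurable lborel"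
    unfolding halfline_adjoint_def by measurable
  have "integrable lborel (\<lambda>\<tau>. \<integral>z. ?F z \<tau> \<partial>(lborel \<Otimes>\<^sub>M lborel))"
    using LL.integrable_snd[OF int] .
  then show "integrable lborel (\<lambda>\<tau>. (halfline_adjoint P \<tau>)\<^sup>2)"
    apply (rule integrable_cong_AE_imp)
    subgoal by (rule m)
    subgoal using AEint by eventually_elim (use sq in auto)
    done
  have "(\<integral>\<tau>. (halfline_adjoint P \<tau>)\<^sup>2 \<partial>lborel) = (\<integral>\<tau>. \<integral>z. ?F z \<tau> \<partial>(lborel \<Otimes>\<^sub>M lborel) \<partial>lborel)"
    apply (rule integral_cong_AE)
    subgoal by (rule m)
    subgoal by measurable
    subgoal using AEint by eventually_elim (use sq in auto)
    done
  also have "\<dots> = (\<integral>z. (\<integral>\<tau>. ?F z \<tau> \<partial>lborel) \<partial>(lborel \<Otimes>\<^sub>M lborel))"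
    by (rule LL.Fubini_integral[OF int])
  also have "\<dots> = (\<integral>z. \<gamma> 0 * (K (fst z) (snd z) * (w (fst z) * w (snd z))) \<partial>(lborel \<Otimes>\<^sub>M lborel))"
    apply (rule integral_cong_AE)
    subgoal by measurable
    subgoal using dbl by (intro borel_measurable_times borel_measurable_integrable) auto
    subgoal using AE by eventually_elim (use hb in \<open>auto simp: has_bochner_integral_iff\<close>)
    done
  also have "\<dots> = \<gamma> 0 * (\<integral>x. (\<integral>y. K x y * (w x * w y) \<partial>lborel) \<partial>lborel)"
    using lborel_pair.integral_fst'[OF dbl] by simp
  also have "\<dots> = \<gamma> 0 * (\<integral>x. Gamma (2 - 2 * \<alpha>) * (weight T \<alpha> x * P x * potential P x) \<partial>lborel)"
  proof -
    have "(\<integral>y. K x y * (w x * w y) \<partial>lborel) = Gamma (2 - 2 * \<alpha>) * (weight T \<alpha> x * P x * potential P x)" for x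
    proof -
      have "(\<integral>y. K x y * (w x * w y) \<partial>lborel) = (\<integral>y. w x * (K x y * w y) \<partial>lborel)" by (simp add: mult_ac)
      then show ?thesis using Gamma_2_pos by (simp add: potential_def w_def)
    qed
    then show ?thesis by simp
  qed
  finally show "(\<integral>\<tau>. (halfline_adjoint P \<tau>)\<^sup>2 \<partial>lborel) = 
      \<gamma> 0 * Gamma (2 - 2 * \<alpha>) * (\<integral>x. weight T \<alpha> x * P x * potential P x \<partial>lborel)" by simp
qed

text \<open>Abel inversion: for x > t the integral of (\<tau> - t)^(\<alpha>-1) (x -
  \<tau>)^(-\<alpha>) over (t,x) is \<open>\<beta> 0\<close> whatever x is, so the pairing recovers
  the integral of u' over (t,T), which equals -u(t). The cut-off \<open>tpow 0 (T - \<tau>)\<close>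
  changes nothing in the pairing, as the adjoint vanishes beyond T, and it makes the test function
  square integrable.\<close>

lemma primitive_halfline:
  assumes P: "continuous_on UNIV P" and P0: "(\<integral>y. weight T \<alpha> y * P y \<partial>lborel) = 0" and t: "t \<in> {0..T}"
  shows "integrable lborel (\<lambda>\<tau>. halfline_adjoint P \<tau> * (tpow (\<alpha> - 1) (\<tau> - t) * tpow 0 (T - \<tau>)))"
    and "(\<integral>\<tau>. halfline_adjoint P \<tau> * (tpow (\<alpha> - 1) (\<tau> - t) * tpow 0 (T - \<tau>)) \<partial>lborel) = - \<beta> 0 * primitive_of P t"
proof -
  have [measurable]: "P \<in> borel_measurable borel" 
    using P by (auto intro: borel_measurable_continuous_onI)
  define w where "w x = weight T \<alpha> x * P x" for x
  have [measurable]: "w \<in> borel_measurable borel" unfolding w_def by measurable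
  have w: "integrable lborel w" unfolding w_def[abs_def] by (rule integrable_weighted[OF P])
  let ?F = "\<lambda>x \<tau>. (tpow (\<alpha> - 1) (\<tau> - t) * tpow (-\<alpha>) (x - \<tau>)) * w x"
  have hb0: "has_bochner_integral lborel (\<lambda>\<tau>. tpow (\<alpha> - 1) (\<tau> - t) * tpow (-\<alpha>) (x - \<tau>)) (\<beta> 0 * indicator {t<..} x)" for x
  proof (cases "t < x")
    case True
    show ?thesis using has_bochner_integral_Beta[of \<alpha> "1 - \<alpha>" t x] True \<alpha>_gt \<alpha>_lt by (simp add: \<beta>_def Beta_commute)
  next
    case False
    then have "(\<lambda>\<tau>. tpow (\<alpha> - 1) (\<tau> - t) * tpow (-\<alpha>) (x - \<tau>)) = (\<lambda>\<tau>. 0)" by (auto simp: tpow_def)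
    then show ?thesis using False by (simp add: has_bochner_integral_zero)
  qed
  have hb: "has_bochner_integral lborel (?F x) (\<beta> 0 * indicator {t<..} x * w x)" 
    and hbn: "has_bochner_integral lborel (\<lambda>\<tau>. norm (?F x \<tau>)) (\<beta> 0 * indicator {t<..} x * \<bar>w x\<bar>)" for x
    using has_bochner_integral_mult_left[where c = "w x", OF hb0[of x]] has_bochner_integral_mult_left[where c = "\<bar>w x\<bar>", OF hb0[of x]]
    by (auto simp: abs_mult)
  have int: "integrable (lborel \<Otimes>\<^sub>M lborel) (\<lambda>(x, \<tau>). ?F x \<tau>)"
  proof (rule lborel_pair.Fubini_integrable)
    have "integrable lborel (\<lambda>x. \<beta> 0 * (indicator {t<..} x *\<^sub>R \<bar>w x\<bar>))"
      using w by (intro integrable_mult_right integrable_mult_indicator) auto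
    then show "integrable lborel (\<lambda>x. \<integral>\<tau>. norm ((\<lambda>(x, \<tau>). ?F x \<tau>) (x, \<tau>)) \<partial>lborel)"
      using hbn by (simp add: has_bochner_integral_iff mult.assoc)
    show "AE x in lborel. integrable lborel (\<lambda>\<tau>. (\<lambda>(x, \<tau>). ?F x \<tau>) (x, \<tau>))"
      using hb by (simp add: has_bochner_integral_iff)
  qed measurable
  have eq: "(\<integral>x. ?F x \<tau> \<partial>lborel) = halfline_adjoint P \<tau> * (tpow (\<alpha> - 1) (\<tau> - t) * tpow 0 (T - \<tau>))" for \<tau>
  proof -
    have "(\<integral>x. ?F x \<tau> \<partial>lborel) = (\<integral>x. tpow (\<alpha> - 1) (\<tau> - t) * (tpow (-\<alpha>) (x - \<tau>) * (weight T \<alpha> x * P x)) \<partial>lborel)"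
      by (simp add: w_def mult_ac)
    also have "\<dots> = tpow (\<alpha> - 1) (\<tau> - t) * halfline_adjoint P \<tau>" by (simp add: halfline_adjoint_def)
    finally show ?thesis using halfline_adjoint_eq_0[of \<tau> P] by (cases "\<tau> < T") (auto simp: tpow_def)
  qed
  show "integrable lborel (\<lambda>\<tau>. halfline_adjoint P \<tau> * (tpow (\<alpha> - 1) (\<tau> - t) * tpow 0 (T - \<tau>)))"
    using lborel_pair.integrable_snd[OF int] unfolding eq .
  have "(\<integral>\<tau>. halfline_adjoint P \<tau> * (tpow (\<alpha> - 1) (\<tau> - t) * tpow 0 (T - \<tau>)) \<partial>lborel) = (\<integral>x. (\<integral>\<tau>. ?F x \<tau> \<partial>lborel) \<partial>lborel)"
    using lborel_pair.Fubini_integral[OF int] unfolding eq .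
  also have "\<dots> = \<beta> 0 * (\<integral>x. indicator {t<..} x *\<^sub>R w x \<partial>lborel)"
    using hb by (simp add: has_bochner_integral_iff mult.assoc)
  also have "(\<integral>x. indicator {t<..} x *\<^sub>R w x \<partial>lborel) = - primitive_of P t"
  proof -
    have i: "integrable lborel (\<lambda>x. indicator {t<..} x *\<^sub>R w x)" "integrable lborel (\<lambda>x. indicator {0..t} x *\<^sub>R w x)"
      by (rule integrable_mult_indicator[OF _ w]; simp)+
    have "w x = indicator {t<..} x *\<^sub>R w x + indicator {0..t} x *\<^sub>R w x" for x
      by (cases "x \<in> {0<..<T}") (auto simp: indicator_def w_def weight_eq_0)
    then have "(\<integral>x. w x \<partial>lborel) = (\<integral>x. indicator {t<..} x *\<^sub>R w x \<partial>lborel) + (\<integral>x. indicator {0..t} x *\<^sub>R w x \<partial>lborel)"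
      using Bochner_Integration.integral_add[OF i] by simp
    moreover have "(\<integral>x. w x \<partial>lborel) = 0" using P0 by (simp add: w_def)
    moreover have "(\<integral>x. indicator {0..t} x *\<^sub>R w x \<partial>lborel) = integral {0..t} w"
      using set_borel_integral_eq_integral(2)[of "{0..t}" w] i(2) 
      by (simp add: set_integrable_def set_lebesgue_integral_def)
    ultimately show ?thesis by (simp add: primitive_of_def w_def[abs_def])
  qed
  finally show "(\<integral>\<tau>. halfline_adjoint P \<tau> * (tpow (\<alpha> - 1) (\<tau> - t) * tpow 0 (T - \<tau>)) \<partial>lborel) = - \<beta> 0 * primitive_of P t"
    by simp
qed

lemma Gamma_reflection_real: 
  fixes z :: real shows "Gamma z * Gamma (1 - z) = pi / sin (pi * z)"
proof -
  have "complex_of_real (Gamma z * Gamma (1 - z)) = Gamma (of_real z) * Gamma (1 - of_real z)"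
    using Gamma_complex_of_real[of z] Gamma_complex_of_real[of "1 - z"] by simp
  also have "\<dots> = of_real (pi / sin (pi * z))"
    unfolding Gamma_reflection_complex using sin_of_real[of "pi * z", where 'a = complex] by simp
  finally show ?thesis by (simp only: of_real_eq_iff)
qed

text \<open>The reflection formula is applied at 2\<alpha> - 1 and at \<alpha>. With
  sin(\<pi>(2\<alpha> - 1)) = -sin(2\<pi>\<alpha>), the double angle formula leaves
  |cos(\<pi>\<alpha>)|, since the cosine is negative for 1/2 < \<alpha> < 1.\<close>

lemma kappa_eq: 
  "\<gamma> 0 * Gamma (2 - 2 * \<alpha>) / (\<beta> 0)\<^sup>2 * (T powr (2 * \<alpha> - 1) / (2 * \<alpha> - 1)) = kappa T \<alpha> / (2 * T)"
proof -
  have pos: "Gamma \<alpha> > 0" "Gamma (1 - \<alpha>) > 0" "Gamma (2*\<alpha>-1) > 0" "Gamma (2-2*\<alpha>) > 0"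
    using \<alpha>_gt \<alpha>_lt by (auto intro!: Gamma_real_pos)
  have s: "sin (pi * \<alpha>) > 0" using \<alpha>_gt \<alpha>_lt by (intro sin_gt_zero) auto
  have c: "cos (pi * \<alpha>) < 0"
  proof -
    have "cos (pi * \<alpha>) < cos (pi / 2)" using \<alpha>_gt \<alpha>_lt by (intro cos_monotone_0_pi) auto
    then show ?thesis by simp
  qed
  have 1: "Gamma (2*\<alpha>-1) * Gamma (2-2*\<alpha>) = pi / (2 * sin (pi * \<alpha>) * \<bar>cos (pi * \<alpha>)\<bar>)"
  proof -
    have "Gamma (2*\<alpha>-1) * Gamma (1 - (2*\<alpha>-1)) = pi / sin (pi * (2*\<alpha>-1))"
      by (rule Gamma_reflection_real)
    moreover have "sin (pi * (2*\<alpha>-1)) = 2 * sin (pi * \<alpha>) * \<bar>cos (pi * \<alpha>)\<bar>"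
    proof -
      have "pi * (2*\<alpha>-1) = 2 * (pi * \<alpha>) - pi" by (simp add: algebra_simps)
      then have "sin (pi * (2*\<alpha>-1)) = - sin (2 * (pi * \<alpha>))" by (simp add: sin_diff)
      also have "\<dots> = 2 * sin (pi * \<alpha>) * \<bar>cos (pi * \<alpha>)\<bar>" using c by (simp add: sin_double)
      finally show ?thesis .
    qed
    ultimately show ?thesis by simp
  qed
  have 2: "Gamma \<alpha> * Gamma (1 - \<alpha>) = pi / sin (pi * \<alpha>)"
    by (rule Gamma_reflection_real)
  have \<beta>: "\<beta> 0 = Gamma \<alpha> * Gamma (1 - \<alpha>)" by (simp add: \<beta>_def Beta_def)
  have "\<gamma> 0 * Gamma (2 - 2 * \<alpha>) = Gamma (1 - \<alpha>) / Gamma \<alpha> * (Gamma (2*\<alpha>-1) * Gamma (2-2*\<alpha>))"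
    by (simp add: \<gamma>_def Beta_def)
  also have "Gamma (2*\<alpha>-1) * Gamma (2-2*\<alpha>) = (Gamma \<alpha> * Gamma (1 - \<alpha>)) / (2 * \<bar>cos (pi * \<alpha>)\<bar>)"
    unfolding 1 2 by simp
  finally have 3: "\<gamma> 0 * Gamma (2 - 2 * \<alpha>) = (Gamma (1 - \<alpha>))\<^sup>2 / (2 * \<bar>cos (pi * \<alpha>)\<bar>)"
    using pos by (simp add: power2_eq_square)
  have 4: "\<gamma> 0 * Gamma (2 - 2 * \<alpha>) / (\<beta> 0)\<^sup>2 = 1 / (2 * \<bar>cos (pi * \<alpha>)\<bar> * (Gamma \<alpha>)\<^sup>2)"
    unfolding 3 \<beta> using pos by (simp add: power2_eq_square)
  have "T powr (2 * \<alpha>) = T * T powr (2 * \<alpha> - 1)"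
    using T_pos by (simp add: powr_diff)
  then show ?thesis unfolding 4 kappa_def using T_pos by simp
qed

text \<open>Cauchy-Schwarz between the half-line adjoint, whose squared norm is the energy up to a
  factor, and the Abel test function, whose squared norm is (T - t)^(2\<alpha>-1) / (2\<alpha> - 1).
  At t = T the Beta integral degenerates, but there the primitive is zero and the energy is
  nonnegative.\<close>

lemma primitive_bound:
  assumes g: "solves g P" and t: "t \<in> {0..T}"
  shows "(primitive_of P t)\<^sup>2 \<le> kappa T \<alpha> / (2 * T) * integral {0..T} (\<lambda>x. primitive_of P x * g x)"
proof -
  have P: "continuous_on UNIV P" and P0: "(\<integral>y. weight T \<alpha> y * P y \<partial>lborel) = 0"
    using g by (auto simp: solves_def)
  let ?E = "\<integral>x. weight T \<alpha> x * P x * potential P x \<partial>lborel"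
  let ?N = "Gamma (2 - 2 * \<alpha>)"
  let ?\<phi> = "\<lambda>\<tau>. tpow (\<alpha> - 1) (\<tau> - t) * tpow 0 (T - \<tau>)"
  have E: "integral {0..T} (\<lambda>x. primitive_of P x * g x) = ?E" by (rule pairing[OF g P P0])
  show ?thesis
  proof (cases "t < T")
    case True
    have sq: "(\<lambda>\<tau>. (?\<phi> \<tau>)\<^sup>2) = (\<lambda>\<tau>. tpow ((2 * \<alpha> - 1) - 1) (\<tau> - t) * tpow (1 - 1) (T - \<tau>))"
    proof
      fix \<tau>
      have "(tpow (\<alpha> - 1) z)\<^sup>2 = tpow ((2 * \<alpha> - 1) - 1) z" for z
        using tpow_add[of "\<alpha> - 1" "\<alpha> - 1" z] by (simp add: power2_eq_square algebra_simps)
      then show "(?\<phi> \<tau>)\<^sup>2 = tpow ((2 * \<alpha> - 1) - 1) (\<tau> - t) * tpow (1 - 1) (T - \<tau>)"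
        by (simp add: power_mult_distrib) (simp add: tpow_def)
    qed
    have B1: "Beta (2 * \<alpha> - 1) 1 = 1 / (2 * \<alpha> - 1)"
    proof -
      have "Gamma (2 * \<alpha> - 1) > 0" by (rule Gamma_real_pos) (use \<alpha>_gt in auto)
      then have "Gamma (2 * \<alpha> - 1) \<noteq> 0" by (rule less_imp_neq[symmetric])
      then show ?thesis using Gamma_plus1_pos[of "2 * \<alpha> - 1"] \<alpha>_gt by (simp add: Beta_def)
    qed
    have hb: "has_bochner_integral lborel (\<lambda>\<tau>. (?\<phi> \<tau>)\<^sup>2) ((T - t) powr (2 * \<alpha> - 1) * Beta (2 * \<alpha> - 1) 1)"
      unfolding sq using has_bochner_integral_Beta[of "2 * \<alpha> - 1" 1 t T] True \<alpha>_gt by simp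
    have "(\<integral>\<tau>. halfline_adjoint P \<tau> * ?\<phi> \<tau> \<partial>lborel)\<^sup>2 \<le> (\<integral>\<tau>. (halfline_adjoint P \<tau>)\<^sup>2 \<partial>lborel) * (\<integral>\<tau>. (?\<phi> \<tau>)\<^sup>2 \<partial>lborel)"
      by (rule Cauchy_Schwarz_integral[OF energy_halfline(1)[OF P] _ primitive_halfline(1)[OF P P0 t]])
         (use hb in \<open>simp add: has_bochner_integral_iff\<close>)
    then have "(\<beta> 0)\<^sup>2 * (primitive_of P t)\<^sup>2 \<le> (\<gamma> 0 * ?N * ?E) * ((T - t) powr (2 * \<alpha> - 1) / (2 * \<alpha> - 1))"
      unfolding primitive_halfline(2)[OF P P0 t] energy_halfline(2)[OF P] 
      using hb by (simp add: has_bochner_integral_iff B1 power_mult_distrib)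
    also have "\<dots> \<le> (\<gamma> 0 * ?N * ?E) * (T powr (2 * \<alpha> - 1) / (2 * \<alpha> - 1))"
    proof (rule mult_left_mono)
      show "(T - t) powr (2 * \<alpha> - 1) / (2 * \<alpha> - 1) \<le> T powr (2 * \<alpha> - 1) / (2 * \<alpha> - 1)"
        using t True \<alpha>_gt by (intro divide_right_mono powr_mono2) auto
      show "0 \<le> \<gamma> 0 * ?N * ?E"
        unfolding energy_halfline(2)[OF P, symmetric] by (rule integral_nonneg_AE) simp
    qed
    finally have "(primitive_of P t)\<^sup>2 \<le> (\<gamma> 0 * ?N * ?E) * (T powr (2 * \<alpha> - 1) / (2 * \<alpha> - 1)) / (\<beta> 0)\<^sup>2"
      using \<beta>_pos[of 0] by (intro mult_imp_le_div_pos) (simp_all only: mult.commute[of "(primitive_of P t)\<^sup>2"] zero_less_power)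
    also have "\<dots> = (\<gamma> 0 * ?N / (\<beta> 0)\<^sup>2 * (T powr (2 * \<alpha> - 1) / (2 * \<alpha> - 1))) * ?E" by (simp add: mult_ac)
    finally show ?thesis unfolding kappa_eq E .
  next
    case False
    then have "t = T" using t by simp
    then have "primitive_of P t = 0" using primitive_of_T[OF P] P0 by simp
    moreover have "0 \<le> ?E"
    proof -
      have "0 \<le> \<gamma> 0 * ?N * ?E"
        unfolding energy_halfline(2)[OF P, symmetric] by (rule integral_nonneg_AE) simp
      moreover have "0 < \<gamma> 0 * ?N" using \<gamma>_pos[of 0] Gamma_2_pos by (rule mult_pos_pos)
      ultimately show ?thesis by (meson mult_pos_neg not_le)
    qed
    moreover have "0 \<le> kappa T \<alpha> / (2 * T)" unfolding kappa_def using T_pos \<alpha>_gt by simp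
    ultimately show ?thesis unfolding E by (simp only: zero_power2 mult_nonneg_nonneg)
  qed
qed

end

section \<open>Solvability for continuous data\<close>

lemma le_if_le_add_inverse_Suc:
  fixes a z c :: real
  assumes "\<And>n. z \<le> a + c * inverse (real (Suc n))"
  shows "z \<le> a"
proof (rule LIMSEQ_le_const)
  show "(\<lambda>n. a + c * inverse (real (Suc n))) \<longlonglongrightarrow> a"
    using tendsto_add[OF tendsto_const[of a] tendsto_mult[OF tendsto_const[of c] LIMSEQ_inverse_real_of_nat]] by simp
qed (use assms in auto)

context riesz_interval begin

lemma solves_cong:
  assumes "solves g P" "\<And>x. x \<in> {0..T} \<Longrightarrow> g x = h x"
  shows "solves h P"
proof -
  have "integral {0..x} g = integral {0..x} h" if "x \<in> {0<..<T}" for x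
    by (rule integral_cong) (use assms(2) that in auto)
  moreover have "continuous_on {0..T} h \<longleftrightarrow> continuous_on {0..T} g"
    by (rule continuous_on_cong) (use assms(2) in auto)
  ultimately show ?thesis using assms(1) unfolding solves_def by auto
qed

lemma weight_pos: "x \<in> {0<..<T} \<Longrightarrow> weight T \<alpha> x > 0"
  by (auto simp: weight_def tpow_def)

text \<open>Zero datum means zero energy, so the pointwise bound kills the primitive; its
  derivative, the weight times P, vanishes inside, and continuity carries P = 0 to the
  endpoints.\<close>

lemma solves_zero:
  assumes "solves (\<lambda>_. 0) P" and x: "x \<in> {0..T}"
  shows "P x = 0"
proof -
  have P: "continuous_on UNIV P" using assms by (simp add: solves_def)
  have z: "primitive_of P t = 0" if "t \<in> {0..T}" for t
    using primitive_bound[OF assms(1) that] by simp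
  have P0: "P y = 0" if "y \<in> {0<..<T}" for y
  proof -
    have "((\<lambda>_. 0) has_real_derivative weight T \<alpha> y * P y) (at y)"
      by (rule has_field_derivative_transform_within_open[OF primitive_of_deriv[OF P that], of "{0<..<T}"]) 
         (use that z in auto)
    then have "weight T \<alpha> y * P y = 0" using DERIV_unique DERIV_const by blast
    then show ?thesis using weight_pos[OF that] by simp
  qed
  show ?thesis
    by (rule continuous_constant_on_closure[of "{0<..<T}" P 0]) 
       (use P P0 x T_pos in \<open>auto intro: continuous_on_subset\<close>)
qed

lemma solves_unique:
  assumes "solves g P" "solves h Q" "\<And>x. x \<in> {0..T} \<Longrightarrow> g x = h x" "x \<in> {0..T}"
  shows "P x = Q x"
proof -
  have "solves (\<lambda>x. 1 * g x + (-1) * h x) (\<lambda>x. 1 * P x + (-1) * Q x)"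
    by (rule solves_lincomb[OF assms(1,2)])
  then have "solves (\<lambda>_. 0) (\<lambda>x. 1 * P x + (-1) * Q x)"
    by (rule solves_cong) (use assms(3) in auto)
  from solves_zero[OF this assms(4)] show ?thesis by simp
qed

definition C\<^sub>3 :: real where "C\<^sub>3 = 2 * C\<^sub>2 * Gamma (2 - 2 * \<alpha>) * (T + 1)"

lemma C3_pos: "0 < C\<^sub>3"
  unfolding C\<^sub>3_def using C2_pos Gamma_2_pos T_pos by simp

text \<open>The free constants of the approximating problems are not followed. Instead the sum of
  the potential and the integral of the datum is compared at x and at T/2: the two values agree for
  every approximation, hence in the limit.\<close>

lemma solves_limit:
  assumes g: "continuous_on {0..T} g" 
    and q: "\<And>n. solves (q n) (P n)" "\<And>n x. x \<in> {0..T} \<Longrightarrow> \<bar>g x - q n x\<bar> \<le> inverse (real (Suc n))"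
    and Q: "continuous_on UNIV Q" "\<And>n x. x \<in> {0..T} \<Longrightarrow> \<bar>P n x - Q x\<bar> \<le> c * inverse (real (Suc n))"
  shows "solves g Q"
proof -
  have P: "continuous_on UNIV (P n)" and P0: "(\<integral>y. weight T \<alpha> y * P n y \<partial>lborel) = 0" 
    and qc: "continuous_on {0..T} (q n)" for n
    using q(1)[of n] by (auto simp: solves_def)
  let ?N = "Gamma (2 - 2 * \<alpha>)" and ?W = "\<integral>y. weight T \<alpha> y \<partial>lborel"
  have mid: "T / 2 \<in> {0<..<T}" using T_pos by auto
  have "\<bar>\<integral>y. weight T \<alpha> y * Q y \<partial>lborel\<bar> \<le> 0"
  proof (rule le_if_le_add_inverse_Suc)
    fix n
    show "\<bar>\<integral>y. weight T \<alpha> y * Q y \<partial>lborel\<bar> \<le> 0 + ?W * c * inverse (real (Suc n))"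
      using potential_diff_bound(2)[OF mid P[of n] Q(1) Q(2)[of _ n]] P0[of n] by simp
  qed
  then have W0: "(\<integral>y. weight T \<alpha> y * Q y \<partial>lborel) = 0" by simp
  define A where "A x = potential Q x + integral {0..x} g" for x
  have A: "\<bar>(potential (P n) x + integral {0..x} (q n)) - A x\<bar> \<le> (\<beta> 0 / ?N * c + T) * inverse (real (Suc n))"
    if x: "x \<in> {0<..<T}" for x n
  proof -
    have 1: "\<bar>potential (P n) x - potential Q x\<bar> \<le> \<beta> 0 / ?N * (c * inverse (real (Suc n)))"
      by (rule potential_diff_bound(1)[OF x P Q(1) Q(2)])
    have int: "g integrable_on {0..x}" "q n integrable_on {0..x}"
      using x by (auto intro!: integrable_continuous_real continuous_on_subset[OF g] continuous_on_subset[OF qc])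
    have "norm (integral {0..x} (\<lambda>y. q n y - g y)) \<le> inverse (real (Suc n)) * (x - 0)"
    proof (rule integral_bound)
      show "continuous_on {0..x} (\<lambda>y. q n y - g y)"
        using x by (intro continuous_intros continuous_on_subset[OF g] continuous_on_subset[OF qc]) auto
      show "norm (q n t - g t) \<le> inverse (real (Suc n))" if "t \<in> {0..x}" for t
        using q(2)[of t n] that x by (simp add: abs_minus_commute)
    qed (use x in auto)
    also have "\<dots> \<le> inverse (real (Suc n)) * T" using x by (intro mult_left_mono) auto
    finally have "norm (integral {0..x} (\<lambda>y. q n y - g y)) \<le> T * inverse (real (Suc n))" by (simp only: mult.commute)
    then have 2: "\<bar>integral {0..x} (q n) - integral {0..x} g\<bar> \<le> T * inverse (real (Suc n))"
      using integral_diff[OF int(2,1)] by simp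
    have "\<bar>(potential (P n) x + integral {0..x} (q n)) - A x\<bar> \<le> \<beta> 0 / ?N * (c * inverse (real (Suc n))) + T * inverse (real (Suc n))"
      using 1 2 unfolding A_def by linarith
    then show ?thesis by (simp only: distrib_right mult.assoc)
  qed
  have A_const: "A x = A (T / 2)" if x: "x \<in> {0<..<T}" for x
  proof -
    have "\<bar>A x - A (T / 2)\<bar> \<le> 0"
    proof (rule le_if_le_add_inverse_Suc)
      fix n
      obtain d where "\<And>x. x \<in> {0<..<T} \<Longrightarrow> potential (P n) x = d - integral {0..x} (q n)" 
        using q(1)[of n] by (auto simp: solves_def)
      then have "potential (P n) x + integral {0..x} (q n) = potential (P n) (T/2) + integral {0..T/2} (q n)"
        using x mid by simp
      then show "\<bar>A x - A (T / 2)\<bar> \<le> 0 + (2 * (\<beta> 0 / ?N * c + T)) * inverse (real (Suc n))"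
        using A[OF x, of n] A[OF mid, of n] by linarith
    qed
    then show ?thesis by simp
  qed
  show ?thesis
    unfolding solves_def
  proof (intro conjI exI ballI)
    show "potential Q x = A (T/2) - integral {0..x} g" if "x \<in> {0<..<T}" for x
      using A_const[OF that] by (simp add: A_def)
  qed (use g Q W0 in auto)
qed

text \<open>Weierstrass approximation of g. The bound for polynomial data, applied to differences of
  the approximating polynomials, makes the densities uniformly Cauchy, and the same bound passes to
  the limit.\<close>

lemma solves_exists:
  assumes g: "continuous_on {0..T} g" and b: "\<And>x. x \<in> {0..T} \<Longrightarrow> \<bar>g x\<bar> \<le> b"
  shows "\<exists>P. solves g P \<and> (\<forall>x\<in>{0..T}. \<bar>P x\<bar> \<le> C\<^sub>3 * b)"
proof -
  let ?i = "\<lambda>n. inverse (real (Suc n))"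
  have "\<exists>q. real_polynomial_function q \<and> (\<forall>x\<in>{0..T}. \<bar>g x - q x\<bar> \<le> ?i n)" for n
    using Stone_Weierstrass_real_polynomial_function[of "{0..T}" g "?i n"] g
    by (metis compact_Icc less_eq_real_def inverse_positive_iff_positive of_nat_0_less_iff zero_less_Suc)
  then obtain q where q: "\<And>n. real_polynomial_function (q n)" "\<And>n x. x \<in> {0..T} \<Longrightarrow> \<bar>g x - q n x\<bar> \<le> ?i n"
    by metis
  have "\<bar>q n x\<bar> \<le> b + ?i n" if "x \<in> {0..T}" for n x
    using q(2)[OF that, of n] b[OF that] by linarith
  then have "\<exists>P. solves (q n) P \<and> (\<forall>x\<in>{0..T}. \<bar>P x\<bar> \<le> C\<^sub>3 * (b + ?i n))" for n
    unfolding C\<^sub>3_def using solves_polynomial[OF q(1)] by blast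
  then obtain P where P: "\<And>n. solves (q n) (P n)" "\<And>n x. x \<in> {0..T} \<Longrightarrow> \<bar>P n x\<bar> \<le> C\<^sub>3 * (b + ?i n)"
    by metis
  have PP: "\<bar>P n x - P m x\<bar> \<le> C\<^sub>3 * (?i n + ?i m)" if x: "x \<in> {0..T}" for n m x
  proof -
    have poly: "real_polynomial_function (\<lambda>x. q n x - q m x)"
      using real_polynomial_function_diff[OF q(1) q(1)] .
    have "\<bar>q n x - q m x\<bar> \<le> ?i n + ?i m" if "x \<in> {0..T}" for x
      using q(2)[OF that, of n] q(2)[OF that, of m] by linarith
    then obtain R where R: "solves (\<lambda>x. q n x - q m x) R" "\<And>x. x \<in> {0..T} \<Longrightarrow> \<bar>R x\<bar> \<le> C\<^sub>3 * (?i n + ?i m)"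
      unfolding C\<^sub>3_def using solves_polynomial[OF poly] by blast
    \<comment> \<open>The estimate is known only for some solution R with datum q n - q m;
      uniqueness identifies it with the difference P n - P m.\<close>
    have "1 * P n x + (-1) * P m x = R x"
      by (rule solves_unique[OF solves_lincomb[OF P(1) P(1)] R(1)]) (use x in auto)
    then show ?thesis using R(2)[OF x] by simp
  qed
  have "uniformly_Cauchy_on {0..T} P"
  proof (rule uniformly_Cauchy_onI)
    fix e :: real assume "e > 0"
    then have "e / (2 * C\<^sub>3) > 0" using C3_pos by simp
    then obtain M where M: "?i M < e / (2 * C\<^sub>3)" using reals_Archimedean by blast
    show "\<exists>M. \<forall>x\<in>{0..T}. \<forall>m\<ge>M. \<forall>n\<ge>M. dist (P m x) (P n x) < e"
    proof (intro exI ballI allI impI)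
      fix x m n assume x: "x \<in> {0..T}" and mn: "m \<ge> M" "n \<ge> M"
      have "?i m \<le> ?i M" "?i n \<le> ?i M" using mn by (auto intro!: le_imp_inverse_le)
      then have "?i m + ?i n < e / (2 * C\<^sub>3) + e / (2 * C\<^sub>3)" using M by linarith
      also have "\<dots> = e / C\<^sub>3" by (simp add: field_simps)
      finally have "?i m + ?i n < e / C\<^sub>3" .
      then have "C\<^sub>3 * (?i m + ?i n) < e" using C3_pos by (simp add: pos_less_divide_eq mult.commute)
      then show "dist (P m x) (P n x) < e" using PP[OF x, of m n] by (simp add: dist_real_def)
    qed
  qed
  then have "uniformly_convergent_on {0..T} P" by (rule Cauchy_uniformly_convergent)
  then obtain Q where Q: "uniform_limit {0..T} P Q sequentially" by (auto simp: uniformly_convergent_on_def)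
  have Pc: "continuous_on {0..T} (P n)" for n
    using P(1)[of n] by (auto simp: solves_def intro: continuous_on_subset)
  have Qc: "continuous_on {0..T} Q"
    by (rule uniform_limit_theorem[OF _ Q]) (use Pc in auto)
  define R where "R x = Q (max 0 (min T x))" for x
  have Rc: "continuous_on UNIV R"
    unfolding R_def[abs_def] using T_pos by (intro continuous_on_compose2[OF Qc]) (auto intro!: continuous_intros)
  have RQ: "R x = Q x" if "x \<in> {0..T}" for x using that by (simp add: R_def)
  have lim: "(\<lambda>m. P m x) \<longlonglongrightarrow> R x" if "x \<in> {0..T}" for x
    using tendsto_uniform_limitI[OF Q that] RQ[OF that] by simp
  have i0: "?i \<longlonglongrightarrow> 0" by (rule LIMSEQ_inverse_real_of_nat)
  have PR: "\<bar>P n x - R x\<bar> \<le> C\<^sub>3 * ?i n" if x: "x \<in> {0..T}" for n x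
  proof (rule LIMSEQ_le)
    show "(\<lambda>m. \<bar>P n x - P m x\<bar>) \<longlonglongrightarrow> \<bar>P n x - R x\<bar>" by (intro tendsto_intros lim x)
    have "(\<lambda>m. C\<^sub>3 * (?i n + ?i m)) \<longlonglongrightarrow> C\<^sub>3 * (?i n + 0)" by (intro tendsto_intros i0)
    then show "(\<lambda>m. C\<^sub>3 * (?i n + ?i m)) \<longlonglongrightarrow> C\<^sub>3 * ?i n" by simp
  qed (use PP[OF x] in auto)
  have "solves g R" by (rule solves_limit[OF g P(1) q(2) Rc PR])
  moreover have "\<bar>R x\<bar> \<le> C\<^sub>3 * b" if x: "x \<in> {0..T}" for x
  proof (rule le_if_le_add_inverse_Suc)
    fix n
    have "\<bar>R x\<bar> \<le> C\<^sub>3 * (b + ?i n) + C\<^sub>3 * ?i n" using PR[OF x, of n] P(2)[OF x, of n] by linarith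
    then show "\<bar>R x\<bar> \<le> C\<^sub>3 * b + (2 * C\<^sub>3) * ?i n" by (simp only: distrib_left mult_2 distrib_right)
  qed
  ultimately show ?thesis by blast
qed

end

section \<open>Flux and absolute continuity\<close>

text \<open>Integrands built from \<open>deriv u\<close> have arbitrary values at some points and
  are integrated over \<open>lebesgue\<close>. A Borel function equal to them almost everywhere
  transfers the computation to \<open>lborel\<close>.\<close>

lemma integral_lebesgue_eq_lborel:
  fixes F G :: "real \<Rightarrow> real"
  assumes G[measurable]: "G \<in> borel_measurable borel" and eq: "AE x in lborel. F x = G x"
  shows "integral\<^sup>L lebesgue F = integral\<^sup>L lborel G"
    and "F \<in> borel_measurable lebesgue"
    and "integrable lborel G \<Longrightarrow> integrable lebesgue F"
proof -
  have G': "G \<in> borel_measurable lebesgue" by (rule measurable_completion) simp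
  have AE: "AE x in lebesgue. G x = F x" using AE_completion[OF eq] by eventually_elim simp
  show F: "F \<in> borel_measurable lebesgue" by (rule borel_measurable_AE[OF G' AE])
  have "integral\<^sup>L lebesgue F = integral\<^sup>L lebesgue G"
    by (rule integral_cong_AE[OF F G']) (use AE in auto)
  also have "\<dots> = integral\<^sup>L lborel G" by (rule integral_completion) simp
  finally show "integral\<^sup>L lebesgue F = integral\<^sup>L lborel G" .
  assume "integrable lborel G"
  then have "integrable lebesgue G" by (subst integrable_completion) auto
  then show "integrable lebesgue F" by (rule integrable_cong_AE_imp) (use F AE in auto)
qed

text \<open>Composition of two integral operators whose kernels compose to c. Nonnegativity of the
  kernels turns integrability of c * w into the absolute integrability required by Fubini; the value
  at the single point r = t is left open because the composed kernel may be singular there.\<close>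

lemma integral_convolve:
  fixes a c w :: "real \<Rightarrow> real" and b :: "real \<Rightarrow> real \<Rightarrow> real"
  assumes [measurable]: "a \<in> borel_measurable borel" "(\<lambda>z. b (fst z) (snd z)) \<in> borel_measurable (borel \<Otimes>\<^sub>M borel)"
    "w \<in> borel_measurable borel"
    and nn: "\<And>s. 0 \<le> a s" "\<And>s r. 0 \<le> b s r"
    and hb: "\<And>r. r \<noteq> t \<Longrightarrow> has_bochner_integral lborel (\<lambda>s. a s * b s r) (c r)"
    and int: "integrable lborel (\<lambda>r. c r * w r)"
  shows "(\<integral>s. a s * (\<integral>r. b s r * w r \<partial>lborel) \<partial>lborel) = (\<integral>r. c r * w r \<partial>lborel)"
proof -
  let ?F = "\<lambda>r s. (a s * b s r) * w r"
  have [measurable]: "(\<lambda>(r, s). ?F r s) \<in> borel_measurable (borel \<Otimes>\<^sub>M borel)"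
  proof -
    have "(\<lambda>z. (\<lambda>z. b (fst z) (snd z)) (snd z, fst z)) \<in> borel_measurable (borel \<Otimes>\<^sub>M borel)"
      by (rule measurable_compose[OF _ assms(2)]) measurable
    then have [measurable]: "(\<lambda>z. b (snd z) (fst z)) \<in> borel_measurable (borel \<Otimes>\<^sub>M borel)" by simp
    show ?thesis unfolding case_prod_beta' by measurable
  qed
  have h1: "has_bochner_integral lborel (\<lambda>s. ?F r s) (c r * w r)" if "r \<noteq> t" for r
    using hb[OF that] by (intro has_bochner_integral_mult_left)
  have h2: "has_bochner_integral lborel (\<lambda>s. norm (?F r s)) \<bar>c r * w r\<bar>" if "r \<noteq> t" for r
  proof -
    have "0 \<le> c r"
    proof -
      have "c r = (\<integral>s. a s * b s r \<partial>lborel)" using hb[OF that] by (simp add: has_bochner_integral_iff)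
      then show ?thesis using nn by (simp add: integral_nonneg_AE)
    qed
    moreover have "has_bochner_integral lborel (\<lambda>s. (a s * b s r) * \<bar>w r\<bar>) (c r * \<bar>w r\<bar>)"
      using hb[OF that] by (intro has_bochner_integral_mult_left)
    ultimately show ?thesis using nn by (simp add: abs_mult)
  qed
  have AE: "AE r in lborel. r \<noteq> t" by (rule AE_lborel_singleton)
  have F: "integrable (lborel \<Otimes>\<^sub>M lborel) (\<lambda>(r, s). ?F r s)"
  proof (rule lborel_pair.Fubini_integrable)
    have "integrable lborel (\<lambda>r. \<bar>c r * w r\<bar>)" using int by (rule integrable_abs)
    then show "integrable lborel (\<lambda>r. \<integral>s. norm ((\<lambda>(r, s). ?F r s) (r, s)) \<partial>lborel)"
      apply (rule integrable_cong_AE_imp)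
      subgoal by measurable
      subgoal using AE by eventually_elim (use h2 in \<open>auto simp: has_bochner_integral_iff\<close>)
      done
    show "AE r in lborel. integrable lborel (\<lambda>s. (\<lambda>(r, s). ?F r s) (r, s))"
      using AE by eventually_elim (use h1 in \<open>auto simp: has_bochner_integral_iff\<close>)
  qed measurable
  have "(\<integral>s. a s * (\<integral>r. b s r * w r \<partial>lborel) \<partial>lborel) = (\<integral>s. (\<integral>r. ?F r s \<partial>lborel) \<partial>lborel)"
    by (simp add: mult.assoc)
  also have "\<dots> = (\<integral>r. (\<integral>s. ?F r s \<partial>lborel) \<partial>lborel)"
    by (rule lborel_pair.Fubini_integral[OF F])
  also have "\<dots> = (\<integral>r. c r * w r \<partial>lborel)"
    apply (rule integral_cong_AE)
    subgoal by measurable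
    subgoal using int by (rule borel_measurable_integrable)
    subgoal using AE by eventually_elim (use h1 in \<open>auto simp: has_bochner_integral_iff\<close>)
    done
  finally show ?thesis .
qed

lemma caputo_left_eq:
  assumes \<alpha>: "\<alpha> < 1" and [measurable]: "w \<in> borel_measurable borel"
    and dw: "\<And>r. r \<in> {0<..<T} \<Longrightarrow> deriv u r = w r" and w0: "\<And>r. r \<notin> {0<..<T} \<Longrightarrow> w r = 0"
    and s: "s \<in> {0<..<T}"
  shows "caputo_left \<alpha> u s = 1 / Gamma (1 - \<alpha>) * (\<integral>r. tpow (-\<alpha>) (s - r) * w r \<partial>lborel)"
proof -
  have "integral\<^sup>L lebesgue (\<lambda>r. indicator {0..s} r *\<^sub>R ((s - r) powr (- \<alpha>) * deriv u r)) = (\<integral>r. tpow (-\<alpha>) (s - r) * w r \<partial>lborel)"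
  proof (rule integral_lebesgue_eq_lborel(1))
    show "AE r in lborel. indicator {0..s} r *\<^sub>R ((s - r) powr (- \<alpha>) * deriv u r) = tpow (-\<alpha>) (s - r) * w r"
      using AE_lborel_singleton[of 0] AE_lborel_singleton[of s]
      by eventually_elim (use s dw w0 in \<open>auto simp: indicator_def tpow_def\<close>)
  qed measurable
  then show ?thesis using \<alpha> by (simp add: caputo_left_def set_lebesgue_integral_def)
qed

lemma caputo_right_eq:
  assumes \<alpha>: "\<alpha> < 1" and [measurable]: "w \<in> borel_measurable borel"
    and dw: "\<And>r. r \<in> {0<..<T} \<Longrightarrow> deriv u r = w r" and w0: "\<And>r. r \<notin> {0<..<T} \<Longrightarrow> w r = 0"
    and s: "s \<in> {0<..<T}"
  shows "caputo_right T \<alpha> u s = - (1 / Gamma (1 - \<alpha>)) * (\<integral>r. tpow (-\<alpha>) (r - s) * w r \<partial>lborel)"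
proof -
  have "integral\<^sup>L lebesgue (\<lambda>r. indicator {s..T} r *\<^sub>R ((r - s) powr (- \<alpha>) * deriv u r)) = (\<integral>r. tpow (-\<alpha>) (r - s) * w r \<partial>lborel)"
  proof (rule integral_lebesgue_eq_lborel(1))
    show "AE r in lborel. indicator {s..T} r *\<^sub>R ((r - s) powr (- \<alpha>) * deriv u r) = tpow (-\<alpha>) (r - s) * w r"
      using AE_lborel_singleton[of T] AE_lborel_singleton[of s]
      by eventually_elim (use s dw w0 in \<open>auto simp: indicator_def tpow_def\<close>)
  qed measurable
  then show ?thesis using \<alpha> by (simp add: caputo_right_def set_lebesgue_integral_def)
qed

section \<open>Square integrability of the derivative and absolute continuity\<close>

context weighted_interval begin

lemma measurable_weighted:
  "continuous_on UNIV P \<Longrightarrow> (\<lambda>x. weight T \<alpha> x * P x) \<in> borel_measurable borel"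
  by (intro borel_measurable_times measurable_weight borel_measurable_continuous_onI)

lemma deriv_primitive_of:
  "continuous_on UNIV P \<Longrightarrow> x \<in> {0<..<T} \<Longrightarrow> deriv (primitive_of P) x = weight T \<alpha> x * P x"
  by (rule DERIV_imp_deriv[OF primitive_of_deriv])

text \<open>The exponent 2\<alpha> - 2 exceeds -1 precisely when \<alpha> > 1/2.\<close>

lemma integrable_weight_square: "integrable lborel (\<lambda>x. (weight T \<alpha> x)\<^sup>2)"
proof -
  have "(tpow (\<alpha> - 1) z)\<^sup>2 = tpow ((2 * \<alpha> - 1) - 1) z" for z
    using tpow_add[of "\<alpha> - 1" "\<alpha> - 1" z] by (simp add: power2_eq_square algebra_simps)
  then have "(\<lambda>x. (weight T \<alpha> x)\<^sup>2) = (\<lambda>x. tpow ((2 * \<alpha> - 1) - 1) (x - 0) * tpow ((2 * \<alpha> - 1) - 1) (T - x))"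
    by (auto simp: weight_def power_mult_distrib)
  then show ?thesis
    using has_bochner_integral_Beta[of "2 * \<alpha> - 1" "2 * \<alpha> - 1" 0 T] \<alpha>_gt T_pos by (simp add: has_bochner_integral_iff)
qed

lemma integrable_weighted_square:
  assumes P: "continuous_on UNIV P"
  shows "integrable lborel (\<lambda>x. (weight T \<alpha> x * P x)\<^sup>2)"
proof -
  have [measurable]: "P \<in> borel_measurable borel" using P by (rule borel_measurable_continuous_onI)
  obtain b where b: "b > 0" "\<And>y. y \<in> {0..T} \<Longrightarrow> \<bar>P y\<bar> \<le> b"
    using bounded_on_interval[OF P] by blast
  have "(weight T \<alpha> x * P x)\<^sup>2 \<le> (weight T \<alpha> x)\<^sup>2 * b\<^sup>2" for x
    using power_mono[OF weighted_bound[of P b x] abs_ge_zero, of 2] b(2) by (simp add: power_mult_distrib)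
  then show ?thesis
    by (intro Bochner_Integration.integrable_bound[OF integrable_mult_left[OF integrable_weight_square, of "b\<^sup>2"]]) auto
qed

lemma primitive_of_diff_le:
  assumes P: "continuous_on UNIV P" and ab: "0 \<le> a" "a \<le> b" "b \<le> T"
  shows "\<bar>primitive_of P b - primitive_of P a\<bar> \<le> (\<integral>x. indicator {a<..<b} x * \<bar>weight T \<alpha> x * P x\<bar> \<partial>lborel)"
proof -
  let ?w = "\<lambda>x. weight T \<alpha> x * P x"
  have "primitive_of P a + integral {a..b} ?w = primitive_of P b"
    unfolding primitive_of_def by (rule Henstock_Kurzweil_Integration.integral_combine) (use ab integrable_on_weighted[OF P] in auto)
  moreover have "integral {a..b} ?w = (\<integral>x. indicator {a<..<b} x * ?w x \<partial>lborel)"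
  proof -
    have "set_integrable lborel {a<..<b} ?w"
      unfolding set_integrable_def by (rule integrable_mult_indicator) (use integrable_weighted[OF P] in auto)
    from set_borel_integral_eq_integral(2)[OF this]
    show ?thesis by (simp add: set_lebesgue_integral_def integral_open_interval_real)
  qed
  moreover have "\<bar>\<integral>x. indicator {a<..<b} x * ?w x \<partial>lborel\<bar> \<le> (\<integral>x. \<bar>indicator {a<..<b} x * ?w x\<bar> \<partial>lborel)"
    by (rule integral_abs_bound)
  ultimately show ?thesis by (simp add: abs_mult)
qed

text \<open>Square integrability of w = u' replaces the absolute continuity of the integral: |w|
  \<le> l/2 + w^2/(2 l), where the first term is paid for by the total length of the intervals and
  the second by disjointness, since the integrals of w^2 over them add up to at most V.\<close>

lemma primitive_of_absolutely_continuous: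
  assumes P: "continuous_on UNIV P"
  shows "absolutely_continuous_on_interval 0 T (primitive_of P)"
  unfolding absolutely_continuous_on_interval_def
proof (intro allI impI)
  fix \<epsilon> :: real assume \<epsilon>: "\<epsilon> > 0"
  let ?w = "\<lambda>x. weight T \<alpha> x * P x"
  define V where "V = (\<integral>x. (?w x)\<^sup>2 \<partial>lborel)"
  have V: "0 \<le> V" unfolding V_def by (rule integral_nonneg_AE) simp
  \<comment> \<open>Makes V / (2 l) smaller than \<epsilon>/2; the total length below \<epsilon>/l
    then keeps the other half below \<epsilon>/2.\<close>
  define l where "l = V / \<epsilon> + 1"
  have l: "0 < l" "V / l < \<epsilon>" 
  proof -
    show "0 < l" using V \<epsilon> by (simp add: l_def add_nonneg_pos)
    have "V < \<epsilon> * l" using \<epsilon> by (simp add: l_def algebra_simps)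
    then show "V / l < \<epsilon>" using \<open>0 < l\<close> by (simp add: pos_divide_less_eq)
  qed
  show "\<exists>\<delta>>0. \<forall>(n::nat) a b. (\<forall>i<n. 0 \<le> a i \<and> a i \<le> b i \<and> b i \<le> T) \<longrightarrow>
       (\<forall>i<n. \<forall>j<n. i \<noteq> j \<longrightarrow> {a i<..<b i} \<inter> {a j<..<b j} = {}) \<longrightarrow>
       (\<Sum>i<n. b i - a i) < \<delta> \<longrightarrow> (\<Sum>i<n. \<bar>primitive_of P (b i) - primitive_of P (a i)\<bar>) < \<epsilon>"
  proof (intro exI[of _ "\<epsilon> / l"] conjI allI impI)
    show "0 < \<epsilon> / l" using \<epsilon> l by simp
    fix n :: nat and a b :: "nat \<Rightarrow> real"
    assume ab: "\<forall>i<n. 0 \<le> a i \<and> a i \<le> b i \<and> b i \<le> T"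
      and disj: "\<forall>i<n. \<forall>j<n. i \<noteq> j \<longrightarrow> {a i<..<b i} \<inter> {a j<..<b j} = {}"
      and small: "(\<Sum>i<n. b i - a i) < \<epsilon> / l"
    let ?I = "\<lambda>i x. indicator {a i<..<b i} x :: real"
    have int1: "integrable lborel (?I i)" for i
      by (cases "a i \<le> b i") (auto intro!: integrable_real_indicator)
    have int2: "integrable lborel (\<lambda>x. ?I i x * (?w x)\<^sup>2)" for i
      using integrable_mult_indicator[OF _ integrable_weighted_square[OF P], of "{a i<..<b i}"] by simp
    have int3: "integrable lborel (\<lambda>x. ?I i x * \<bar>?w x\<bar>)" for i
      using integrable_mult_indicator[OF _ integrable_abs[OF integrable_weighted[OF P]], of "{a i<..<b i}"] by simp
    have pt: "\<bar>?w x\<bar> \<le> l / 2 + (?w x)\<^sup>2 / (2 * l)" for x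
    proof -
      have "0 \<le> (l - \<bar>?w x\<bar>)\<^sup>2" by simp
      then have "2 * l * \<bar>?w x\<bar> \<le> l\<^sup>2 + (?w x)\<^sup>2" by (simp add: power2_diff)
      then show ?thesis using l(1) by (simp add: field_simps power2_eq_square)
    qed
    have "(\<Sum>i<n. \<bar>primitive_of P (b i) - primitive_of P (a i)\<bar>) \<le> (\<Sum>i<n. l / 2 * (b i - a i) + (\<integral>x. ?I i x * (?w x)\<^sup>2 \<partial>lborel) / (2 * l))"
    proof (rule sum_mono)
      fix i assume "i \<in> {..<n}"
      then have i: "0 \<le> a i" "a i \<le> b i" "b i \<le> T" using ab by auto
      have "\<bar>primitive_of P (b i) - primitive_of P (a i)\<bar> \<le> (\<integral>x. ?I i x * \<bar>?w x\<bar> \<partial>lborel)"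
        by (rule primitive_of_diff_le[OF P i])
      also have "\<dots> \<le> (\<integral>x. l / 2 * ?I i x + ?I i x * (?w x)\<^sup>2 / (2 * l) \<partial>lborel)"
      proof (rule integral_mono[OF int3])
        show "integrable lborel (\<lambda>x. l / 2 * ?I i x + ?I i x * (?w x)\<^sup>2 / (2 * l))"
          by (intro Bochner_Integration.integrable_add integrable_mult_right integrable_divide int1 int2)
        show "?I i x * \<bar>?w x\<bar> \<le> l / 2 * ?I i x + ?I i x * (?w x)\<^sup>2 / (2 * l)" for x
          using pt[of x] by (simp add: indicator_def)
      qed
      also have "\<dots> = l / 2 * (\<integral>x. ?I i x \<partial>lborel) + (\<integral>x. ?I i x * (?w x)\<^sup>2 \<partial>lborel) / (2 * l)"
        using int1[of i] int2[of i] by (subst Bochner_Integration.integral_add) auto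
      also have "(\<integral>x. ?I i x \<partial>lborel) = b i - a i" using i by simp
      finally show "\<bar>primitive_of P (b i) - primitive_of P (a i)\<bar> \<le> l / 2 * (b i - a i) + (\<integral>x. ?I i x * (?w x)\<^sup>2 \<partial>lborel) / (2 * l)" .
    qed
    also have "\<dots> = l / 2 * (\<Sum>i<n. b i - a i) + (\<Sum>i<n. (\<integral>x. ?I i x * (?w x)\<^sup>2 \<partial>lborel)) / (2 * l)"
      by (simp only: sum.distrib sum_distrib_left sum_divide_distrib)
    also have "(\<Sum>i<n. (\<integral>x. ?I i x * (?w x)\<^sup>2 \<partial>lborel)) = (\<integral>x. (\<Sum>i<n. ?I i x * (?w x)\<^sup>2) \<partial>lborel)"
      by (rule Bochner_Integration.integral_sum[symmetric]) (rule int2)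
    also have "\<dots> \<le> V"
      unfolding V_def
    proof (rule integral_mono)
      fix x
      have "(\<Sum>i<n. ?I i x) = indicator (\<Union>i\<in>{..<n}. {a i<..<b i}) x"
        by (rule indicator_UN_disjoint[symmetric]) (use disj in \<open>auto simp: disjoint_family_on_def\<close>)
      then have "(\<Sum>i<n. ?I i x) \<le> 1" by (simp add: indicator_le_1)
      then show "(\<Sum>i<n. ?I i x * (?w x)\<^sup>2) \<le> (?w x)\<^sup>2"
        unfolding sum_distrib_right[symmetric] by (rule mult_left_le_one_le[rotated 2]) (auto intro: sum_nonneg)
    qed (intro Bochner_Integration.integrable_sum int2 integrable_weighted_square P)+
    finally have "(\<Sum>i<n. \<bar>primitive_of P (b i) - primitive_of P (a i)\<bar>) \<le> l / 2 * (\<Sum>i<n. b i - a i) + V / (2 * l)"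
      using l(1) by (simp add: divide_right_mono)
    moreover have "l / 2 * (\<Sum>i<n. b i - a i) < \<epsilon> / 2"
      using small l(1) by (simp add: pos_less_divide_eq mult.commute)
    moreover have "V / (2 * l) < \<epsilon> / 2" using l by (simp add: field_simps)
    ultimately show "(\<Sum>i<n. \<bar>primitive_of P (b i) - primitive_of P (a i)\<bar>) < \<epsilon>" by linarith
  qed
qed

end

section \<open>The flux as a Riesz potential\<close>

context riesz_interval begin

text \<open>On each side two Abel kernels of exponent -\<alpha> compose to |t - r|^(1-2\<alpha>)
  times Beta(1-\<alpha>, 1-\<alpha>). The minus sign in the right Caputo derivative turns the
  difference in the flux into a sum, so that the two one-sided kernels join to K, and the Beta value
  over \<Gamma>(1-\<alpha>)^2 is 1 / \<Gamma>(2 - 2\<alpha>).\<close>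

lemma flux_primitive_of:
  assumes P: "continuous_on UNIV P" and t: "t \<in> {0<..<T}"
  shows "flux T \<alpha> (primitive_of P) t = potential P t"
proof -
  define w where "w x = weight T \<alpha> x * P x" for x
  have [measurable]: "w \<in> borel_measurable borel" unfolding w_def[abs_def] by (rule measurable_weighted[OF P])
  have w0: "w r = 0" if "r \<notin> {0<..<T}" for r using that by (simp add: w_def weight_eq_0)
  have dw: "deriv (primitive_of P) r = w r" if "r \<in> {0<..<T}" for r
    unfolding w_def by (rule deriv_primitive_of[OF P that])
  let ?G = "Gamma (1 - \<alpha>)" and ?B = "Beta (1 - \<alpha>) (1 - \<alpha>)"
  let ?u = "primitive_of P"
  have K: "integrable lborel (\<lambda>r. K t r * w r)" unfolding w_def by (rule integrable_K_weighted[OF t P])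
  have K_eq: "tpow (1 - 2 * \<alpha>) (t - r) = indicator {..<t} r * K t r" "tpow (1 - 2 * \<alpha>) (r - t) = indicator {t<..} r * K t r" for r
    by (auto simp: tpow_def K_def indicator_def)
  have intL: "integrable lborel (\<lambda>r. (tpow (1 - 2 * \<alpha>) (t - r) * ?B) * w r)"
    and intR: "integrable lborel (\<lambda>r. (tpow (1 - 2 * \<alpha>) (r - t) * ?B) * w r)"
  proof -
    have "integrable lborel (\<lambda>r. ?B * (indicator A r *\<^sub>R (K t r * w r)))" if "A \<in> sets borel" for A :: "real set"
      using that by (intro integrable_mult_right integrable_mult_indicator K) auto
    from this[of "{..<t}"] this[of "{t<..}"]
    show "integrable lborel (\<lambda>r. (tpow (1 - 2 * \<alpha>) (t - r) * ?B) * w r)"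
      "integrable lborel (\<lambda>r. (tpow (1 - 2 * \<alpha>) (r - t) * ?B) * w r)"
      unfolding K_eq by (simp_all add: mult_ac)
  qed
  have hbB: "has_bochner_integral lborel (\<lambda>s. tpow (-\<alpha>) (s - a) * tpow (-\<alpha>) (b - s)) (tpow (1 - 2 * \<alpha>) (b - a) * ?B)"
    if "a \<noteq> b" for a b
  proof (cases "a < b")
    case True
    then show ?thesis using has_bochner_integral_Beta[of "1 - \<alpha>" "1 - \<alpha>" a b] \<alpha>_lt by (simp add: tpow_pos)
  next
    case False
    then have "(\<lambda>s. tpow (-\<alpha>) (s - a) * tpow (-\<alpha>) (b - s)) = (\<lambda>s. 0)" by (auto simp: tpow_def)
    moreover have "tpow (1 - 2 * \<alpha>) (b - a) = 0" using False by (auto simp: tpow_def)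
    ultimately show ?thesis by (simp add: has_bochner_integral_zero)
  qed
  have L: "frac_integral_left (1 - \<alpha>) (caputo_left \<alpha> ?u) t = 1 / ?G * (1 / ?G * (\<integral>r. (tpow (1 - 2 * \<alpha>) (t - r) * ?B) * w r \<partial>lborel))"
  proof -
    let ?A = "\<lambda>s. \<integral>r. tpow (-\<alpha>) (s - r) * w r \<partial>lborel"
    \<comment> \<open>The defining integral is restricted to [0,t], whereas the truncated power
      extends to all s < t; the two agree because the inner integral vanishes for negative
      s.\<close>
    have A0: "?A s = 0" if "s < 0" for s
    proof -
      have "tpow (-\<alpha>) (s - r) * w r = 0" for r using that w0[of r] by (cases "r \<in> {0<..<T}") (auto simp: tpow_def)
      then show ?thesis by (simp only: Bochner_Integration.integral_zero)
    qed
    have "integral\<^sup>L lebesgue (\<lambda>s. indicator {0..t} s *\<^sub>R ((t - s) powr ((1 - \<alpha>) - 1) * caputo_left \<alpha> ?u s)) = 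
      (\<integral>s. tpow (-\<alpha>) (t - s) * (1 / ?G * ?A s) \<partial>lborel)"
    proof (rule integral_lebesgue_eq_lborel(1))
      show "AE s in lborel. indicator {0..t} s *\<^sub>R ((t - s) powr ((1 - \<alpha>) - 1) * caputo_left \<alpha> ?u s) = tpow (-\<alpha>) (t - s) * (1 / ?G * ?A s)"
        using AE_lborel_singleton[of 0] AE_lborel_singleton[of t]
      proof eventually_elim
        case (elim s)
        consider "s < 0" | "0 < s" "s < t" | "t < s" using elim by linarith
        then show ?case
        proof cases
          case 2
          then have "caputo_left \<alpha> ?u s = 1 / ?G * ?A s"
            using t by (intro caputo_left_eq[where T = T, OF \<alpha>_lt _ dw w0]) auto
          then show ?thesis using 2 by (simp add: tpow_pos)
        qed (use A0 in \<open>auto simp: tpow_def\<close>)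
      qed
    qed measurable
    also have "\<dots> = 1 / ?G * (\<integral>s. tpow (-\<alpha>) (t - s) * ?A s \<partial>lborel)"
      by (subst integral_mult_right_zero[symmetric]) (simp add: mult_ac)
    also have "(\<integral>s. tpow (-\<alpha>) (t - s) * ?A s \<partial>lborel) = (\<integral>r. (tpow (1 - 2 * \<alpha>) (t - r) * ?B) * w r \<partial>lborel)"
    proof (rule integral_convolve[OF _ _ _ _ _ _ intL])
      show "has_bochner_integral lborel (\<lambda>s. tpow (-\<alpha>) (t - s) * tpow (-\<alpha>) (s - r)) (tpow (1 - 2 * \<alpha>) (t - r) * ?B)" if "r \<noteq> t" for r
        using hbB[OF that] by (simp add: mult.commute)
    qed auto
    finally show ?thesis using \<alpha>_lt by (simp add: frac_integral_left_def set_lebesgue_integral_def)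
  qed
  have R: "frac_integral_right T (1 - \<alpha>) (caputo_right T \<alpha> ?u) t = 1 / ?G * (- (1 / ?G) * (\<integral>r. (tpow (1 - 2 * \<alpha>) (r - t) * ?B) * w r \<partial>lborel))"
  proof -
    let ?A = "\<lambda>s. \<integral>r. tpow (-\<alpha>) (r - s) * w r \<partial>lborel"
    have A0: "?A s = 0" if "s > T" for s
    proof -
      have "tpow (-\<alpha>) (r - s) * w r = 0" for r using that w0[of r] by (cases "r \<in> {0<..<T}") (auto simp: tpow_def)
      then show ?thesis by (simp only: Bochner_Integration.integral_zero)
    qed
    have "integral\<^sup>L lebesgue (\<lambda>s. indicator {t..T} s *\<^sub>R ((s - t) powr ((1 - \<alpha>) - 1) * caputo_right T \<alpha> ?u s)) = 
      (\<integral>s. tpow (-\<alpha>) (s - t) * (- (1 / ?G) * ?A s) \<partial>lborel)"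
    proof (rule integral_lebesgue_eq_lborel(1))
      show "AE s in lborel. indicator {t..T} s *\<^sub>R ((s - t) powr ((1 - \<alpha>) - 1) * caputo_right T \<alpha> ?u s) = tpow (-\<alpha>) (s - t) * (- (1 / ?G) * ?A s)"
        using AE_lborel_singleton[of T] AE_lborel_singleton[of t]
      proof eventually_elim
        case (elim s)
        consider "s < t" | "t < s" "s < T" | "T < s" using elim by linarith
        then show ?case
        proof cases
          case 2
          then have "caputo_right T \<alpha> ?u s = - (1 / ?G) * ?A s"
            using t by (intro caputo_right_eq[where T = T, OF \<alpha>_lt _ dw w0]) auto
          then show ?thesis using 2 by (simp add: tpow_pos)
        qed (use A0 in \<open>auto simp: tpow_def\<close>)
      qed
    qed measurable
    also have "\<dots> = - (1 / ?G) * (\<integral>s. tpow (-\<alpha>) (s - t) * ?A s \<partial>lborel)"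
      by (subst integral_mult_right_zero[symmetric]) (simp add: mult_ac)
    also have "(\<integral>s. tpow (-\<alpha>) (s - t) * ?A s \<partial>lborel) = (\<integral>r. (tpow (1 - 2 * \<alpha>) (r - t) * ?B) * w r \<partial>lborel)"
    proof (rule integral_convolve[OF _ _ _ _ _ _ intR])
      show "has_bochner_integral lborel (\<lambda>s. tpow (-\<alpha>) (s - t) * tpow (-\<alpha>) (r - s)) (tpow (1 - 2 * \<alpha>) (r - t) * ?B)" if "r \<noteq> t" for r
        using hbB[of t r] that by auto
    qed auto
    finally show ?thesis using \<alpha>_lt by (simp add: frac_integral_right_def set_lebesgue_integral_def)
  qed
  have "flux T \<alpha> ?u t = 1 / ?G * (1 / ?G * ((\<integral>r. (tpow (1 - 2 * \<alpha>) (t - r) * ?B) * w r \<partial>lborel) + (\<integral>r. (tpow (1 - 2 * \<alpha>) (r - t) * ?B) * w r \<partial>lborel)))"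
    unfolding flux_def L R by (simp add: algebra_simps add_divide_distrib)
  also have "(\<integral>r. (tpow (1 - 2 * \<alpha>) (t - r) * ?B) * w r \<partial>lborel) + (\<integral>r. (tpow (1 - 2 * \<alpha>) (r - t) * ?B) * w r \<partial>lborel) 
    = (\<integral>r. (tpow (1 - 2 * \<alpha>) (t - r) * ?B) * w r + (tpow (1 - 2 * \<alpha>) (r - t) * ?B) * w r \<partial>lborel)"
    by (rule Bochner_Integration.integral_add[OF intL intR, symmetric])
  also have "\<dots> = (\<integral>r. ?B * (K t r * w r) \<partial>lborel)"
  proof (rule Bochner_Integration.integral_cong[OF refl])
    fix r
    have "tpow (1 - 2 * \<alpha>) (t - r) + tpow (1 - 2 * \<alpha>) (r - t) = K t r"
      by (auto simp: tpow_def K_def)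
    then show "(tpow (1 - 2 * \<alpha>) (t - r) * ?B) * w r + (tpow (1 - 2 * \<alpha>) (r - t) * ?B) * w r = ?B * (K t r * w r)"
      by (metis (no_types, opaque_lifting) distrib_right mult.assoc mult.commute)
  qed
  also have "\<dots> = ?B * (\<integral>r. K t r * w r \<partial>lborel)" by simp
  also have "1 / ?G * (1 / ?G * (?B * (\<integral>r. K t r * w r \<partial>lborel))) = potential P t"
  proof -
    have "?G > 0" using \<alpha>_lt by (intro Gamma_real_pos) auto
    then have "?G \<noteq> 0" by (rule less_imp_neq[symmetric])
    have "(1 - \<alpha>) + (1 - \<alpha>) = 2 - 2 * \<alpha>" by simp
    then have "?B = ?G * ?G / Gamma (2 - 2 * \<alpha>)" by (simp only: Beta_def)
    then show ?thesis using \<open>?G \<noteq> 0\<close> by (simp add: potential_def w_def)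
  qed
  finally show ?thesis .
qed

end

section \<open>Approximation by polynomials\<close>

text \<open>Agreement is asked only on the open interval, since derivatives and Caputo derivatives
  may take arbitrary values at the endpoints.\<close>

lemma lebesgue_on_transfer:
  fixes F G :: "real \<Rightarrow> real"
  assumes [measurable]: "G \<in> borel_measurable borel" and eq: "\<And>x. x \<in> {0<..<T} \<Longrightarrow> F x = G x"
  shows "(LINT x|lebesgue_on {0..T}. F x) = (\<integral>x. indicator {0<..<T} x * G x \<partial>lborel)"
    and "F \<in> borel_measurable (lebesgue_on {0..T})"
    and "integrable lborel (\<lambda>x. indicator {0<..<T} x * G x) \<Longrightarrow> integrable (lebesgue_on {0..T}) F"
proof -
  have m: "(\<lambda>x. indicator {0<..<T} x * G x) \<in> borel_measurable borel" by measurable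
  have AE: "AE x in lborel. indicator {0..T} x *\<^sub>R F x = indicator {0<..<T} x * G x"
    using AE_lborel_singleton[of 0] AE_lborel_singleton[of T]
    by eventually_elim (use eq in \<open>auto simp: indicator_def\<close>)
  note i = integral_lebesgue_eq_lborel[OF m AE]
  have S: "{0..T} \<inter> space lebesgue \<in> sets lebesgue" by simp
  show "(LINT x|lebesgue_on {0..T}. F x) = (\<integral>x. indicator {0<..<T} x * G x \<partial>lborel)"
    unfolding integral_restrict_space[OF S] by (rule i(1))
  show "F \<in> borel_measurable (lebesgue_on {0..T})"
    unfolding borel_measurable_restrict_space_iff[OF S] by (rule i(2))
  show "integrable (lebesgue_on {0..T}) F" if "integrable lborel (\<lambda>x. indicator {0<..<T} x * G x)"
    unfolding integrable_restrict_space[OF S] by (rule i(3)[OF that])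
qed

lemma real_polynomial_antiderivative:
  assumes "real_polynomial_function q"
  obtains p :: "real poly" where "poly p 0 = 0" "\<And>x. (poly p has_real_derivative q x) (at x)"
proof -
  obtain a n where a: "q = (\<lambda>x. \<Sum>i\<le>n. a i * x ^ i)"
    using assms unfolding real_polynomial_function_iff_sum by auto
  define p where "p = (\<Sum>i\<le>n. monom (a i / (1 + real i)) (Suc i))"
  have p: "poly p x = (\<Sum>i\<le>n. a i / (1 + real i) * x ^ Suc i)" for x
    by (simp add: p_def poly_sum poly_monom)
  have "(poly p has_real_derivative q x) (at x)" for x
    unfolding p[abs_def] a by (rule has_real_derivative_antiderivative_sum)
  moreover have "poly p 0 = 0" by (simp add: p)
  ultimately show ?thesis by (rule that[rotated])
qed

lemma smooth_on_interval_poly: "smooth_on_interval T (poly p)"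
  unfolding smooth_on_interval_def
proof (intro exI conjI allI ballI)
  show "poly ((pderiv ^^ 0) p) = poly p" by simp
  show "(poly ((pderiv ^^ n) p) has_real_derivative poly ((pderiv ^^ Suc n) p) t) (at t within {0..T})" for n t
    using DERIV_subset[OF poly_DERIV] by simp
qed

lemma integrable_indicator_continuous:
  fixes f :: "real \<Rightarrow> real"
  assumes "continuous_on UNIV f"
  shows "integrable lborel (\<lambda>x. indicator {a<..<b} x * f x)"
    and "(\<integral>x. indicator {a<..<b} x * f x \<partial>lborel) = integral {a..b} f"
proof -
  have "set_integrable lborel {a..b} f"
    by (rule borel_integrable_atLeastAtMost') (rule continuous_on_subset[OF assms], simp)
  then have s: "set_integrable lborel {a<..<b} f" by (rule set_integrable_subset) auto
  then show "integrable lborel (\<lambda>x. indicator {a<..<b} x * f x)" by (simp add: set_integrable_def)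
  show "(\<integral>x. indicator {a<..<b} x * f x \<partial>lborel) = integral {a..b} f"
    using set_borel_integral_eq_integral(2)[OF s]
    by (simp add: set_lebesgue_integral_def integral_open_interval_real)
qed

text \<open>Splitting the kernel as sqrt k * sqrt k, Cauchy-Schwarz bounds the square of the
  transform by the row integral times the integral of k d^2; integrating in s and exchanging the
  integrals brings in the column integral.\<close>

lemma schur_test:
  fixes k :: "real \<Rightarrow> real \<Rightarrow> real" and d :: "real \<Rightarrow> real"
  assumes k[measurable]: "(\<lambda>z. k (fst z) (snd z)) \<in> borel_measurable (borel \<Otimes>\<^sub>M borel)"
    and [measurable]: "d \<in> borel_measurable borel"
    and nn: "\<And>s r. 0 \<le> k s r"
    and row: "\<And>s. integrable lborel (k s)" "\<And>s. (\<integral>r. k s r \<partial>lborel) \<le> c"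
    and col: "\<And>r. integrable lborel (\<lambda>s. k s r)" "\<And>r. (\<integral>s. k s r \<partial>lborel) \<le> c"
    and d: "integrable lborel (\<lambda>r. (d r)\<^sup>2)"
  shows "AE s in lborel. integrable lborel (\<lambda>r. k s r * d r)"
    and "integrable lborel (\<lambda>s. (\<integral>r. k s r * d r \<partial>lborel)\<^sup>2)"
    and "(\<integral>s. (\<integral>r. k s r * d r \<partial>lborel)\<^sup>2 \<partial>lborel) \<le> c\<^sup>2 * (\<integral>r. (d r)\<^sup>2 \<partial>lborel)"
proof -
  have "0 \<le> (\<integral>s. k s 0 \<partial>lborel)" by (rule integral_nonneg_AE) (simp add: nn)
  then have c: "0 \<le> c" using col(2)[of 0] by (rule order_trans)
  have "(\<lambda>z. (\<lambda>z. k (fst z) (snd z)) (snd z, fst z)) \<in> borel_measurable (borel \<Otimes>\<^sub>M borel)"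
    by (rule measurable_compose[OF _ k]) measurable
  then have k'[measurable]: "(\<lambda>z. k (snd z) (fst z)) \<in> borel_measurable (borel \<Otimes>\<^sub>M borel)" by simp
  have [measurable]: "(\<lambda>(s, r). k s r) \<in> borel_measurable (borel \<Otimes>\<^sub>M borel)" using k by (simp add: case_prod_beta')
  have [measurable]: "(\<lambda>(r, s). k s r) \<in> borel_measurable (borel \<Otimes>\<^sub>M borel)" using k' by (simp add: case_prod_beta')
  have col_bound: "(d r)\<^sup>2 * (\<integral>s. k s r \<partial>lborel) \<le> c * (d r)\<^sup>2" for r
    using mult_left_mono[OF col(2)[of r], of "(d r)\<^sup>2"] by (simp add: mult.commute)
  have nn': "0 \<le> (\<integral>s. k s r \<partial>lborel)" for r using nn by (simp add: integral_nonneg_AE)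
  have int: "integrable lborel (\<lambda>r. (d r)\<^sup>2 * (\<integral>s. k s r \<partial>lborel))"
    by (rule Bochner_Integration.integrable_bound[OF integrable_mult_right[OF d, of c]])
       (use col_bound nn' c in \<open>auto simp: abs_mult\<close>)
  have F: "integrable (lborel \<Otimes>\<^sub>M lborel) (\<lambda>(r, s). (d r)\<^sup>2 * k s r)"
  proof (rule lborel_pair.Fubini_integrable)
    show "integrable lborel (\<lambda>r. \<integral>s. norm ((\<lambda>(r, s). (d r)\<^sup>2 * k s r) (r, s)) \<partial>lborel)"
      using int nn by (simp add: abs_mult)
    show "AE r in lborel. integrable lborel (\<lambda>s. (\<lambda>(r, s). (d r)\<^sup>2 * k s r) (r, s))"
      using col(1) by simp
  qed measurable
  have AE: "AE s in lborel. integrable lborel (\<lambda>r. (d r)\<^sup>2 * k s r)"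
    using lborel_pair.AE_integrable_snd[OF F] .
  have kd: "integrable lborel (\<lambda>r. k s r * d r)" if "integrable lborel (\<lambda>r. (d r)\<^sup>2 * k s r)" for s
  proof (rule Bochner_Integration.integrable_bound[OF Bochner_Integration.integrable_add[OF row(1)[of s] that]])
    have "\<bar>k s r * d r\<bar> \<le> k s r + (d r)\<^sup>2 * k s r" for r
    proof -
      \<comment> \<open>This dominates k |d| by k + k d^2. The first term is integrable by the row
        condition and the second, for almost every s, by Fubini.\<close>
      have "\<bar>d r\<bar> \<le> 1 + (d r)\<^sup>2"
      proof -
        have "0 \<le> (\<bar>d r\<bar> - 1/2)\<^sup>2" by simp
        then show ?thesis by (simp add: power2_diff) (simp add: power2_eq_square)
      qed
      then have "k s r * \<bar>d r\<bar> \<le> k s r * (1 + (d r)\<^sup>2)" using nn by (rule mult_left_mono)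
      then show ?thesis using nn[of s r] by (simp add: abs_mult algebra_simps)
    qed
    then show "AE r in lborel. norm (k s r * d r) \<le> norm (k s r + (d r)\<^sup>2 * k s r)"
      using nn by (intro AE_I2) (auto intro!: order_trans[OF _ abs_ge_self])
  qed measurable
  show "AE s in lborel. integrable lborel (\<lambda>r. k s r * d r)"
    using AE by eventually_elim (rule kd)
  have bound: "(\<integral>r. k s r * d r \<partial>lborel)\<^sup>2 \<le> c * (\<integral>r. (d r)\<^sup>2 * k s r \<partial>lborel)"
    if i: "integrable lborel (\<lambda>r. (d r)\<^sup>2 * k s r)" for s
  proof -
    have eq: "sqrt (k s r) * (sqrt (k s r) * d r) = k s r * d r" "(sqrt (k s r))\<^sup>2 = k s r" "(sqrt (k s r) * d r)\<^sup>2 = (d r)\<^sup>2 * k s r" for r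
      using nn[of s r] by (simp_all add: power_mult_distrib mult.assoc[symmetric])
    have "(\<integral>r. k s r * d r \<partial>lborel)\<^sup>2 \<le> (\<integral>r. k s r \<partial>lborel) * (\<integral>r. (d r)\<^sup>2 * k s r \<partial>lborel)"
      using Cauchy_Schwarz_integral[of lborel "\<lambda>r. sqrt (k s r)" "\<lambda>r. sqrt (k s r) * d r"] row(1)[of s] i kd[OF i]
      unfolding eq by simp
    also have "\<dots> \<le> c * (\<integral>r. (d r)\<^sup>2 * k s r \<partial>lborel)"
      by (intro mult_right_mono row(2) integral_nonneg_AE) (use nn in auto)
    finally show ?thesis .
  qed
  have snd: "integrable lborel (\<lambda>s. c * (\<integral>r. (d r)\<^sup>2 * k s r \<partial>lborel))"
    using lborel_pair.integrable_snd[OF F] by simp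
  have AEb: "AE s in lborel. (\<integral>r. k s r * d r \<partial>lborel)\<^sup>2 \<le> c * (\<integral>r. (d r)\<^sup>2 * k s r \<partial>lborel)"
    using AE by eventually_elim (rule bound)
  show sq: "integrable lborel (\<lambda>s. (\<integral>r. k s r * d r \<partial>lborel)\<^sup>2)"
    apply (rule Bochner_Integration.integrable_bound[OF snd])
    subgoal by measurable
    subgoal using AEb by eventually_elim (auto intro: order_trans[OF _ abs_ge_self])
    done
  have "(\<integral>s. (\<integral>r. k s r * d r \<partial>lborel)\<^sup>2 \<partial>lborel) \<le> (\<integral>s. c * (\<integral>r. (d r)\<^sup>2 * k s r \<partial>lborel) \<partial>lborel)"
    by (rule integral_mono_AE[OF sq snd AEb])
  also have "\<dots> = c * (\<integral>r. (\<integral>s. (d r)\<^sup>2 * k s r \<partial>lborel) \<partial>lborel)"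
    using lborel_pair.Fubini_integral[OF F] by simp
  also have "\<dots> \<le> c * (\<integral>r. c * (d r)\<^sup>2 \<partial>lborel)"
    by (intro mult_left_mono integral_mono c) (use int d col_bound in auto)
  finally show "(\<integral>s. (\<integral>r. k s r * d r \<partial>lborel)\<^sup>2 \<partial>lborel) \<le> c\<^sup>2 * (\<integral>r. (d r)\<^sup>2 \<partial>lborel)"
    by (simp add: power2_eq_square mult.assoc)
qed

context weighted_interval begin

text \<open>For \<alpha> < 1 the weight is unbounded, so it is regularised before Weierstrass
  approximation, and dominated convergence controls the error in L2. Subtracting the mean of the
  polynomial does not increase the error, because the target has mean zero and the subtraction is an
  orthogonal projection.\<close>

lemma weighted_polynomial_approx:
  assumes P: "continuous_on UNIV P" and P0: "(\<integral>y. weight T \<alpha> y * P y \<partial>lborel) = 0"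
  obtains q where "\<And>n. real_polynomial_function (q n)" "\<And>n. integral {0..T} (q n) = 0"
    "(\<lambda>n. \<integral>x. (indicator {0<..<T} x * q n x - weight T \<alpha> x * P x)\<^sup>2 \<partial>lborel) \<longlonglongrightarrow> 0"
proof -
  let ?I = "\<lambda>x. indicator {0<..<T} x :: real" and ?e = "\<lambda>n. inverse (real (Suc n))"
  let ?w = "\<lambda>x. weight T \<alpha> x * P x"
  have [measurable]: "P \<in> borel_measurable borel" using P by (rule borel_measurable_continuous_onI)
  obtain b where b: "b > 0" "\<And>y. y \<in> {0..T} \<Longrightarrow> \<bar>P y\<bar> \<le> b"
    using bounded_on_interval[OF P] by blast
  \<comment> \<open>Both distances to the endpoints are shifted by 1/(n+1). As \<alpha> \<le> 1,
    this stays below the weight, which therefore serves as dominating function.\<close>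
  define r where "r n x = (max 0 x + ?e n) powr (\<alpha> - 1) * (max 0 (T - x) + ?e n) powr (\<alpha> - 1)" for n x
  have epos: "0 < ?e n" for n by simp
  have rc: "continuous_on UNIV (\<lambda>x. r n x * P x)" for n
    unfolding r_def using epos[of n] 
    by (intro continuous_intros P) (auto simp: add_nonneg_pos less_imp_neq[symmetric] simp del: inverse_positive_iff_positive)
  have r_le: "0 \<le> r n x" "r n x \<le> weight T \<alpha> x" if "x \<in> {0<..<T}" for n x
    using that \<alpha>_le by (auto simp: r_def weight_def tpow_def intro!: mult_mono powr_mono2')
  have e0: "?e \<longlonglongrightarrow> 0" by (rule LIMSEQ_inverse_real_of_nat)
  have r_lim: "(\<lambda>n. r n x) \<longlonglongrightarrow> weight T \<alpha> x" if "x \<in> {0<..<T}" for x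
  proof -
    have "(\<lambda>n. r n x) \<longlonglongrightarrow> (max 0 x + 0) powr (\<alpha> - 1) * (max 0 (T - x) + 0) powr (\<alpha> - 1)"
      unfolding r_def using that by (intro tendsto_intros e0) auto
    then show ?thesis using that by (simp add: weight_def tpow_def)
  qed
  define E where "E n = (\<integral>x. ?I x * (r n x * P x - ?w x)\<^sup>2 \<partial>lborel)" for n
  have [measurable]: "(\<lambda>x. r n x * P x) \<in> borel_measurable borel" for n
    using rc by (rule borel_measurable_continuous_onI)
  have dom: "norm (?I x * (r n x * P x - ?w x)\<^sup>2) \<le> (weight T \<alpha> x)\<^sup>2 * b\<^sup>2" for n x
  proof (cases "x \<in> {0<..<T}")
    case True
    have "\<bar>r n x * P x - ?w x\<bar> = \<bar>r n x - weight T \<alpha> x\<bar> * \<bar>P x\<bar>" by (simp add: abs_mult[symmetric] algebra_simps)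
    also have "\<dots> \<le> weight T \<alpha> x * b" using r_le[OF True, of n] b(2)[of x] True by (intro mult_mono) auto
    finally have "\<bar>r n x * P x - ?w x\<bar>\<^sup>2 \<le> (weight T \<alpha> x * b)\<^sup>2" by (rule power_mono) simp
    then show ?thesis using True by (simp add: power_mult_distrib)
  qed simp
  have domi: "integrable lborel (\<lambda>x. (weight T \<alpha> x)\<^sup>2 * b\<^sup>2)" by (intro integrable_mult_left integrable_weight_square)
  have "E \<longlonglongrightarrow> (\<integral>x. (\<lambda>_::real. 0) x \<partial>lborel)"
    unfolding E_def[abs_def]
  proof (rule integral_dominated_convergence[where w = "\<lambda>x. (weight T \<alpha> x)\<^sup>2 * b\<^sup>2"])
    show "AE x in lborel. (\<lambda>n. ?I x * (r n x * P x - ?w x)\<^sup>2) \<longlonglongrightarrow> 0"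
    proof (rule AE_I2)
      fix x
      show "(\<lambda>n. ?I x * (r n x * P x - ?w x)\<^sup>2) \<longlonglongrightarrow> 0"
      proof (cases "x \<in> {0<..<T}")
        case True
        have "(\<lambda>n. ?I x * (r n x * P x - ?w x)\<^sup>2) \<longlonglongrightarrow> ?I x * (weight T \<alpha> x * P x - ?w x)\<^sup>2"
          by (intro tendsto_intros r_lim True)
        then show ?thesis by simp
      qed simp
    qed
    show "AE x in lborel. norm (?I x * (r n x * P x - ?w x)\<^sup>2) \<le> (weight T \<alpha> x)\<^sup>2 * b\<^sup>2" for n
      using dom by (intro AE_I2)
    show "integrable lborel (\<lambda>x. (weight T \<alpha> x)\<^sup>2 * b\<^sup>2)" by (rule domi)
  qed measurable
  then have E0: "E \<longlonglongrightarrow> 0" by simp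
  have Eint: "integrable lborel (\<lambda>x. ?I x * (r n x * P x - ?w x)\<^sup>2)" for n
    by (rule Bochner_Integration.integrable_bound[OF domi]) (use dom order_trans[OF _ abs_ge_self] in \<open>auto\<close>)
  have "\<exists>q. real_polynomial_function q \<and> (\<forall>x\<in>{0..T}. \<bar>r n x * P x - q x\<bar> \<le> ?e n)" for n
    using Stone_Weierstrass_real_polynomial_function[of "{0..T}" "\<lambda>x. r n x * P x" "?e n"] continuous_on_subset[OF rc[of n], of "{0..T}"]
    by (metis compact_Icc less_eq_real_def inverse_positive_iff_positive of_nat_0_less_iff zero_less_Suc subset_UNIV)
  then obtain q' where q': "\<And>n. real_polynomial_function (q' n)" "\<And>n x. x \<in> {0..T} \<Longrightarrow> \<bar>r n x * P x - q' n x\<bar> \<le> ?e n"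
    by metis
  have q'c: "continuous_on S (q' n)" for n S
    using continuous_real_polymonial_function[OF q'(1)] continuous_on_subset[of UNIV "q' n" S]
    by (simp add: continuous_on_eq_continuous_at)
  have [measurable]: "q' n \<in> borel_measurable borel" for n using q'c by (rule borel_measurable_continuous_onI)
  define m where "m n = integral {0..T} (q' n) / T" for n
  define q where "q n x = q' n x - m n" for n x
  have q: "real_polynomial_function (q n)" for n
    unfolding q_def[abs_def] by (intro real_polynomial_function_diff q' real_polynomial_function.intros(2))
  have qint: "integral {0..T} (q n) = 0" for n
  proof -
    have "integral {0..T} (q n) = integral {0..T} (q' n) - integral {0..T} (\<lambda>_. m n)"
      unfolding q_def by (rule integral_diff) (auto intro!: integrable_continuous_real q'c)
    then show ?thesis using T_pos by (simp add: m_def)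
  qed
  have bound: "(\<integral>x. (?I x * q n x - ?w x)\<^sup>2 \<partial>lborel) \<le> 2 * T * (?e n)\<^sup>2 + 2 * E n" for n
  proof -
    let ?d = "\<lambda>x. ?I x * q' n x - ?w x"
    have Iq: "integrable lborel (\<lambda>x. ?I x * q' n x)" "(\<integral>x. ?I x * q' n x \<partial>lborel) = T * m n"
      using integrable_indicator_continuous[OF q'c, of 0 T] T_pos by (simp_all add: m_def)
    have d1: "integrable lborel ?d" by (intro Bochner_Integration.integrable_diff Iq integrable_weighted P)
    have d1v: "(\<integral>x. ?d x \<partial>lborel) = T * m n"
      using Iq integrable_weighted[OF P] P0 by simp
    have I: "integrable lborel ?I" "(\<integral>x. ?I x \<partial>lborel) = T"
      using T_pos by (auto intro!: integrable_real_indicator)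
    have d2b: "(?d x)\<^sup>2 \<le> 2 * (?e n)\<^sup>2 * ?I x + 2 * (?I x * (r n x * P x - ?w x)\<^sup>2)" for x
    proof (cases "x \<in> {0<..<T}")
      case True
      have "\<bar>r n x * P x - q' n x\<bar>\<^sup>2 \<le> (?e n)\<^sup>2" using q'(2)[of x n] True by (intro power_mono) auto
      then have 1: "(q' n x - r n x * P x)\<^sup>2 \<le> (?e n)\<^sup>2" by (simp add: power2_commute)
      have "(A + B)\<^sup>2 \<le> 2 * A\<^sup>2 + 2 * B\<^sup>2" for A B :: real
        using sum_squares_bound[of A B] by (simp add: power2_sum)
      from this[of "q' n x - r n x * P x" "r n x * P x - ?w x"] 1
      show ?thesis using True by simp
    qed (simp add: weight_eq_0)
    have d2i: "integrable lborel (\<lambda>x. 2 * (?e n)\<^sup>2 * ?I x + 2 * (?I x * (r n x * P x - ?w x)\<^sup>2))"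
      by (intro Bochner_Integration.integrable_add integrable_mult_right I Eint)
    have d2: "integrable lborel (\<lambda>x. (?d x)\<^sup>2)"
      by (rule Bochner_Integration.integrable_bound[OF d2i]) (use d2b order_trans[OF _ abs_ge_self] in auto)
    have "(?I x * q n x - ?w x)\<^sup>2 = (?d x)\<^sup>2 - 2 * m n * ?d x + (m n)\<^sup>2 * ?I x" for x
      by (cases "x \<in> {0<..<T}") (auto simp: q_def weight_eq_0 power2_eq_square algebra_simps)
    then have "(\<integral>x. (?I x * q n x - ?w x)\<^sup>2 \<partial>lborel) = (\<integral>x. (?d x)\<^sup>2 - 2 * m n * ?d x + (m n)\<^sup>2 * ?I x \<partial>lborel)"
      by simp
    also have "\<dots> = (\<integral>x. (?d x)\<^sup>2 - 2 * m n * ?d x \<partial>lborel) + (\<integral>x. (m n)\<^sup>2 * ?I x \<partial>lborel)"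
      by (intro Bochner_Integration.integral_add Bochner_Integration.integrable_diff integrable_mult_right d1 d2 I)
    also have "\<dots> = (\<integral>x. (?d x)\<^sup>2 \<partial>lborel) - (\<integral>x. 2 * m n * ?d x \<partial>lborel) + (\<integral>x. (m n)\<^sup>2 * ?I x \<partial>lborel)"
      by (subst Bochner_Integration.integral_diff) (auto intro: d1 d2)
    also have "\<dots> = (\<integral>x. (?d x)\<^sup>2 \<partial>lborel) - 2 * m n * (T * m n) + (m n)\<^sup>2 * T"
      unfolding integral_mult_right_zero d1v I(2) ..
    \<comment> \<open>The two correction terms add up to -T (m n)^2.\<close>
    also have "\<dots> \<le> (\<integral>x. (?d x)\<^sup>2 \<partial>lborel)"
    proof -
      have "0 \<le> T * (m n)\<^sup>2" using T_pos by simp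
      then show ?thesis by (simp add: power2_eq_square algebra_simps)
    qed
    also have "\<dots> \<le> (\<integral>x. 2 * (?e n)\<^sup>2 * ?I x + 2 * (?I x * (r n x * P x - ?w x)\<^sup>2) \<partial>lborel)"
      by (rule integral_mono[OF d2 d2i d2b])
    also have "\<dots> = (\<integral>x. 2 * (?e n)\<^sup>2 * ?I x \<partial>lborel) + (\<integral>x. 2 * (?I x * (r n x * P x - ?w x)\<^sup>2) \<partial>lborel)"
      by (intro Bochner_Integration.integral_add integrable_mult_right I Eint)
    also have "\<dots> = 2 * (?e n)\<^sup>2 * T + 2 * E n"
      unfolding integral_mult_right_zero I(2) E_def ..
    finally show ?thesis by (simp add: mult_ac)
  qed
  have "(\<lambda>n. \<integral>x. (?I x * q n x - ?w x)\<^sup>2 \<partial>lborel) \<longlonglongrightarrow> 0"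
  proof (rule tendsto_sandwich[of "\<lambda>_. 0"])
    have "(\<lambda>n. 2 * T * (?e n)\<^sup>2 + 2 * E n) \<longlonglongrightarrow> 2 * T * 0\<^sup>2 + 2 * 0"
      by (intro tendsto_intros e0 E0)
    then show "(\<lambda>n. 2 * T * (?e n)\<^sup>2 + 2 * E n) \<longlonglongrightarrow> 0" by simp
  qed (use bound in \<open>auto intro!: always_eventually integral_nonneg_AE\<close>)
  with q qint show thesis by (rule that)
qed

end

section \<open>Membership in the energy space\<close>

context weighted_interval begin

text \<open>Acts on the derivative instead of the function, so that a Borel representative of the
  derivative can be inserted. The branch for \<alpha> = 1 is the identity, which lets membership be
  proved once for all \<alpha>.\<close>

definition caputo_op :: "(real \<Rightarrow> real) \<Rightarrow> real \<Rightarrow> real" where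
  "caputo_op d s = (if \<alpha> = 1 then d s else 1 / Gamma (1 - \<alpha>) * (\<integral>r. tpow (-\<alpha>) (s - r) * d r \<partial>lborel))"

lemma measurable_caputo_op:
  assumes [measurable]: "d \<in> borel_measurable borel"
  shows "caputo_op d \<in> borel_measurable borel"
  unfolding caputo_op_def[abs_def] by measurable

lemma caputo_left_eq_op:
  assumes w: "w \<in> borel_measurable borel"
    and dw: "\<And>r. r \<in> {0<..<T} \<Longrightarrow> deriv u r = w r" and w0: "\<And>r. r \<notin> {0<..<T} \<Longrightarrow> w r = 0"
    and s: "s \<in> {0<..<T}"
  shows "caputo_left \<alpha> u s = caputo_op w s"
proof (cases "\<alpha> = 1")
  case True
  then show ?thesis unfolding caputo_left_def caputo_op_def using dw[OF s] by simp
next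
  case False
  then have "\<alpha> < 1" using \<alpha>_le by simp
  from caputo_left_eq[where T = T, OF this w dw w0 s] False show ?thesis
    by (simp add: caputo_op_def)
qed

text \<open>Cut off to the square (0,T) x (0,T), where row and column integrals are both at most
  T^(1-\<alpha>) Beta(1, 1-\<alpha>), as the Schur test demands.\<close>

definition caputo_kernel :: "real \<Rightarrow> real \<Rightarrow> real" where
  "caputo_kernel s r = indicator {0<..<T} s * (indicator {0<..<T} r * tpow (-\<alpha>) (s - r))"

definition C\<^sub>4 :: real where "C\<^sub>4 = T powr (1 - \<alpha>) * Beta 1 (1 - \<alpha>)"

lemma caputo_kernel_row:
  assumes "\<alpha> < 1"
  shows "integrable lborel (caputo_kernel s)" "(\<integral>r. caputo_kernel s r \<partial>lborel) \<le> C\<^sub>4"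
    and "integrable lborel (\<lambda>s. caputo_kernel s r)" "(\<integral>s. caputo_kernel s r \<partial>lborel) \<le> C\<^sub>4"
proof -
  have B: "Beta 1 (1 - \<alpha>) \<ge> 0" "Beta (1 - \<alpha>) 1 = Beta 1 (1 - \<alpha>)"
    using assms by (auto simp: Beta_def intro!: divide_nonneg_nonneg mult_nonneg_nonneg Gamma_real_nonneg simp: add.commute)
  have C: "0 \<le> C\<^sub>4" "0 < z \<Longrightarrow> z \<le> T \<Longrightarrow> z powr (1 - \<alpha>) * Beta 1 (1 - \<alpha>) \<le> C\<^sub>4" for z
    unfolding C\<^sub>4_def using B assms by (auto intro!: mult_right_mono powr_mono2)
  have "integrable lborel (caputo_kernel s) \<and> (\<integral>r. caputo_kernel s r \<partial>lborel) \<le> C\<^sub>4"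
  proof (cases "s \<in> {0<..<T}")
    case True
    then have "caputo_kernel s = (\<lambda>r. tpow (1 - 1) (r - 0) * tpow ((1 - \<alpha>) - 1) (s - r))"
      by (auto simp: caputo_kernel_def tpow_def indicator_def)
    moreover have "has_bochner_integral lborel (\<lambda>r. tpow (1 - 1) (r - 0) * tpow ((1 - \<alpha>) - 1) (s - r)) 
       ((s - 0) powr (1 + (1 - \<alpha>) - 1) * Beta 1 (1 - \<alpha>))"
      by (rule has_bochner_integral_Beta) (use True assms in auto)
    ultimately show ?thesis using C(2)[of s] True by (simp add: has_bochner_integral_iff)
  next
    case False
    then have "caputo_kernel s = (\<lambda>r. 0)" by (auto simp: caputo_kernel_def)
    then show ?thesis using C(1) by simp
  qed
  then show "integrable lborel (caputo_kernel s)" "(\<integral>r. caputo_kernel s r \<partial>lborel) \<le> C\<^sub>4" by auto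
  have "integrable lborel (\<lambda>s. caputo_kernel s r) \<and> (\<integral>s. caputo_kernel s r \<partial>lborel) \<le> C\<^sub>4"
  proof (cases "r \<in> {0<..<T}")
    case True
    then have "(\<lambda>s. caputo_kernel s r) = (\<lambda>s. tpow ((1 - \<alpha>) - 1) (s - r) * tpow (1 - 1) (T - s))"
      by (auto simp: caputo_kernel_def tpow_def indicator_def)
    moreover have "has_bochner_integral lborel (\<lambda>s. tpow ((1 - \<alpha>) - 1) (s - r) * tpow (1 - 1) (T - s)) 
       ((T - r) powr ((1 - \<alpha>) + 1 - 1) * Beta (1 - \<alpha>) 1)"
      by (rule has_bochner_integral_Beta) (use True assms in auto)
    ultimately show ?thesis using C(2)[of "T - r"] True B(2) by (simp add: has_bochner_integral_iff)
  next
    case False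
    then have "(\<lambda>s. caputo_kernel s r) = (\<lambda>s. 0)" by (auto simp: caputo_kernel_def)
    then show ?thesis using C(1) by simp
  qed
  then show "integrable lborel (\<lambda>s. caputo_kernel s r)" "(\<integral>s. caputo_kernel s r \<partial>lborel) \<le> C\<^sub>4" by auto
qed

definition C\<^sub>5 :: real where "C\<^sub>5 = (if \<alpha> = 1 then 1 else (1 / Gamma (1 - \<alpha>))\<^sup>2 * C\<^sub>4\<^sup>2)"

lemma measurable_caputo_kernel: 
  "(\<lambda>z. caputo_kernel (fst z) (snd z)) \<in> borel_measurable (borel \<Otimes>\<^sub>M borel)"
  unfolding caputo_kernel_def by measurable

lemma caputo_kernel_nonneg: "0 \<le> caputo_kernel s r" 
  by (simp add: caputo_kernel_def)

lemma caputo_op_kernel: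
  assumes "\<alpha> < 1" "\<And>x. x \<notin> {0<..<T} \<Longrightarrow> d x = 0"
  shows "indicator {0<..<T} s * caputo_op d s = 1 / Gamma (1 - \<alpha>) * (\<integral>r. caputo_kernel s r * d r \<partial>lborel)"
    and "indicator {0<..<T} s * (caputo_op d s)\<^sup>2 = (1 / Gamma (1 - \<alpha>))\<^sup>2 * (\<integral>r. caputo_kernel s r * d r \<partial>lborel)\<^sup>2" 
proof -
  have k: "caputo_kernel s r * d r = indicator {0<..<T} s * (tpow (-\<alpha>) (s - r) * d r)" for r
    using assms(2)[of r] by (auto simp: caputo_kernel_def indicator_def)
  show op: "indicator {0<..<T} s * caputo_op d s = 1 / Gamma (1 - \<alpha>) * (\<integral>r. caputo_kernel s r * d r \<partial>lborel)"
    unfolding k using assms(1) by (simp add: caputo_op_def)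
  have "indicator {0<..<T} s * (caputo_op d s)\<^sup>2 = (indicator {0<..<T} s * caputo_op d s)\<^sup>2"
    by (simp add: indicator_def)
  then show "indicator {0<..<T} s * (caputo_op d s)\<^sup>2 = (1 / Gamma (1 - \<alpha>))\<^sup>2 * (\<integral>r. caputo_kernel s r * d r \<partial>lborel)\<^sup>2"
    unfolding op by (simp only: power_mult_distrib)
qed

lemma caputo_op_L2_bound:
  assumes d: "d \<in> borel_measurable borel" "\<And>x. x \<notin> {0<..<T} \<Longrightarrow> d x = 0" "integrable lborel (\<lambda>x. (d x)\<^sup>2)"
  shows "integrable lborel (\<lambda>s. indicator {0<..<T} s * (caputo_op d s)\<^sup>2)"
    and "(\<integral>s. indicator {0<..<T} s * (caputo_op d s)\<^sup>2 \<partial>lborel) \<le> C\<^sub>5 * (\<integral>x. (d x)\<^sup>2 \<partial>lborel)"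
proof -
  have "integrable lborel (\<lambda>s. indicator {0<..<T} s * (caputo_op d s)\<^sup>2) \<and>
    (\<integral>s. indicator {0<..<T} s * (caputo_op d s)\<^sup>2 \<partial>lborel) \<le> C\<^sub>5 * (\<integral>x. (d x)\<^sup>2 \<partial>lborel)"
  proof (cases "\<alpha> = 1")
    case True
    have "indicator {0<..<T} s * (caputo_op d s)\<^sup>2 = (d s)\<^sup>2" for s
      using d(2)[of s] unfolding caputo_op_def using True by (auto simp: indicator_def)
    moreover have "C\<^sub>5 = 1" unfolding C\<^sub>5_def using True by simp
    ultimately show ?thesis using d(3) by simp
  next
    case False
    then have \<alpha>1: "\<alpha> < 1" using \<alpha>_le by simp
    let ?G = "Gamma (1 - \<alpha>)"
    note s = schur_test[OF measurable_caputo_kernel d(1) caputo_kernel_nonneg caputo_kernel_row(1,2)[OF \<alpha>1] caputo_kernel_row(3,4)[OF \<alpha>1] d(3)]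
    have "integrable lborel (\<lambda>s. (1 / ?G)\<^sup>2 * (\<integral>r. caputo_kernel s r * d r \<partial>lborel)\<^sup>2)"
      by (rule integrable_mult_right[OF s(2)])
    moreover have "(\<integral>s. (1 / ?G)\<^sup>2 * (\<integral>r. caputo_kernel s r * d r \<partial>lborel)\<^sup>2 \<partial>lborel) \<le> (1 / ?G)\<^sup>2 * (C\<^sub>4\<^sup>2 * (\<integral>x. (d x)\<^sup>2 \<partial>lborel))"
      unfolding integral_mult_right_zero by (rule mult_left_mono[OF s(3)]) simp
    moreover have "C\<^sub>5 = (1 / ?G)\<^sup>2 * C\<^sub>4\<^sup>2" unfolding C\<^sub>5_def using False by simp
    moreover have "indicator {0<..<T} s * (caputo_op d s)\<^sup>2 = (1 / ?G)\<^sup>2 * (\<integral>r. caputo_kernel s r * d r \<partial>lborel)\<^sup>2" for s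
      by (rule caputo_op_kernel(2)[OF \<alpha>1]) (rule d(2))
    ultimately show ?thesis by (simp only: mult.assoc)
  qed
  then show "integrable lborel (\<lambda>s. indicator {0<..<T} s * (caputo_op d s)\<^sup>2)"
    and "(\<integral>s. indicator {0<..<T} s * (caputo_op d s)\<^sup>2 \<partial>lborel) \<le> C\<^sub>5 * (\<integral>x. (d x)\<^sup>2 \<partial>lborel)" by auto
qed

text \<open>Linearity of the Abel integral is available only where both integrals converge, since
  divergent ones have the default value 0. The Schur test gives convergence almost everywhere, which
  suffices for the L2 norms.\<close>

lemma caputo_op_L2_diff:
  assumes d: "d \<in> borel_measurable borel" "\<And>x. x \<notin> {0<..<T} \<Longrightarrow> d x = 0" "integrable lborel (\<lambda>x. (d x)\<^sup>2)"
    and e: "e \<in> borel_measurable borel" "\<And>x. x \<notin> {0<..<T} \<Longrightarrow> e x = 0" "integrable lborel (\<lambda>x. (e x)\<^sup>2)"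
  shows "(\<integral>s. indicator {0<..<T} s * (caputo_op d s - caputo_op e s)\<^sup>2 \<partial>lborel) =
      (\<integral>s. indicator {0<..<T} s * (caputo_op (\<lambda>x. d x - e x) s)\<^sup>2 \<partial>lborel)"
proof (cases "\<alpha> = 1")
  case True
  then show ?thesis unfolding caputo_op_def by simp
next
  case False
  then have \<alpha>1: "\<alpha> < 1" using \<alpha>_le by simp
  let ?G = "Gamma (1 - \<alpha>)"
    note [measurable] = d(1) e(1) measurable_caputo_op
    have de: "d x - e x = 0" if "x \<notin> {0<..<T}" for x using d(2)[OF that] e(2)[OF that] by simp
    have AE1: "AE s in lborel. integrable lborel (\<lambda>r. caputo_kernel s r * d r)"
      by (rule schur_test(1)[OF measurable_caputo_kernel d(1) caputo_kernel_nonneg caputo_kernel_row(1,2)[OF \<alpha>1] caputo_kernel_row(3,4)[OF \<alpha>1] d(3)])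
    have AE2: "AE s in lborel. integrable lborel (\<lambda>r. caputo_kernel s r * e r)"
      by (rule schur_test(1)[OF measurable_caputo_kernel e(1) caputo_kernel_nonneg caputo_kernel_row(1,2)[OF \<alpha>1] caputo_kernel_row(3,4)[OF \<alpha>1] e(3)])
    show "(\<integral>s. indicator {0<..<T} s * (caputo_op d s - caputo_op e s)\<^sup>2 \<partial>lborel) =
      (\<integral>s. indicator {0<..<T} s * (caputo_op (\<lambda>x. d x - e x) s)\<^sup>2 \<partial>lborel)"
    proof (rule integral_cong_AE)
      show "AE s in lborel. indicator {0<..<T} s * (caputo_op d s - caputo_op e s)\<^sup>2 = indicator {0<..<T} s * (caputo_op (\<lambda>x. d x - e x) s)\<^sup>2"
        using AE1 AE2
      proof eventually_elim
        case (elim s)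
        have "indicator {0<..<T} s * (caputo_op d s - caputo_op e s)\<^sup>2 = (indicator {0<..<T} s * caputo_op d s - indicator {0<..<T} s * caputo_op e s)\<^sup>2"
          by (simp add: indicator_def)
        also have "\<dots> = (1 / ?G * (\<integral>r. caputo_kernel s r * d r - caputo_kernel s r * e r \<partial>lborel))\<^sup>2"
        proof -
          have "indicator {0<..<T} s * caputo_op d s = 1 / ?G * (\<integral>r. caputo_kernel s r * d r \<partial>lborel)"
            by (rule caputo_op_kernel(1)[OF \<alpha>1]) (rule d(2))
          moreover have "indicator {0<..<T} s * caputo_op e s = 1 / ?G * (\<integral>r. caputo_kernel s r * e r \<partial>lborel)"
            by (rule caputo_op_kernel(1)[OF \<alpha>1]) (rule e(2))
          ultimately show ?thesis using elim by (simp add: diff_divide_distrib)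
        qed
        also have "\<dots> = (1 / ?G)\<^sup>2 * (\<integral>r. caputo_kernel s r * (d r - e r) \<partial>lborel)\<^sup>2"
          by (simp only: power_mult_distrib right_diff_distrib)
        also have "\<dots> = indicator {0<..<T} s * (caputo_op (\<lambda>x. d x - e x) s)\<^sup>2"
          by (rule caputo_op_kernel(2)[symmetric, OF \<alpha>1]) (rule de)
        finally show ?case .
      qed
    qed measurable
qed

text \<open>The approximating functions are antiderivatives of the mean-zero polynomials that
  approximate u' in L2; mean zero makes them vanish at T as well as at 0. The Schur bound gives
  convergence of the Caputo derivatives, Cauchy-Schwarz gives uniform convergence of the functions.
  The extended derivative is the actual \<open>caputo_left\<close> of the primitive.\<close>

lemma primitive_of_in_E_space:
  assumes P: "continuous_on UNIV P" and P0: "(\<integral>y. weight T \<alpha> y * P y \<partial>lborel) = 0"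
  shows "primitive_of P \<in> E_space T \<alpha>"
proof -
  let ?I = "\<lambda>x. indicator {0<..<T} x :: real"
  define w where "w x = weight T \<alpha> x * P x" for x
  let ?u = "primitive_of P"
  have w: "w \<in> borel_measurable borel" unfolding w_def[abs_def] by (rule measurable_weighted[OF P])
  have w0: "w x = 0" if "x \<notin> {0<..<T}" for x using that by (simp add: w_def weight_eq_0)
  have w2: "integrable lborel (\<lambda>x. (w x)\<^sup>2)" unfolding w_def by (rule integrable_weighted_square[OF P])
  have w1: "integrable lborel w" unfolding w_def[abs_def] by (rule integrable_weighted[OF P])
  have dw: "deriv ?u x = w x" if "x \<in> {0<..<T}" for x unfolding w_def by (rule deriv_primitive_of[OF P that])
  obtain q where q: "\<And>n. real_polynomial_function (q n)" "\<And>n. integral {0..T} (q n) = 0"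
    "(\<lambda>n. \<integral>x. (?I x * q n x - weight T \<alpha> x * P x)\<^sup>2 \<partial>lborel) \<longlonglongrightarrow> 0"
    using weighted_polynomial_approx[OF P P0] by blast
  define E where "E n = (\<integral>x. (?I x * q n x - w x)\<^sup>2 \<partial>lborel)" for n
  have E: "E \<longlonglongrightarrow> 0" using q(3) by (simp add: E_def[abs_def] w_def)
  have qc: "continuous_on S (q n)" for n S
    using continuous_real_polymonial_function[OF q(1)] continuous_on_subset[of UNIV "q n" S]
    by (simp add: continuous_on_eq_continuous_at)
  have qm[measurable]: "q n \<in> borel_measurable borel" for n using qc by (rule borel_measurable_continuous_onI)
  have "\<exists>p :: real poly. poly p 0 = 0 \<and> (\<forall>x. (poly p has_real_derivative q n x) (at x))" for n
    by (rule real_polynomial_antiderivative[OF q(1)[of n]]) blast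
  then obtain p :: "nat \<Rightarrow> real poly" where p: "\<And>n. poly (p n) 0 = 0" "\<And>n x. (poly (p n) has_real_derivative q n x) (at x)"
    by metis
  have p_eq: "poly (p n) t = integral {0..t} (q n)" if "0 \<le> t" for n t
  proof -
    have "(q n has_integral (poly (p n) t - poly (p n) 0)) {0..t}"
      by (rule fundamental_theorem_of_calculus) 
         (use that p(2) in \<open>auto simp: has_real_derivative_iff_has_vector_derivative[symmetric] intro: has_field_derivative_at_within\<close>)
    then show ?thesis using p(1)[of n] by (simp add: integral_unique)
  qed
  define d where "d n x = ?I x * q n x" for n x
  have d: "d n \<in> borel_measurable borel" for n unfolding d_def[abs_def] by measurable
  have d0: "d n x = 0" if "x \<notin> {0<..<T}" for n x using that by (simp add: d_def)
  have d2: "integrable lborel (\<lambda>x. (d n x)\<^sup>2)" for n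
  proof -
    have "integrable lborel (\<lambda>x. ?I x * (q n x)\<^sup>2)"
      by (rule integrable_indicator_continuous(1)) (intro continuous_intros qc)
    moreover have "(\<lambda>x. (d n x)\<^sup>2) = (\<lambda>x. ?I x * (q n x)\<^sup>2)" by (auto simp: d_def indicator_def)
    ultimately show ?thesis by simp
  qed
  have dd: "deriv (poly (p n)) x = d n x" if "x \<in> {0<..<T}" for n x
    using DERIV_imp_deriv[OF p(2)] that by (simp add: d_def)
  have d1: "integrable lborel (d n)" for n
    unfolding d_def[abs_def] by (rule integrable_indicator_continuous(1)[OF qc])
  have dw2: "integrable lborel (\<lambda>x. (d n x - w x)\<^sup>2)" for n
  proof (rule Bochner_Integration.integrable_bound)
    show "integrable lborel (\<lambda>x. 2 * (d n x)\<^sup>2 + 2 * (w x)\<^sup>2)"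
      by (intro Bochner_Integration.integrable_add integrable_mult_right d2 w2)
    have "(A - B)\<^sup>2 \<le> 2 * A\<^sup>2 + 2 * B\<^sup>2" for A B :: real
      using sum_squares_bound[of A "-B"] by (simp add: power2_diff)
    then show "AE x in lborel. norm ((d n x - w x)\<^sup>2) \<le> norm (2 * (d n x)\<^sup>2 + 2 * (w x)\<^sup>2)"
      by (intro AE_I2) (auto intro: order_trans[OF _ abs_ge_self])
  qed (use d[of n] w in measurable)
  define uc where "uc t = ?u (max 0 (min T t))" for t
  have ucc: "continuous_on UNIV uc"
    unfolding uc_def[abs_def] using T_pos
    by (intro continuous_on_compose2[OF continuous_primitive_of[OF P]]) (auto intro!: continuous_intros)
  have uc: "uc t = ?u t" if "t \<in> {0..T}" for t using that by (simp add: uc_def)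
  have [measurable]: "uc \<in> borel_measurable borel" using ucc by (rule borel_measurable_continuous_onI)
  note mc[measurable] = measurable_caputo_op[OF w] measurable_caputo_op[OF d]
  have cl: "caputo_left \<alpha> ?u s = caputo_op w s" if "s \<in> {0<..<T}" for s
    by (rule caputo_left_eq_op[OF w dw w0 that])
  have cd: "caputo_left \<alpha> (poly (p n)) s = caputo_op (d n) s" if "s \<in> {0<..<T}" for s n
    by (rule caputo_left_eq_op[OF d dd d0 that])
  have "square_integrable T ?u"
    unfolding square_integrable_def
  proof
    show "?u \<in> borel_measurable (lebesgue_on {0..T})"
      by (rule lebesgue_on_transfer(2)[where G = uc]) (auto simp: uc)
    show "integrable (lebesgue_on {0..T}) (\<lambda>t. (?u t)\<^sup>2)"
      by (rule lebesgue_on_transfer(3)[where G = "\<lambda>t. (uc t)\<^sup>2"])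
         (auto simp: uc intro!: integrable_indicator_continuous(1) continuous_intros ucc)
  qed
  moreover have "square_integrable T (caputo_left \<alpha> ?u)"
    unfolding square_integrable_def
  proof
    show "caputo_left \<alpha> ?u \<in> borel_measurable (lebesgue_on {0..T})"
      by (rule lebesgue_on_transfer(2)[where G = "caputo_op w"]) (use cl mc in auto)
    show "integrable (lebesgue_on {0..T}) (\<lambda>t. (caputo_left \<alpha> ?u t)\<^sup>2)"
      by (rule lebesgue_on_transfer(3)[where G = "\<lambda>t. (caputo_op w t)\<^sup>2"])
         (use cl mc caputo_op_L2_bound(1)[OF w w0 w2] in auto)
  qed
  moreover have "smooth_on_interval T (poly (p n)) \<and> poly (p n) 0 = 0 \<and> poly (p n) T = 0" for n
    using smooth_on_interval_poly p(1) p_eq[of T n] q(2)[of n] T_pos by simp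
  moreover have "(\<lambda>n. LINT t|lebesgue_on {0..T}. \<bar>caputo_left \<alpha> (poly (p n)) t - caputo_left \<alpha> ?u t\<bar>\<^sup>2) \<longlonglongrightarrow> 0"
  proof (rule tendsto_sandwich[of "\<lambda>_. 0"])
    have "(\<lambda>n. C\<^sub>5 * E n) \<longlonglongrightarrow> C\<^sub>5 * 0" by (intro tendsto_intros E)
    then show "(\<lambda>n. C\<^sub>5 * E n) \<longlonglongrightarrow> 0" by simp
    show "\<forall>\<^sub>F n in sequentially. (LINT t|lebesgue_on {0..T}. \<bar>caputo_left \<alpha> (poly (p n)) t - caputo_left \<alpha> ?u t\<bar>\<^sup>2) \<le> C\<^sub>5 * E n"
    proof (intro always_eventually allI)
      fix n
      have "(LINT t|lebesgue_on {0..T}. \<bar>caputo_left \<alpha> (poly (p n)) t - caputo_left \<alpha> ?u t\<bar>\<^sup>2) = 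
         (\<integral>t. ?I t * (caputo_op (d n) t - caputo_op w t)\<^sup>2 \<partial>lborel)"
        by (rule lebesgue_on_transfer(1)) (use cl cd in auto)
      also have "\<dots> = (\<integral>t. ?I t * (caputo_op (\<lambda>x. d n x - w x) t)\<^sup>2 \<partial>lborel)"
        by (rule caputo_op_L2_diff[OF d d0 d2 w w0 w2])
      also have "\<dots> \<le> C\<^sub>5 * (\<integral>x. (d n x - w x)\<^sup>2 \<partial>lborel)"
        by (rule caputo_op_L2_bound(2)) (use d w d0 w0 dw2 in auto)
      finally show "(LINT t|lebesgue_on {0..T}. \<bar>caputo_left \<alpha> (poly (p n)) t - caputo_left \<alpha> ?u t\<bar>\<^sup>2) \<le> C\<^sub>5 * E n"
        by (simp add: E_def d_def)
    qed
  qed (auto intro!: always_eventually integral_nonneg_AE)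
  moreover have "(\<lambda>n. LINT t|lebesgue_on {0..T}. \<bar>poly (p n) t - ?u t\<bar>\<^sup>2) \<longlonglongrightarrow> 0"
  proof (rule tendsto_sandwich[of "\<lambda>_. 0"])
    \<comment> \<open>One factor T comes from the pointwise bound t * E n \<le> T * E n, the other
      from integrating it over the interval.\<close>
    have "(\<lambda>n. T * E n * T) \<longlonglongrightarrow> T * 0 * T" by (intro tendsto_intros E)
    then show "(\<lambda>n. T * E n * T) \<longlonglongrightarrow> 0" by simp
    show "\<forall>\<^sub>F n in sequentially. (LINT t|lebesgue_on {0..T}. \<bar>poly (p n) t - ?u t\<bar>\<^sup>2) \<le> T * E n * T"
    proof (intro always_eventually allI)
      fix n
      have E0: "0 \<le> E n" unfolding E_def by (rule integral_nonneg_AE) simp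
      have pt: "(poly (p n) t - uc t)\<^sup>2 \<le> T * E n" if t: "t \<in> {0<..<T}" for t
      proof -
        let ?J = "\<lambda>x. indicator {0<..<t} x :: real"
        have J: "integrable lborel (\<lambda>x. (?J x)\<^sup>2)" "(\<integral>x. (?J x)\<^sup>2 \<partial>lborel) = t"
        proof -
          have "(\<lambda>x. (?J x)\<^sup>2) = ?J" by (auto simp: indicator_def)
          then show "integrable lborel (\<lambda>x. (?J x)\<^sup>2)" "(\<integral>x. (?J x)\<^sup>2 \<partial>lborel) = t"
            using t by (auto intro!: integrable_real_indicator)
        qed
        have i: "integrable lborel (\<lambda>x. ?J x * d n x)" "integrable lborel (\<lambda>x. ?J x * w x)"
          using integrable_mult_indicator[OF _ d1, of "{0<..<t}" n] integrable_mult_indicator[OF _ w1, of "{0<..<t}"] by simp_all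
        have i': "integrable lborel (\<lambda>x. ?J x * (d n x - w x))"
          using Bochner_Integration.integrable_diff[OF i] by (simp add: right_diff_distrib)
        have "?J x * d n x = ?J x * q n x" for x using t by (auto simp: d_def indicator_def)
        then have "(\<integral>x. ?J x * d n x \<partial>lborel) = (\<integral>x. ?J x * q n x \<partial>lborel)" by (simp only:)
        then have "(\<integral>x. ?J x * d n x \<partial>lborel) = poly (p n) t"
          using integrable_indicator_continuous(2)[OF qc, of 0 t n] p_eq[of t n] t by simp
        moreover have "(\<integral>x. ?J x * w x \<partial>lborel) = uc t"
        proof -
          have "set_integrable lborel {0<..<t} w" using i(2) by (simp add: set_integrable_def)
          from set_borel_integral_eq_integral(2)[OF this]
          show ?thesis using uc[of t] t 
            by (simp add: set_lebesgue_integral_def integral_open_interval_real primitive_of_def w_def[abs_def])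
        qed
        ultimately have "poly (p n) t - uc t = (\<integral>x. ?J x * (d n x - w x) \<partial>lborel)"
          using Bochner_Integration.integral_diff[OF i] by (simp add: right_diff_distrib)
        also have "\<dots>\<^sup>2 \<le> (\<integral>x. (?J x)\<^sup>2 \<partial>lborel) * (\<integral>x. (d n x - w x)\<^sup>2 \<partial>lborel)"
          by (rule Cauchy_Schwarz_integral[OF J(1) dw2 i'])
        also have "\<dots> = t * E n" unfolding J(2) by (simp add: E_def d_def)
        also have "\<dots> \<le> T * E n" using t E0 by (intro mult_right_mono) auto
        finally show ?thesis .
      qed
      have "(LINT t|lebesgue_on {0..T}. \<bar>poly (p n) t - ?u t\<bar>\<^sup>2) = (\<integral>t. ?I t * (poly (p n) t - uc t)\<^sup>2 \<partial>lborel)"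
        by (rule lebesgue_on_transfer(1)) (auto simp: uc intro!: borel_measurable_continuous_onI continuous_intros ucc)
      also have "\<dots> \<le> (\<integral>t. T * E n * ?I t \<partial>lborel)"
      proof (rule integral_mono)
        show "integrable lborel (\<lambda>t. ?I t * (poly (p n) t - uc t)\<^sup>2)"
          by (rule integrable_indicator_continuous(1)) (intro continuous_intros ucc)
        show "integrable lborel (\<lambda>t. T * E n * ?I t)"
          using T_pos by (auto intro!: integrable_mult_right integrable_real_indicator)
        show "?I t * (poly (p n) t - uc t)\<^sup>2 \<le> T * E n * ?I t" for t
          using pt[of t] by (auto simp: indicator_def)
      qed
      also have "\<dots> = T * E n * T" using T_pos by simp
      finally show "(LINT t|lebesgue_on {0..T}. \<bar>poly (p n) t - ?u t\<bar>\<^sup>2) \<le> T * E n * T" .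
    qed
  qed (auto intro!: always_eventually integral_nonneg_AE)
  ultimately have "has_extended_caputo T \<alpha> ?u (caputo_left \<alpha> ?u)"
    unfolding has_extended_caputo_def by (intro conjI exI[of _ "\<lambda>n. poly (p n)"] allI) simp_all
  then show ?thesis
    unfolding E_space_def using continuous_primitive_of[OF P] by blast
qed

end

section \<open>The variational argument\<close>

text \<open>Isolates what the variational argument uses of the linear problem, so that \<alpha> < 1
  and \<alpha> = 1 share it. The solution operator is a relation because solutions matter only on
  [0,T]. A general modulus \<open>\<Omega>\<close> is allowed because for \<alpha> < 1 the bound on
  u' blows up at the endpoints. With \<open>\<Lambda>\<close> = \<kappa>/(2T) the condition
  \<open>small\<close> reads \<kappa> \<mu> m < c^2.\<close>

locale nonlinear_problem =
  fixes T \<Lambda> \<mu> c m :: real and f F \<Omega> :: "real \<Rightarrow> real" and sol :: "(real \<Rightarrow> real) \<Rightarrow> (real \<Rightarrow> real) \<Rightarrow> bool"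
  assumes T: "0 < T" and \<Lambda>: "0 < \<Lambda>" and \<mu>: "0 < \<mu>" and c: "0 < c"
    and f: "continuous_on UNIV f" and F: "\<And>x. (F has_real_derivative f x) (at x)" and F0: "F 0 = 0"
    and Fm: "\<And>x. \<bar>x\<bar> \<le> c \<Longrightarrow> F x \<le> m" and small: "2 * \<Lambda> * \<mu> * T * m < c\<^sup>2"
    and \<Omega>: "continuous_on {0..T} \<Omega>"
    and sol_cont: "\<And>g u. sol g u \<Longrightarrow> continuous_on {0..T} g" "\<And>g u. sol g u \<Longrightarrow> continuous_on {0..T} u"
    and sol_0: "\<And>g u. sol g u \<Longrightarrow> u 0 = 0"
    and sol_lincomb: "\<And>g u h v a b. sol g u \<Longrightarrow> sol h v \<Longrightarrow> sol (\<lambda>x. a * g x + b * h x) (\<lambda>x. a * u x + b * v x)"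
    and sol_sym: "\<And>g u h v. sol g u \<Longrightarrow> sol h v \<Longrightarrow> integral {0..T} (\<lambda>x. u x * h x) = integral {0..T} (\<lambda>x. v x * g x)"
    and sol_bound: "\<And>g u t. sol g u \<Longrightarrow> t \<in> {0..T} \<Longrightarrow> (u t)\<^sup>2 \<le> \<Lambda> * integral {0..T} (\<lambda>x. u x * g x)"
    and sol_ex: "\<And>g. continuous_on {0..T} g \<Longrightarrow> \<exists>u. sol g u"
    and sol_equicont: "\<And>g u b x y. sol g u \<Longrightarrow> (\<And>x. x \<in> {0..T} \<Longrightarrow> \<bar>g x\<bar> \<le> b) \<Longrightarrow> x \<in> {0..T} \<Longrightarrow> y \<in> {0..T} \<Longrightarrow>
          \<bar>u x - u y\<bar> \<le> b * \<bar>\<Omega> x - \<Omega> y\<bar>"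
begin

abbreviation I :: "(real \<Rightarrow> real) \<Rightarrow> real" where "I a \<equiv> integral {0..T} a"

lemma I_lincomb:
  assumes "continuous_on {0..T} a" "continuous_on {0..T} b"
  shows "I (\<lambda>x. s * a x + t * b x) = s * I a + t * I b"
  by (intro integral_unique has_integral_add has_integral_mult_right integrable_integral integrable_continuous_real assms)

lemma I_bound:
  assumes "continuous_on {0..T} a" "\<And>x. x \<in> {0..T} \<Longrightarrow> \<bar>a x\<bar> \<le> b"
  shows "\<bar>I a\<bar> \<le> T * b"
  using integral_bound[of 0 T a b] assms T by (simp add: mult.commute)

lemma I_mono:
  assumes "continuous_on {0..T} a" "continuous_on {0..T} b" "\<And>x. x \<in> {0..T} \<Longrightarrow> a x \<le> b x"
  shows "I a \<le> I b"
  by (intro integral_le integrable_continuous_real assms)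

lemma energy_nonneg: "sol g u \<Longrightarrow> 0 \<le> I (\<lambda>x. u x * g x)"
  using sol_bound[of g u 0] T \<Lambda> sol_0[of g u] by (simp add: zero_le_mult_iff)

lemma cont_F: "continuous_on S F"
  by (rule DERIV_continuous_on) (use F in \<open>auto intro: has_field_derivative_at_within\<close>)

lemma cont_compose:
  assumes "continuous_on {0..T} u"
  shows "continuous_on {0..T} (\<lambda>x. f (u x))" "continuous_on {0..T} (\<lambda>x. F (u x))"
  using continuous_on_compose2[OF f assms] continuous_on_compose2[OF cont_F assms] by auto

text \<open>Energy at most 2 r forces u^2 \<le> 2 r \<Lambda> = c^2; the factor 2 matches the half
  in front of the energy in \<open>J\<close>.\<close>

definition r :: real where "r = c\<^sup>2 / (2 * \<Lambda>)"

lemma r_pos: "0 < r" using c \<Lambda> by (simp add: r_def)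

lemma \<mu>_small: "\<mu> * T * m < r"
  using small \<Lambda> by (simp add: r_def field_simps)

definition admissible :: "(real \<Rightarrow> real) \<Rightarrow> (real \<Rightarrow> real) \<Rightarrow> bool" where
  "admissible g u \<longleftrightarrow> sol g u \<and> I (\<lambda>x. u x * g x) \<le> 2 * r"

lemma admissible_bound:
  assumes "admissible g u" "x \<in> {0..T}"
  shows "\<bar>u x\<bar> \<le> c"
proof -
  have "(u x)\<^sup>2 \<le> \<Lambda> * I (\<lambda>x. u x * g x)" using assms sol_bound by (simp add: admissible_def)
  also have "\<dots> \<le> \<Lambda> * (2 * r)" using assms \<Lambda> by (intro mult_left_mono) (auto simp: admissible_def)
  also have "\<dots> = c\<^sup>2" using \<Lambda> by (simp add: r_def)
  finally show ?thesis using c by (metis abs_le_square_iff abs_of_pos)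
qed

definition J :: "(real \<Rightarrow> real) \<Rightarrow> (real \<Rightarrow> real) \<Rightarrow> real" where
  "J g u = I (\<lambda>x. u x * g x) / 2 - \<mu> * I (\<lambda>x. F (u x))"

lemma I_F_le: 
  assumes "admissible g u" shows "\<mu> * I (\<lambda>x. F (u x)) \<le> \<mu> * T * m"
proof -
  have "sol g u" using assms by (simp add: admissible_def)
  have "I (\<lambda>x. F (u x)) \<le> I (\<lambda>_. m)"
    by (intro I_mono cont_compose continuous_intros) (use assms admissible_bound Fm sol_cont[OF \<open>sol g u\<close>] in auto)
  then show ?thesis using T \<mu> by (simp add: mult.assoc mult_left_mono)
qed

lemma J_bounded_below: "admissible g u \<Longrightarrow> - (\<mu> * T * m) \<le> J g u"
  using I_F_le[of g u] energy_nonneg[of g u] by (auto simp: J_def admissible_def)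

lemma sol_zero: "sol (\<lambda>_. 0) (\<lambda>_. 0)"
proof -
  obtain u where "sol (\<lambda>_. 0) u" using sol_ex[of "\<lambda>_. 0"] by auto
  from sol_lincomb[OF this this, of 0 0] show ?thesis by simp
qed

lemma admissible_zero: "admissible (\<lambda>_. 0) (\<lambda>_. 0)" "J (\<lambda>_. 0) (\<lambda>_. 0) = 0"
  using sol_zero r_pos by (auto simp: admissible_def J_def F0)

definition j :: real where "j = Inf {J g u | g u. admissible g u}"

lemma j_le: "admissible g u \<Longrightarrow> j \<le> J g u"
  unfolding j_def by (rule cInf_lower) (auto intro!: bdd_belowI[of _ "- (\<mu> * T * m)"] J_bounded_below)

lemma approximate_minimiser:
  assumes "0 < e" obtains g u where "admissible g u" "J g u < j + e"
proof -
  have "{J g u | g u. admissible g u} \<noteq> {}" using admissible_zero by blast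
  from cInf_lessD[OF this, of "j + e"] assms show ?thesis using that by (auto simp: j_def)
qed

lemma f_bounded: obtains b where "0 < b" "\<And>x. \<bar>x\<bar> \<le> c \<Longrightarrow> \<bar>f x\<bar> \<le> b"
proof -
  have "compact (f ` {-c..c})"
    by (intro compact_continuous_image continuous_on_subset[OF f]) auto
  then obtain b where b: "b > 0" "\<forall>z\<in>f ` {-c..c}. norm z \<le> b" by (meson bounded_pos compact_imp_bounded)
  show ?thesis
  proof (rule that[OF b(1)])
    fix x assume "\<bar>x\<bar> \<le> c"
    then have "x \<in> {-c..c}" by auto
    then show "\<bar>f x\<bar> \<le> b" using b(2) by auto
  qed
qed

lemma \<Omega>_bounded: obtains D where "0 < D" "\<And>x. x \<in> {0..T} \<Longrightarrow> \<bar>\<Omega> x - \<Omega> 0\<bar> \<le> D"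
proof -
  have "compact ((\<lambda>x. \<Omega> x - \<Omega> 0) ` {0..T})"
    by (intro compact_continuous_image continuous_intros \<Omega>) auto
  then obtain b where "b > 0" "\<forall>z\<in>(\<lambda>x. \<Omega> x - \<Omega> 0) ` {0..T}. norm z \<le> b" by (meson bounded_pos compact_imp_bounded)
  then show ?thesis using that[of b] by auto
qed

lemma f_uniform:
  assumes "0 < e" obtains d where "0 < d" "\<And>x y. \<bar>x\<bar> \<le> c \<Longrightarrow> \<bar>y\<bar> \<le> c \<Longrightarrow> \<bar>x - y\<bar> < d \<Longrightarrow> \<bar>f x - f y\<bar> < e"
proof -
  have "uniformly_continuous_on {-c..c} f"
    by (intro compact_uniformly_continuous continuous_on_subset[OF f]) auto
  then obtain d where d: "d > 0" "\<forall>x\<in>{-c..c}. \<forall>y\<in>{-c..c}. dist y x < d \<longrightarrow> dist (f y) (f x) < e"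
    using assms unfolding uniformly_continuous_on_def by blast
  show ?thesis
  proof (rule that[OF d(1)])
    fix x y assume "\<bar>x\<bar> \<le> c" "\<bar>y\<bar> \<le> c" and xy: "\<bar>x - y\<bar> < d"
    then have "y \<in> {-c..c}" "x \<in> {-c..c}" by auto
    then show "\<bar>f x - f y\<bar> < e" using d(2) xy by (simp add: dist_real_def)
  qed
qed

text \<open>
  An approximate minimiser lies strictly inside the energy ball, because \<open>J \<le> j + e \<le> e\<close> there.
  Moving it in the direction \<open>h = \<mu> f(u) - g\<close> shows that the energy of \<open>h\<close> is small.
\<close>

lemma approximate_solution:
  assumes \<theta>: "0 < \<theta>"
  obtains g u v where "sol g u" "\<And>x. x \<in> {0..T} \<Longrightarrow> \<bar>u x\<bar> \<le> c" "sol (\<lambda>x. f (u x)) v"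
    "\<And>x. x \<in> {0..T} \<Longrightarrow> (\<mu> * v x - u x)\<^sup>2 \<le> \<Lambda> * \<theta>"
proof -
  obtain b where b: "0 < b" "\<And>x. \<bar>x\<bar> \<le> c \<Longrightarrow> \<bar>f x\<bar> \<le> b" using f_bounded by blast
  obtain D where D: "0 < D" "\<And>x. x \<in> {0..T} \<Longrightarrow> \<bar>\<Omega> x - \<Omega> 0\<bar> \<le> D" using \<Omega>_bounded by blast
  \<comment> \<open>\<open>Z\<close> bounds |z|, \<open>Z1\<close> bounds the integral of z g,
    \<open>Q0\<close> bounds the energy Q of h, and \<open>\<delta>\<close> is the margin that the
    condition on \<mu> leaves.\<close>
  define Z where "Z = \<mu> * (b * D) + c"
  define Z1 where "Z1 = \<mu> * (T * (c * b)) + 2 * r"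
  define Q0 where "Q0 = \<mu>\<^sup>2 * (T * (b * D * b)) + 2 * (\<mu> * (T * (c * b))) + 2 * r"
  define \<delta> where "\<delta> = r - \<mu> * T * m"
  have pos: "0 < Z" "0 < Z1" "0 < Q0" "0 < \<delta>"
    unfolding Z_def Z1_def Q0_def \<delta>_def using \<mu> b(1) D(1) c T r_pos \<mu>_small by (auto intro!: add_pos_pos mult_pos_pos)
  \<comment> \<open>Tolerance for the variation of f, chosen so that \<mu> T Z \<eta> =
    \<theta>/4.\<close>
  define \<eta> where "\<eta> = \<theta> / (4 * (\<mu> * T * Z))"
  have \<eta>: "0 < \<eta>" unfolding \<eta>_def using \<theta> pos \<mu> T by simp
  obtain d where d: "0 < d" "\<And>x y. \<bar>x\<bar> \<le> c \<Longrightarrow> \<bar>y\<bar> \<le> c \<Longrightarrow> \<bar>x - y\<bar> < d \<Longrightarrow> \<bar>f x - f y\<bar> < \<eta>"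
    using f_uniform[OF \<eta>] by blast
  \<comment> \<open>The entries of the minimum give, in order: t^2 \<le> t; the moved point stays in
    the energy ball; f varies by less than \<eta> along the move; the second-order term t Q / 2 is
    at most \<theta>/4.\<close>
  define t where "t = min 1 (min (\<delta> / (2 * Z1 + Q0)) (min (d / (2 * Z)) (\<theta> / (2 * Q0))))"
  have t: "0 < t" "t \<le> 1" "t * (2 * Z1 + Q0) \<le> \<delta>" "t * Z < d" "t * Q0 / 2 \<le> \<theta> / 4"
  proof -
    show "0 < t" unfolding t_def using pos d(1) \<theta> by simp
    show "t \<le> 1" unfolding t_def by simp
    have "t \<le> \<delta> / (2 * Z1 + Q0)" unfolding t_def by simp
    then show "t * (2 * Z1 + Q0) \<le> \<delta>" using pos by (simp add: pos_le_divide_eq)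
    have "t \<le> d / (2 * Z)" unfolding t_def by simp
    then have "t * (2 * Z) \<le> d" using pos by (simp add: pos_le_divide_eq)
    then show "t * Z < d" using d(1) by linarith
    have "t \<le> \<theta> / (2 * Q0)" unfolding t_def by simp
    then have "t * (2 * Q0) \<le> \<theta>" using pos by (simp add: pos_le_divide_eq)
    moreover have "t * (2 * Q0) = 2 * (t * Q0)" by simp
    ultimately show "t * Q0 / 2 \<le> \<theta> / 4" by linarith
  qed
  \<comment> \<open>The bound \<delta>/2 keeps the minimiser inside the ball, and t \<theta>/4 is
    small compared with the first-order gain t Q.\<close>
  define e where "e = min (\<delta> / 2) (t * \<theta> / 4)"
  have e: "0 < e" "e \<le> \<delta> / 2" "e \<le> t * \<theta> / 4" unfolding e_def using pos t \<theta> by auto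
  obtain g u where gu: "admissible g u" "J g u < j + e" using approximate_minimiser[OF e(1)] by blast
  have s: "sol g u" using gu(1) by (simp add: admissible_def)
  note cg = sol_cont(1)[OF s] and cu = sol_cont(2)[OF s]
  have uc: "\<bar>u x\<bar> \<le> c" if "x \<in> {0..T}" for x by (rule admissible_bound[OF gu(1) that])
  have cfu: "continuous_on {0..T} (\<lambda>x. f (u x))" by (rule cont_compose[OF cu])
  obtain v where v: "sol (\<lambda>x. f (u x)) v" using sol_ex[OF cfu] by blast
  note cv = sol_cont(2)[OF v]
  have vb: "\<bar>v x\<bar> \<le> b * D" if x: "x \<in> {0..T}" for x
  proof -
    have "\<bar>v x - v 0\<bar> \<le> b * \<bar>\<Omega> x - \<Omega> 0\<bar>" using sol_equicont[OF v, of b x 0] b uc x T by auto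
    also have "\<dots> \<le> b * D" using b(1) D(2)[OF x] by (intro mult_left_mono) auto
    finally show ?thesis using sol_0[OF v] by simp
  qed
  \<comment> \<open>Let z be the solution with datum h. By symmetry the derivative of
    \<open>J\<close> at u along z is the integral of z g minus \<mu> times that of z f(u), that is
    -Q: the steepest descent direction for the energy norm.\<close>
  define h where "h x = \<mu> * f (u x) + (-1) * g x" for x
  define z where "z x = \<mu> * v x + (-1) * u x" for x
  have hz: "sol h z" unfolding h_def z_def by (rule sol_lincomb[OF v s])
  note ch = sol_cont(1)[OF hz] and cz = sol_cont(2)[OF hz]
  define A where "A = I (\<lambda>x. u x * g x)"
  define Bu where "Bu = I (\<lambda>x. u x * f (u x))"
  define Bv where "Bv = I (\<lambda>x. v x * f (u x))"
  define Q where "Q = I (\<lambda>x. z x * h x)"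
  have A: "0 \<le> A" "A \<le> 2 * r" using energy_nonneg[OF s] gu(1) by (auto simp: A_def admissible_def)
  have Bu: "\<bar>Bu\<bar> \<le> T * (c * b)" unfolding Bu_def
    by (rule I_bound) (use uc b c in \<open>auto simp: abs_mult intro!: continuous_intros cu cfu mult_mono\<close>)
  have Bv: "\<bar>Bv\<bar> \<le> T * (b * D * b)" unfolding Bv_def
    by (rule I_bound) (use uc b vb D(1) in \<open>auto simp: abs_mult intro!: continuous_intros cv cfu mult_mono\<close>)
  have vg: "I (\<lambda>x. v x * g x) = Bu" unfolding Bu_def by (rule sol_sym[OF s v, symmetric])
  have zg: "I (\<lambda>x. z x * g x) = \<mu> * Bu - A"
  proof -
    have "(\<lambda>x. z x * g x) = (\<lambda>x. \<mu> * (v x * g x) + (-1) * (u x * g x))" by (auto simp: z_def algebra_simps)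
    then have "I (\<lambda>x. z x * g x) = \<mu> * I (\<lambda>x. v x * g x) + (-1) * A"
      unfolding A_def using I_lincomb[of "\<lambda>x. v x * g x" "\<lambda>x. u x * g x" \<mu> "-1"] cv cu cg by (simp add: continuous_on_mult)
    then show ?thesis using vg by simp
  qed
  have zf: "I (\<lambda>x. z x * f (u x)) = \<mu> * Bv - Bu"
  proof -
    have "(\<lambda>x. z x * f (u x)) = (\<lambda>x. \<mu> * (v x * f (u x)) + (-1) * (u x * f (u x)))" by (auto simp: z_def algebra_simps)
    then show ?thesis
      unfolding Bu_def Bv_def using I_lincomb[of "\<lambda>x. v x * f (u x)" "\<lambda>x. u x * f (u x)" \<mu> "-1"] cv cu cfu by (simp add: continuous_on_mult)
  qed
  have Q_eq: "Q = \<mu> * I (\<lambda>x. z x * f (u x)) - I (\<lambda>x. z x * g x)"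
  proof -
    have "(\<lambda>x. z x * h x) = (\<lambda>x. \<mu> * (z x * f (u x)) + (-1) * (z x * g x))" by (auto simp: h_def algebra_simps)
    then show ?thesis
      unfolding Q_def using I_lincomb[of "\<lambda>x. z x * f (u x)" "\<lambda>x. z x * g x" \<mu> "-1"] cz cg cfu by (simp add: continuous_on_mult)
  qed
  have "Q = \<mu>\<^sup>2 * Bv - 2 * (\<mu> * Bu) + A" unfolding Q_eq zf zg by (simp add: power2_eq_square algebra_simps)
  moreover have "\<mu>\<^sup>2 * Bv \<le> \<mu>\<^sup>2 * (T * (b * D * b))" using Bv by (intro mult_left_mono) auto
  moreover have muBu: "\<bar>\<mu> * Bu\<bar> \<le> \<mu> * (T * (c * b))" using Bu \<mu> by (simp add: abs_mult)
  ultimately have Q0: "Q \<le> Q0" unfolding Q0_def using A by linarith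
  have Q1: "0 \<le> Q" unfolding Q_def by (rule energy_nonneg[OF hz])
  define g' where "g' x = 1 * g x + t * h x" for x
  define u' where "u' x = 1 * u x + t * z x" for x
  have s': "sol g' u'" unfolding g'_def u'_def by (rule sol_lincomb[OF s hz])
  have A': "I (\<lambda>x. u' x * g' x) = A + 2 * t * I (\<lambda>x. z x * g x) + t\<^sup>2 * Q"
  proof -
    have "(\<lambda>x. u' x * g' x) = (\<lambda>x. 1 * (u x * g x + t * (u x * h x)) + t * (1 * (z x * g x) + t * (z x * h x)))"
      by (auto simp: u'_def g'_def algebra_simps)
    then have "I (\<lambda>x. u' x * g' x) = 1 * I (\<lambda>x. u x * g x + t * (u x * h x)) + t * I (\<lambda>x. 1 * (z x * g x) + t * (z x * h x))"
      using I_lincomb[of "\<lambda>x. u x * g x + t * (u x * h x)" "\<lambda>x. 1 * (z x * g x) + t * (z x * h x)" 1 t] cu cg ch cz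
      by (simp add: continuous_on_mult continuous_on_add)
    also have "I (\<lambda>x. u x * g x + t * (u x * h x)) = A + t * I (\<lambda>x. u x * h x)"
      using I_lincomb[of "\<lambda>x. u x * g x" "\<lambda>x. u x * h x" 1 t] cu cg ch by (simp add: continuous_on_mult A_def)
    also have "I (\<lambda>x. u x * h x) = I (\<lambda>x. z x * g x)" by (rule sol_sym[OF s hz])
    also have "I (\<lambda>x. 1 * (z x * g x) + t * (z x * h x)) = I (\<lambda>x. z x * g x) + t * Q"
      using I_lincomb[of "\<lambda>x. z x * g x" "\<lambda>x. z x * h x" 1 t] cz cg ch by (simp add: continuous_on_mult Q_def)
    finally show ?thesis by (simp add: power2_eq_square algebra_simps)
  qed
  have zg_bound: "\<bar>I (\<lambda>x. z x * g x)\<bar> \<le> Z1" unfolding zg Z1_def using muBu A by linarith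
  \<comment> \<open>Comparison with the zero pair gives J < e \<le> \<delta>/2, while \<mu> times
    the integral of F(u) is at most r - \<delta>.\<close>
  have A_small: "A \<le> 2 * r - \<delta>"
  proof -
    have "J g u < e" using gu(2) j_le[OF admissible_zero(1)] admissible_zero(2) by linarith
    then have "A / 2 < e + \<mu> * I (\<lambda>x. F (u x))" by (simp add: J_def A_def)
    also have "\<dots> \<le> \<delta> / 2 + \<mu> * T * m" using e(2) I_F_le[OF gu(1)] by linarith
    finally have "A / 2 < \<delta> / 2 + \<mu> * T * m" .
    moreover have "\<mu> * T * m = r - \<delta>" by (simp add: \<delta>_def)
    ultimately show ?thesis by linarith
  qed
  have adm': "admissible g' u'"
    unfolding admissible_def
  proof
    have "t * I (\<lambda>x. z x * g x) \<le> t * Z1" using zg_bound t(1) by (intro mult_left_mono) auto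
    moreover have "t\<^sup>2 * Q \<le> t * Q0"
    proof -
      have "t\<^sup>2 \<le> t" using t(1,2) by (simp add: power2_eq_square mult_left_le)
      then show ?thesis using Q0 Q1 t(1) by (intro mult_mono) auto
    qed
    ultimately have "A + 2 * t * I (\<lambda>x. z x * g x) + t\<^sup>2 * Q \<le> A + t * (2 * Z1 + Q0)" by (simp add: algebra_simps)
    then show "I (\<lambda>x. u' x * g' x) \<le> 2 * r" unfolding A' using A_small t(3) by linarith
  qed (rule s')
  have zb: "\<bar>z x\<bar> \<le> Z" if "x \<in> {0..T}" for x
  proof -
    have "\<bar>\<mu> * v x\<bar> \<le> \<mu> * (b * D)" using vb[OF that] \<mu> by (simp add: abs_mult)
    then show ?thesis using uc[OF that] unfolding z_def Z_def by linarith
  qed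
  have Fdiff: "F (u' x) \<ge> F (u x) + t * (z x * f (u x)) - t * (Z * \<eta>)" if x: "x \<in> {0..T}" for x
  proof -
    have "\<bar>u' x\<bar> \<le> c" by (rule admissible_bound[OF adm' x])
    note u'c = this
    have diff: "u' x - u x = t * z x" by (simp add: u'_def)
    \<comment> \<open>The intermediate point has to lie in [-c,c], where f is uniformly continuous;
      this is why admissibility of the moved pair comes before.\<close>
    obtain \<xi> where \<xi>: "F (u' x) - F (u x) = (u' x - u x) * f \<xi>" "\<bar>\<xi> - u x\<bar> \<le> \<bar>u' x - u x\<bar>" "\<bar>\<xi>\<bar> \<le> c"
    proof (cases "u x" "u' x" rule: linorder_cases)
      case less
      then obtain \<xi> where "\<xi> > u x" "\<xi> < u' x" "F (u' x) - F (u x) = (u' x - u x) * f \<xi>" using MVT2[of "u x" "u' x" F f] F by blast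
      then show thesis using that[of \<xi>] u'c uc[OF x] by auto
    next
      case equal
      then show thesis using that[of "u x"] uc[OF x] by simp
    next
      case greater
      then obtain \<xi> where "\<xi> > u' x" "\<xi> < u x" "F (u x) - F (u' x) = (u x - u' x) * f \<xi>" using MVT2[of "u' x" "u x" F f] F by blast
      then show thesis using that[of \<xi>] u'c uc[OF x] by (auto simp: algebra_simps)
    qed
    have tz: "\<bar>t * z x\<bar> \<le> t * Z" using zb[OF x] t(1) by (simp add: abs_mult)
    then have "\<bar>\<xi> - u x\<bar> < d" using \<xi>(2) t(4) unfolding diff by linarith
    then have fd: "\<bar>f \<xi> - f (u x)\<bar> < \<eta>" using d(2)[OF \<xi>(3) uc[OF x]] by simp
    have "F (u' x) - F (u x) = t * (z x * f (u x)) + (t * z x) * (f \<xi> - f (u x))"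
      unfolding \<xi>(1) diff by (simp add: algebra_simps)
    moreover have "\<bar>(t * z x) * (f \<xi> - f (u x))\<bar> \<le> (t * Z) * \<eta>"
      unfolding abs_mult[of "t * z x"] using tz fd by (intro mult_mono) auto
    ultimately show ?thesis by (simp add: mult.assoc)
  qed
  have IF: "I (\<lambda>x. F (u' x)) \<ge> I (\<lambda>x. F (u x)) + t * I (\<lambda>x. z x * f (u x)) - T * (t * (Z * \<eta>))"
  proof -
    have c1: "continuous_on {0..T} (\<lambda>x. F (u x))" "continuous_on {0..T} (\<lambda>x. F (u' x))"
      by (rule cont_compose[OF cu]) (rule cont_compose[OF sol_cont(2)[OF s']])
    have "I (\<lambda>x. 1 * (1 * F (u x) + t * (z x * f (u x))) + (- (t * (Z * \<eta>))) * 1) \<le> I (\<lambda>x. F (u' x))"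
    proof (rule I_mono)
      show "continuous_on {0..T} (\<lambda>x. 1 * (1 * F (u x) + t * (z x * f (u x))) + (- (t * (Z * \<eta>))) * 1)"
        by (intro continuous_intros c1 cz cfu)
    qed (use Fdiff c1 in auto)
    also have "I (\<lambda>x. 1 * (1 * F (u x) + t * (z x * f (u x))) + (- (t * (Z * \<eta>))) * 1) = 
      1 * I (\<lambda>x. 1 * F (u x) + t * (z x * f (u x))) + (- (t * (Z * \<eta>))) * I (\<lambda>_. 1)"
      by (rule I_lincomb) (intro continuous_intros c1 cz cfu)+
    also have "I (\<lambda>x. 1 * F (u x) + t * (z x * f (u x))) = 1 * I (\<lambda>x. F (u x)) + t * I (\<lambda>x. z x * f (u x))"
      by (rule I_lincomb) (intro continuous_intros c1 cz cfu)+
    finally show ?thesis using T by (simp add: mult.commute)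
  qed
  have "j \<le> J g' u'" by (rule j_le[OF adm'])
  then have "J g u - e < (A + 2 * t * I (\<lambda>x. z x * g x) + t\<^sup>2 * Q) / 2 - \<mu> * I (\<lambda>x. F (u' x))"
    using gu(2) unfolding J_def A' by linarith
  moreover have "\<mu> * I (\<lambda>x. F (u' x)) \<ge> \<mu> * (I (\<lambda>x. F (u x)) + t * I (\<lambda>x. z x * f (u x)) - T * (t * (Z * \<eta>)))"
    using IF \<mu> by (intro mult_left_mono) auto
  ultimately have "- e < t * I (\<lambda>x. z x * g x) + t\<^sup>2 * Q / 2 - \<mu> * (t * I (\<lambda>x. z x * f (u x)) - T * (t * (Z * \<eta>)))"
    unfolding J_def A_def[symmetric] by (simp add: algebra_simps)
  also have "\<dots> = t * (- Q + t * Q / 2 + \<mu> * T * Z * \<eta>)"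
    unfolding Q_eq by (simp add: power2_eq_square algebra_simps)
  \<comment> \<open>Near-minimality limits the gain: after division by t, Q is below e/t plus the
    second-order and continuity errors, three terms of at most \<theta>/4 each.\<close>
  finally have key: "t * (Q - t * Q / 2 - \<mu> * T * Z * \<eta>) < e" by (simp add: algebra_simps)
  also have "e \<le> t * (\<theta> / 4)" using e(3) by simp
  finally have "Q - t * Q / 2 - \<mu> * T * Z * \<eta> < \<theta> / 4" using t(1) by simp
  moreover have "\<mu> * T * Z * \<eta> = \<theta> / 4" unfolding \<eta>_def using \<mu> T pos by simp
  moreover have "t * Q / 2 \<le> \<theta> / 4"
  proof -
    have "t * Q \<le> t * Q0" using Q0 t(1) by (intro mult_left_mono) auto
    then show ?thesis using t(5) by linarith
  qed
  ultimately have "Q \<le> \<theta>" using \<theta> by linarith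
  have "(\<mu> * v x - u x)\<^sup>2 \<le> \<Lambda> * \<theta>" if "x \<in> {0..T}" for x
  proof -
    have "(z x)\<^sup>2 \<le> \<Lambda> * Q" unfolding Q_def by (rule sol_bound[OF hz that])
    also have "\<dots> \<le> \<Lambda> * \<theta>" using \<open>Q \<le> \<theta>\<close> \<Lambda> by (intro mult_left_mono) auto
    finally show ?thesis by (simp add: z_def)
  qed
  then show thesis using that[OF s uc v] by blast
qed

text \<open>The data of the approximate minimisers u_n have no common sup bound, so compactness is
  applied to the solutions v_n with data f(u_n), which are bounded because |u_n| \<le> c. Since
  \<mu> v_n - u_n tends to 0 uniformly, a uniform limit w of the v_n makes \<mu> w the limit of the
  u_n, and the solution with datum f(\<mu> w) turns out to be w.\<close>

theorem solution_exists: "\<exists>g u. sol g u \<and> (\<forall>x\<in>{0..T}. g x = \<mu> * f (u x))"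
proof -
  obtain b where b: "0 < b" "\<And>x. \<bar>x\<bar> \<le> c \<Longrightarrow> \<bar>f x\<bar> \<le> b" using f_bounded by blast
  obtain D where D: "0 < D" "\<And>x. x \<in> {0..T} \<Longrightarrow> \<bar>\<Omega> x - \<Omega> 0\<bar> \<le> D" using \<Omega>_bounded by blast
  let ?e = "\<lambda>n. inverse (real (Suc n))"
  have "\<exists>u v. continuous_on {0..T} u \<and> (\<forall>x\<in>{0..T}. \<bar>u x\<bar> \<le> c) \<and> sol (\<lambda>x. f (u x)) v \<and> (\<forall>x\<in>{0..T}. \<bar>\<mu> * v x - u x\<bar> \<le> ?e n)" for n
  proof -
    \<comment> \<open>The choice \<theta> = e^2/\<Lambda> turns the bound \<Lambda> \<theta> into
      e^2.\<close>
    have "0 < (?e n)\<^sup>2 / \<Lambda>" using \<Lambda> by simp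
    then obtain g u v where *: "sol g u" "\<And>x. x \<in> {0..T} \<Longrightarrow> \<bar>u x\<bar> \<le> c" "sol (\<lambda>x. f (u x)) v"
      "\<And>x. x \<in> {0..T} \<Longrightarrow> (\<mu> * v x - u x)\<^sup>2 \<le> \<Lambda> * ((?e n)\<^sup>2 / \<Lambda>)"
      using approximate_solution by blast
    have "\<bar>\<mu> * v x - u x\<bar> \<le> ?e n" if "x \<in> {0..T}" for x
    proof -
      have "(\<mu> * v x - u x)\<^sup>2 \<le> (?e n)\<^sup>2" using *(4)[OF that] \<Lambda> by simp
      then show ?thesis by (rule abs_le_square_iff[THEN iffD2, THEN order_trans]) simp
    qed
    then show ?thesis using * sol_cont by blast
  qed
  then obtain u v where uv: "\<And>n. continuous_on {0..T} (u n)" "\<And>n x. x \<in> {0..T} \<Longrightarrow> \<bar>u n x\<bar> \<le> c" 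
    "\<And>n. sol (\<lambda>x. f (u n x)) (v n)" "\<And>n x. x \<in> {0..T} \<Longrightarrow> \<bar>\<mu> * v n x - u n x\<bar> \<le> ?e n"
    by metis
  have equi: "\<bar>v n x - v n y\<bar> \<le> b * \<bar>\<Omega> x - \<Omega> y\<bar>" if "x \<in> {0..T}" "y \<in> {0..T}" for n x y
    by (rule sol_equicont[OF uv(3) _ that]) (use b uv(2) in auto)
  obtain w k where w: "continuous_on {0..T} w" "strict_mono (k :: nat \<Rightarrow> nat)"
    "\<And>e. 0 < e \<Longrightarrow> \<exists>N. \<forall>n x. n \<ge> N \<and> x \<in> {0..T} \<longrightarrow> norm (v (k n) x - w x) < e"
  proof (rule Arzela_Ascoli[of "{0..T}" v "b * D"])
    show "norm (v n x) \<le> b * D" if x: "x \<in> {0..T}" for n x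
    proof -
      have "\<bar>v n x - v n 0\<bar> \<le> b * \<bar>\<Omega> x - \<Omega> 0\<bar>" using equi[OF x, of 0 n] T by simp
      also have "\<dots> \<le> b * D" using b(1) D(2)[OF x] by (intro mult_left_mono) auto
      finally show ?thesis using sol_0[OF uv(3)] by simp
    qed
    show "\<exists>d>0. \<forall>n y. y \<in> {0..T} \<and> norm (x - y) < d \<longrightarrow> norm (v n x - v n y) < e" if x: "x \<in> {0..T}" and e: "0 < e" for x e
    proof -
      have "0 < e / b" using e b(1) by simp
      then obtain d where d: "d > 0" "\<forall>y\<in>{0..T}. dist y x < d \<longrightarrow> dist (\<Omega> y) (\<Omega> x) < e / b"
        using \<Omega> x unfolding continuous_on_iff by blast
      have "norm (v n x - v n y) < e" if y: "y \<in> {0..T}" "norm (x - y) < d" for n y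
      proof -
        have "\<bar>\<Omega> x - \<Omega> y\<bar> < e / b" using d(2) y by (auto simp: dist_real_def abs_minus_commute)
        then have "b * \<bar>\<Omega> x - \<Omega> y\<bar> < e" using b(1) by (simp add: pos_less_divide_eq mult.commute)
        then show ?thesis using equi[OF x y(1), of n] by simp
      qed
      then show ?thesis using d(1) by blast
    qed
  qed (use that in auto)
  have k: "n \<le> k n" for n using w(2) by (rule strict_mono_imp_increasing)
  have e0: "?e \<longlonglongrightarrow> 0" by (rule LIMSEQ_inverse_real_of_nat)
  have unif: "\<exists>N. \<forall>n\<ge>N. \<forall>x\<in>{0..T}. \<bar>u (k n) x - \<mu> * w x\<bar> < e" if e: "0 < e" for e
  proof -
    have "0 < e / (2 * \<mu>)" using e \<mu> by simp
    then obtain N1 where N1: "\<forall>n x. n \<ge> N1 \<and> x \<in> {0..T} \<longrightarrow> norm (v (k n) x - w x) < e / (2 * \<mu>)" using w(3) by blast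
    obtain N2 where N2: "?e N2 < e / 2" using reals_Archimedean[of "e / 2"] e by auto
    have "\<bar>u (k n) x - \<mu> * w x\<bar> < e" if n: "n \<ge> max N1 N2" and x: "x \<in> {0..T}" for n x
    proof -
      have "\<mu> * \<bar>v (k n) x - w x\<bar> < \<mu> * (e / (2 * \<mu>))" using N1 n x \<mu> by (intro mult_strict_left_mono) auto
      then have 1: "\<bar>\<mu> * v (k n) x - \<mu> * w x\<bar> < e / 2" using \<mu> by (simp add: right_diff_distrib[symmetric] abs_mult)
      have "?e (k n) \<le> ?e N2" using k[of n] n by (intro le_imp_inverse_le) auto
      then show ?thesis using 1 uv(4)[OF x, of "k n"] N2 by linarith
    qed
    then show ?thesis by blast
  qed
  have lim: "(\<lambda>n. u (k n) x) \<longlonglongrightarrow> \<mu> * w x" if x: "x \<in> {0..T}" for x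
    unfolding LIMSEQ_iff using unif x by (metis real_norm_def)
  have wc: "\<bar>\<mu> * w x\<bar> \<le> c" if x: "x \<in> {0..T}" for x
    by (rule LIMSEQ_le_const2[OF tendsto_rabs[OF lim[OF x]]]) (use uv(2)[OF x] in auto)
  have cw: "continuous_on {0..T} (\<lambda>x. f (\<mu> * w x))"
    by (rule cont_compose) (intro continuous_intros w)
  obtain v' where v': "sol (\<lambda>x. f (\<mu> * w x)) v'" using sol_ex[OF cw] by blast
  have "v' x = w x" if x: "x \<in> {0..T}" for x
  proof -
    \<comment> \<open>The difference v (k n) - v' solves the linear problem with a uniformly small
      datum and vanishes at 0, so the equicontinuity estimate between 0 and x makes it
      small.\<close>
    have "\<bar>w x - v' x\<bar> \<le> e" if e: "0 < e" for e
    proof -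
      have "0 < e / (2 * D)" using e D by simp
      from f_uniform[OF this] obtain d where d: "0 < d" "\<And>x y. \<bar>x\<bar> \<le> c \<Longrightarrow> \<bar>y\<bar> \<le> c \<Longrightarrow> \<bar>x - y\<bar> < d \<Longrightarrow> \<bar>f x - f y\<bar> < e / (2 * D)"
        by blast
      obtain N1 where N1: "\<forall>n\<ge>N1. \<forall>x\<in>{0..T}. \<bar>u (k n) x - \<mu> * w x\<bar> < d" using unif[OF d(1)] by blast
      have "0 < e / 2" using e by simp
      then obtain N2 where N2: "\<forall>n x. n \<ge> N2 \<and> x \<in> {0..T} \<longrightarrow> norm (v (k n) x - w x) < e / 2" using w(3) by blast
      define n where "n = max N1 N2"
      have diff: "sol (\<lambda>x. 1 * f (u (k n) x) + (-1) * f (\<mu> * w x)) (\<lambda>x. 1 * v (k n) x + (-1) * v' x)"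
        by (rule sol_lincomb[OF uv(3) v'])
      have "\<bar>f (u (k n) y) - f (\<mu> * w y)\<bar> < e / (2 * D)" if y: "y \<in> {0..T}" for y
        by (rule d(2)[OF uv(2)[OF y] wc[OF y]]) (use N1 y in \<open>auto simp: n_def\<close>)
      then have fb: "\<bar>1 * f (u (k n) y) + (-1) * f (\<mu> * w y)\<bar> \<le> e / (2 * D)" if "y \<in> {0..T}" for y
        using that by (simp add: less_imp_le)
      have "0 \<in> {0..T}" using T by simp
      from sol_equicont[OF diff fb x this] sol_0[OF uv(3)] sol_0[OF v']
      have "\<bar>v (k n) x - v' x\<bar> \<le> e / (2 * D) * \<bar>\<Omega> x - \<Omega> 0\<bar>" by simp
      also have "\<dots> \<le> e / (2 * D) * D" using D e x by (intro mult_left_mono) auto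
      also have "\<dots> = e / 2" using D by simp
      finally have "\<bar>v (k n) x - v' x\<bar> \<le> e / 2" .
      moreover have "\<bar>v (k n) x - w x\<bar> < e / 2" using N2 x by (auto simp: n_def)
      ultimately show ?thesis by linarith
    qed
    then have "\<bar>w x - v' x\<bar> \<le> 0" by (rule field_le_epsilon) simp
    then show ?thesis by simp
  qed
  note vw = this
  have "sol (\<lambda>x. \<mu> * f (\<mu> * w x)) (\<lambda>x. \<mu> * v' x)"
    using sol_lincomb[OF v' v', of \<mu> 0] by (simp only: mult_zero_left add_0_right)
  moreover have "\<forall>x\<in>{0..T}. \<mu> * f (\<mu> * w x) = \<mu> * f (\<mu> * v' x)"
  proof
    fix x assume "x \<in> {0..T}"
    from vw[OF this] show "\<mu> * f (\<mu> * w x) = \<mu> * f (\<mu> * v' x)" by (simp only:)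
  qed
  ultimately show ?thesis by (intro exI conjI)
qed

end

section \<open>Existence of solutions\<close>

lemma primitive_deriv:
  assumes f: "continuous_on UNIV f"
  shows "(primitive f has_real_derivative f x) (at x)"
proof -
  let ?a = "- \<bar>x\<bar> - 1" and ?b = "\<bar>x\<bar> + 1"
  have "((\<lambda>u. LBINT y=ereal 0..ereal u. f y) has_vector_derivative f x) (at x within {?a..?b})"
    by (rule interval_integral_FTC2) (auto intro: continuous_on_subset[OF f])
  moreover have "at x within {?a..?b} = at x"
    by (intro at_within_interior) auto
  ultimately show ?thesis
    unfolding primitive_def[abs_def] by (simp add: has_real_derivative_iff_has_vector_derivative)
qed

lemma primitive_0: "primitive f 0 = 0"
  by (simp add: primitive_def zero_ereal_def[symmetric])

lemma primitive_le_max: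
  assumes f: "continuous_on UNIV f" and x: "\<bar>x\<bar> \<le> c"
  shows "primitive f x \<le> max_primitive f c"
proof -
  have S: "{\<xi>::real. \<bar>\<xi>\<bar> \<le> c} = {-c..c}" by auto
  have "continuous_on {-c..c} (primitive f)"
    by (rule DERIV_continuous_on) (use primitive_deriv[OF f] in \<open>auto intro: has_field_derivative_at_within\<close>)
  then have "compact (primitive f ` {-c..c})" by (intro compact_continuous_image) auto
  then have "bdd_above (primitive f ` {-c..c})" by (intro bounded_imp_bdd_above compact_imp_bounded)
  then show ?thesis
    unfolding max_primitive_def S by (rule cSUP_upper[rotated]) (use x in auto)
qed

text \<open>If no c worked, every quotient would be finite and at most \<kappa> \<mu>, hence so
  would the supremum, against the strict inequality for \<mu>. No attained supremum is
  required.\<close>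

lemma growth_quotient_bound:
  assumes f: "continuous_on UNIV f" and \<kappa>: "0 < \<kappa>"
    and \<mu>: "ereal \<mu> < ereal (1 / \<kappa>) * (SUP \<gamma>\<in>{0<..}. growth_quotient f \<gamma>)"
  obtains c where "0 < c" "\<kappa> * \<mu> * max_primitive f c < c\<^sup>2"
proof (rule ccontr)
  assume "\<not> thesis"
  then have *: "c\<^sup>2 \<le> \<kappa> * \<mu> * max_primitive f c" if "0 < c" for c
    using that \<open>(\<And>c. 0 < c \<Longrightarrow> \<kappa> * \<mu> * max_primitive f c < c\<^sup>2 \<Longrightarrow> thesis)\<close> by (meson not_le)
  have "growth_quotient f c \<le> ereal (\<kappa> * \<mu>)" if c: "0 < c" for c
  proof -
    have "0 \<le> max_primitive f c" using primitive_le_max[OF f, of 0 c] c by (simp add: primitive_0)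
    \<comment> \<open>A zero maximum, where the quotient is infinite, would give c^2 \<le>
      0.\<close>
    moreover have "max_primitive f c \<noteq> 0" using *[OF c] c by auto
    ultimately have "0 < max_primitive f c" by simp
    then show ?thesis using *[OF c] by (simp add: growth_quotient_def pos_divide_le_eq)
  qed
  then have "(SUP \<gamma>\<in>{0<..}. growth_quotient f \<gamma>) \<le> ereal (\<kappa> * \<mu>)"
    by (intro SUP_least) auto
  then have "ereal (1 / \<kappa>) * (SUP \<gamma>\<in>{0<..}. growth_quotient f \<gamma>) \<le> ereal (1 / \<kappa>) * ereal (\<kappa> * \<mu>)"
    using \<kappa> by (intro ereal_mult_left_mono) auto
  also have "\<dots> = ereal \<mu>" using \<kappa> by simp
  finally show False using \<mu> by simp
qed

context weighted_interval begin

text \<open>The flux formula on the open interval is enough: around each interior point it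
  determines the flux in a neighbourhood, hence its derivative, and the endpoints are a null
  set.\<close>

lemma is_solution_primitive_of:
  assumes P: "continuous_on UNIV P" and P0: "(\<integral>y. weight T \<alpha> y * P y \<partial>lborel) = 0"
    and g: "continuous_on {0..T} g" "\<And>x. x \<in> {0..T} \<Longrightarrow> g x = \<mu> * f (primitive_of P x)"
    and flux: "\<And>x. x \<in> {0<..<T} \<Longrightarrow> flux T \<alpha> (primitive_of P) x = C - integral {0..x} g"
  shows "is_solution T \<alpha> \<mu> f (primitive_of P)"
proof -
  let ?u = "primitive_of P"
  have D: "(flux T \<alpha> ?u has_real_derivative - g x) (at x)" if x: "x \<in> {0<..<T}" for x
  proof -
    have "((\<lambda>x. integral {0..x} g) has_real_derivative g x) (at x within {0..T})"
      by (rule integral_has_real_derivative[OF g(1)]) (use x in auto)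
    moreover have "at x within {0..T} = at x" using x by (intro at_within_interior) auto
    ultimately have "((\<lambda>x. C - integral {0..x} g) has_real_derivative 0 - g x) (at x)"
      by (intro DERIV_diff DERIV_const) simp
    then have "((\<lambda>x. C - integral {0..x} g) has_real_derivative - g x) (at x)" by simp
    then show ?thesis
      by (rule has_field_derivative_transform_within_open[of _ _ _ "{0<..<T}"]) (use x flux in auto)
  qed
  have AE: "AE t in lebesgue_on {0..T}. t \<in> {0<..<T}"
  proof -
    have "AE t in lborel. t \<in> {0..T} \<longrightarrow> t \<in> {0<..<T}"
      using AE_lborel_singleton[of 0] AE_lborel_singleton[of T] by eventually_elim auto
    then have "AE t in lebesgue. t \<in> {0..T} \<longrightarrow> t \<in> {0<..<T}" by (rule AE_completion)
    then show ?thesis by (subst AE_restrict_space_iff) auto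
  qed
  show ?thesis
    unfolding is_solution_def
  proof (intro conjI)
    show "absolutely_continuous_on_interval 0 T ?u" by (rule primitive_of_absolutely_continuous[OF P])
    show "AE t in lebesgue_on {0..T}. flux T \<alpha> ?u differentiable at t"
      using AE by eventually_elim (use D in \<open>auto simp: real_differentiable_def\<close>)
    show "AE t in lebesgue_on {0..T}. deriv (flux T \<alpha> ?u) t + \<mu> * f (?u t) = 0"
      using AE
    proof eventually_elim
      case (elim t)
      then show ?case using DERIV_imp_deriv[OF D[OF elim]] g(2)[of t] by simp
    qed
    show "?u 0 = 0" by simp
    show "?u T = 0" using primitive_of_T[OF P] P0 by simp
  qed
qed

end

lemma kappa_pos:
  assumes "0 < T" "1/2 < \<alpha>" "\<alpha> \<le> 1"
  shows "0 < kappa T \<alpha>"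
proof -
  have "cos (pi * \<alpha>) < cos (pi / 2)" using assms by (intro cos_monotone_0_pi) auto
  then have "cos (pi * \<alpha>) \<noteq> 0" by simp
  moreover have "Gamma \<alpha> \<noteq> 0" using Gamma_real_pos[of \<alpha>] assms by linarith
  ultimately show ?thesis unfolding kappa_def using assms by (auto intro!: divide_pos_pos mult_pos_pos)
qed

section \<open>The case 1/2 < \<alpha> < 1\<close>

context riesz_interval begin

text \<open>The density P is hidden, because the variational argument refers only to data and
  solutions.\<close>

definition sol :: "(real \<Rightarrow> real) \<Rightarrow> (real \<Rightarrow> real) \<Rightarrow> bool" where
  "sol g u \<longleftrightarrow> (\<exists>P. solves g P \<and> (\<forall>t\<in>{0..T}. u t = primitive_of P t))"

text \<open>The density is bounded by \<open>C\<^sub>3\<close> b, so increments of the solution are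
  dominated by increments of the primitive of the weight; this primitive is the common modulus.
  Uniqueness transfers the bound from the solution constructed by \<open>solves_exists\<close> to
  the given P.\<close>

lemma primitive_of_equicont:
  assumes g: "solves g P" and b: "\<And>x. x \<in> {0..T} \<Longrightarrow> \<bar>g x\<bar> \<le> b" and xy: "x \<in> {0..T}" "y \<in> {0..T}"
  shows "\<bar>primitive_of P x - primitive_of P y\<bar> \<le> b * \<bar>C\<^sub>3 * primitive_of (\<lambda>_. 1) x - C\<^sub>3 * primitive_of (\<lambda>_. 1) y\<bar>"
  using xy
proof (induction x y rule: linorder_wlog)
  case (le x y)
  have P: "continuous_on UNIV P" and cg: "continuous_on {0..T} g" using g by (auto simp: solves_def)
  obtain P' where P': "solves g P'" "\<And>x. x \<in> {0..T} \<Longrightarrow> \<bar>P' x\<bar> \<le> C\<^sub>3 * b"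
    using solves_exists[OF cg b] by blast
  have Pb: "\<bar>P x\<bar> \<le> C\<^sub>3 * b" if "x \<in> {0..T}" for x
    using solves_unique[OF g P'(1) refl that] P'(2)[OF that] by simp
  let ?w = "\<lambda>y. weight T \<alpha> y * P y" and ?w1 = "\<lambda>y. weight T \<alpha> y * 1"
  have c1: "continuous_on UNIV (\<lambda>_::real. 1::real)" by simp
  have comb: "primitive_of P x + integral {x..y} ?w = primitive_of P y"
    "primitive_of (\<lambda>_. 1) x + integral {x..y} ?w1 = primitive_of (\<lambda>_. 1) y"
    unfolding primitive_of_def
    by (rule Henstock_Kurzweil_Integration.integral_combine; use le integrable_on_weighted[OF P] integrable_on_weighted[OF c1] in auto)+
  have "norm (integral {x..y} ?w) \<le> integral {x..y} (\<lambda>y. weight T \<alpha> y * 1 * (C\<^sub>3 * b))"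
  proof (rule integral_norm_bound_integral)
    show "(\<lambda>y. weight T \<alpha> y * 1 * (C\<^sub>3 * b)) integrable_on {x..y}"
      by (intro integrable_on_mult_left integrable_on_weighted c1)
    show "norm (weight T \<alpha> z * P z) \<le> weight T \<alpha> z * 1 * (C\<^sub>3 * b)" for z
    proof -
      have "\<bar>weight T \<alpha> z * P z\<bar> \<le> weight T \<alpha> z * (C\<^sub>3 * b)" by (rule weighted_bound[OF Pb])
      then show ?thesis by simp
    qed
  qed (rule integrable_on_weighted[OF P])
  also have "\<dots> = b * (C\<^sub>3 * integral {x..y} ?w1)" by simp
  also have "integral {x..y} ?w1 = \<bar>primitive_of (\<lambda>_. 1) x - primitive_of (\<lambda>_. 1) y\<bar>"
  proof -
    have "0 \<le> integral {x..y} ?w1" by (intro integral_nonneg integrable_on_weighted c1) simp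
    then show ?thesis using comb(2) by linarith
  qed
  also have "C\<^sub>3 * \<bar>primitive_of (\<lambda>_. 1) x - primitive_of (\<lambda>_. 1) y\<bar> = \<bar>C\<^sub>3 * primitive_of (\<lambda>_. 1) x - C\<^sub>3 * primitive_of (\<lambda>_. 1) y\<bar>"
    using C3_pos by (simp add: right_diff_distrib[symmetric] abs_mult)
  finally show ?case using comb(1) by simp
next
  case (sym x y)
  then show ?case by (simp add: abs_minus_commute)
qed

lemma integral_primitive_cong:
  assumes "\<And>t. t \<in> {0..T} \<Longrightarrow> u t = primitive_of P t"
  shows "integral {0..T} (\<lambda>x. u x * h x) = integral {0..T} (\<lambda>x. primitive_of P x * h x)"
  by (rule integral_cong) (use assms in auto)

lemma nonlinear_problem_sol:
  assumes f: "continuous_on UNIV f" and \<mu>: "0 < \<mu>" and c: "0 < c" "kappa T \<alpha> * \<mu> * max_primitive f c < c\<^sup>2"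
  shows "nonlinear_problem T (kappa T \<alpha> / (2 * T)) \<mu> c (max_primitive f c) f (primitive f) (\<lambda>x. C\<^sub>3 * primitive_of (\<lambda>_. 1) x) sol"
proof
  show "0 < T" by (rule T_pos)
  show "0 < kappa T \<alpha> / (2 * T)" using kappa_pos[OF T_pos \<alpha>_gt \<alpha>_le] T_pos by simp
  show "2 * (kappa T \<alpha> / (2 * T)) * \<mu> * T * max_primitive f c < c\<^sup>2" using c T_pos by simp
  show "continuous_on {0..T} (\<lambda>x. C\<^sub>3 * primitive_of (\<lambda>_. 1) x)"
    by (intro continuous_intros continuous_primitive_of)
  fix g u assume gu: "sol g u"
  then obtain P where P: "solves g P" "\<And>t. t \<in> {0..T} \<Longrightarrow> u t = primitive_of P t" by (auto simp: sol_def)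
  then have Pc: "continuous_on UNIV P" by (simp add: solves_def)
  show "continuous_on {0..T} g" using P by (simp add: solves_def)
  show "continuous_on {0..T} u"
    using continuous_primitive_of[OF Pc] P(2) continuous_on_cong[of "{0..T}" "{0..T}" u "primitive_of P"] by simp
  show "u 0 = 0" using P(2)[of 0] T_pos by simp
  show "(u t)\<^sup>2 \<le> kappa T \<alpha> / (2 * T) * integral {0..T} (\<lambda>x. u x * g x)" if "t \<in> {0..T}" for t
    using primitive_bound[OF P(1) that] P(2)[OF that] integral_primitive_cong[OF P(2)] by simp
  show "\<bar>u x - u y\<bar> \<le> b * \<bar>C\<^sub>3 * primitive_of (\<lambda>_. 1) x - C\<^sub>3 * primitive_of (\<lambda>_. 1) y\<bar>"
    if "\<And>x. x \<in> {0..T} \<Longrightarrow> \<bar>g x\<bar> \<le> b" "x \<in> {0..T}" "y \<in> {0..T}" for b x y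
    using primitive_of_equicont[OF P(1) that] P(2)[OF that(2)] P(2)[OF that(3)] by simp
  fix h v assume hv: "sol h v"
  then obtain Q where Q: "solves h Q" "\<And>t. t \<in> {0..T} \<Longrightarrow> v t = primitive_of Q t" by (auto simp: sol_def)
  then have Qc: "continuous_on UNIV Q" by (simp add: solves_def)
  show "sol (\<lambda>x. a * g x + b * h x) (\<lambda>x. a * u x + b * v x)" for a b
    unfolding sol_def using solves_lincomb[OF P(1) Q(1), of a b] primitive_of_lincomb[OF Pc Qc, of a b] P(2) Q(2)
    by (intro exI[of _ "\<lambda>x. a * P x + b * Q x"]) auto
  have "integral {0..T} (\<lambda>x. primitive_of P x * h x) = (\<integral>x. weight T \<alpha> x * P x * potential Q x \<partial>lborel)"
    using pairing[OF Q(1) Pc] P(1) by (simp add: solves_def)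
  also have "\<dots> = (\<integral>x. weight T \<alpha> x * Q x * potential P x \<partial>lborel)" by (rule potential_symmetric[OF Qc Pc])
  also have "\<dots> = integral {0..T} (\<lambda>x. primitive_of Q x * g x)"
    using pairing[OF P(1) Qc] Q(1) by (simp add: solves_def)
  finally show "integral {0..T} (\<lambda>x. u x * h x) = integral {0..T} (\<lambda>x. v x * g x)"
    using integral_primitive_cong[OF P(2)] integral_primitive_cong[OF Q(2)] by simp
next
  fix g :: "real \<Rightarrow> real" assume g: "continuous_on {0..T} g"
  have "compact (g ` {0..T})" by (rule compact_continuous_image[OF g]) simp
  then obtain b where "\<forall>z\<in>g ` {0..T}. norm z \<le> b" by (meson bounded_iff compact_imp_bounded)
  then show "\<exists>u. sol g u" using solves_exists[OF g, of b] unfolding sol_def by auto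
qed (use f \<mu> c primitive_deriv primitive_0 primitive_le_max in auto)

lemma solution_lt_1:
  assumes f: "continuous_on UNIV f" and \<mu>: "0 < \<mu>" and c: "0 < c" "kappa T \<alpha> * \<mu> * max_primitive f c < c\<^sup>2"
  shows "\<exists>u. u \<in> E_space T \<alpha> \<and> is_solution T \<alpha> \<mu> f u"
proof -
  interpret N: nonlinear_problem T "kappa T \<alpha> / (2 * T)" \<mu> c "max_primitive f c" f "primitive f" "\<lambda>x. C\<^sub>3 * primitive_of (\<lambda>_. 1) x" sol
    by (rule nonlinear_problem_sol[OF assms])
  obtain g u where gu: "sol g u" "\<forall>x\<in>{0..T}. g x = \<mu> * f (u x)" using N.solution_exists by blast
  then obtain P where P: "solves g P" "\<And>t. t \<in> {0..T} \<Longrightarrow> u t = primitive_of P t" by (auto simp: sol_def)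
  then have Pc: "continuous_on UNIV P" and P0: "(\<integral>y. weight T \<alpha> y * P y \<partial>lborel) = 0" and cg: "continuous_on {0..T} g"
    by (auto simp: solves_def)
  obtain C where C: "\<And>x. x \<in> {0<..<T} \<Longrightarrow> potential P x = C - integral {0..x} g" using P(1) by (auto simp: solves_def)
  have "is_solution T \<alpha> \<mu> f (primitive_of P)"
    by (rule is_solution_primitive_of[OF Pc P0 cg, where C = C]) (use gu(2) P(2) C flux_primitive_of[OF Pc] in auto)
  then show ?thesis using primitive_of_in_E_space[OF Pc P0] by blast
qed

end

section \<open>The classical case \<alpha> = 1\<close>

locale classical_interval =
  fixes T :: real
  assumes T_pos: "0 < T"
begin

text \<open>For \<alpha> = 1 both terms of the flux contribute u', so 2 u' equals a constant minus
  the integral of g. The constant is the average of that integral over [0,T], which makes the mean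
  of u' zero.\<close>

definition slope :: "(real \<Rightarrow> real) \<Rightarrow> real \<Rightarrow> real" where
  "slope g x = (integral {0..T} (\<lambda>y. integral {0..y} g) / T - integral {0..x} g) / 2"

definition sol :: "(real \<Rightarrow> real) \<Rightarrow> (real \<Rightarrow> real) \<Rightarrow> bool" where
  "sol g u \<longleftrightarrow> continuous_on {0..T} g \<and> (\<forall>t\<in>{0..T}. u t = integral {0..t} (slope g))"

lemma continuous_integral:
  fixes g :: "real \<Rightarrow> real"
  assumes "continuous_on {0..T} g"
  shows "continuous_on {0..T} (\<lambda>x. integral {0..x} g)"
  by (intro indefinite_integral_continuous_1 integrable_continuous_real assms)

lemma continuous_slope: "continuous_on {0..T} g \<Longrightarrow> continuous_on {0..T} (slope g)"
  unfolding slope_def[abs_def] by (intro continuous_intros continuous_integral)  simp_all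

lemma integral_slope: 
  assumes "continuous_on {0..T} g" shows "integral {0..T} (slope g) = 0"
proof -
  let ?G = "\<lambda>x. integral {0..x} g"
  have "(?G has_integral integral {0..T} ?G) {0..T}"
    by (intro integrable_integral integrable_continuous_real continuous_integral assms)
  moreover have "((\<lambda>_. integral {0..T} ?G / T) has_integral (T - 0) *\<^sub>R (integral {0..T} ?G / T)) {0..T}"
    using has_integral_const_real[of "integral {0..T} ?G / T" 0 T] T_pos by simp
  ultimately have "(slope g has_integral ((T - 0) *\<^sub>R (integral {0..T} ?G / T) - integral {0..T} ?G) / 2) {0..T}"
    unfolding slope_def[abs_def] by (intro has_integral_divide has_integral_diff)
  then show ?thesis using T_pos by (simp add: integral_unique)
qed

lemma slope_lincomb:
  assumes g: "continuous_on {0..T} g" and h: "continuous_on {0..T} h" and x: "x \<in> {0..T}"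
  shows "slope (\<lambda>x. a * g x + b * h x) x = a * slope g x + b * slope h x"
proof -
  have 1: "integral {0..x} (\<lambda>x. a * g x + b * h x) = a * integral {0..x} g + b * integral {0..x} h" if "x \<in> {0..T}" for x
    using that by (intro integral_unique has_integral_add has_integral_mult_right integrable_integral integrable_continuous_real
        continuous_on_subset[OF g] continuous_on_subset[OF h]) auto
  have "integral {0..T} (\<lambda>y. integral {0..y} (\<lambda>x. a * g x + b * h x)) = integral {0..T} (\<lambda>y. a * integral {0..y} g + b * integral {0..y} h)"
    by (rule integral_cong) (rule 1)
  also have "\<dots> = a * integral {0..T} (\<lambda>y. integral {0..y} g) + b * integral {0..T} (\<lambda>y. integral {0..y} h)"
    by (intro integral_unique has_integral_add has_integral_mult_right integrable_integral integrable_continuous_real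
        continuous_integral g h)
  finally show ?thesis unfolding slope_def 1[OF x] by (simp add: algebra_simps add_divide_distrib diff_divide_distrib)
qed

lemma slope_bound:
  assumes g: "continuous_on {0..T} g" and b: "\<And>x. x \<in> {0..T} \<Longrightarrow> \<bar>g x\<bar> \<le> b" and x: "x \<in> {0..T}"
  shows "\<bar>slope g x\<bar> \<le> b * T"
proof -
  have b0: "0 \<le> b" using b[of 0] T_pos by (auto intro: order_trans[OF abs_ge_zero])
  have 1: "\<bar>integral {0..y} g\<bar> \<le> b * T" if y: "y \<in> {0..T}" for y
  proof -
    have "norm (integral {0..y} g) \<le> b * (y - 0)"
      by (rule integral_bound) (use y b in \<open>auto intro: continuous_on_subset[OF g]\<close>)
    also have "\<dots> \<le> b * T" using y b0 by (intro mult_left_mono) auto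
    finally show ?thesis by simp
  qed
  have "norm (integral {0..T} (\<lambda>y. integral {0..y} g)) \<le> (b * T) * (T - 0)"
    by (rule integral_bound) (use T_pos 1 continuous_integral[OF g] in auto)
  then have "\<bar>integral {0..T} (\<lambda>y. integral {0..y} g) / T\<bar> \<le> b * T"
    using T_pos by (simp add: abs_divide pos_divide_le_eq)
  moreover have "\<bar>(X - Y) / 2\<bar> \<le> B" if "\<bar>X\<bar> \<le> B" "\<bar>Y\<bar> \<le> B" for X Y B :: real
  proof -
    have "\<bar>X - Y\<bar> \<le> 2 * B" using that by linarith
    then show ?thesis by simp
  qed
  ultimately show ?thesis using 1[OF x] unfolding slope_def by blast
qed

text \<open>Integration by parts, where the derivative of \<open>slope h\<close> is -h/2; the factor
  2 undoes this half, and the boundary terms vanish because the primitive of \<open>slope g\<close>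
  is zero at both ends.\<close>

lemma sol_pairing:
  assumes g: "sol g u" and h: "continuous_on {0..T} h"
  shows "integral {0..T} (\<lambda>x. u x * h x) = 2 * integral {0..T} (\<lambda>x. slope g x * slope h x)"
proof -
  have cg: "continuous_on {0..T} g" and u: "\<And>t. t \<in> {0..T} \<Longrightarrow> u t = integral {0..t} (slope g)" using g by (auto simp: sol_def)
  let ?U = "\<lambda>t. integral {0..t} (slope g)"
  have cU: "continuous_on {0..T} ?U" by (rule continuous_integral[OF continuous_slope[OF cg]])
  have "((\<lambda>x. ?U x * (- (h x / 2)) + slope g x * slope h x) has_integral (?U T * slope h T - ?U 0 * slope h 0)) {0..T}"
  proof (rule fundamental_theorem_of_calculus_interior)
    fix x assume x: "x \<in> {0<..<T}"
    then have at: "at x within {0..T} = at x" by (intro at_within_interior) auto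
    have dU: "(?U has_real_derivative slope g x) (at x)"
      using integral_has_real_derivative[OF continuous_slope[OF cg], of x] x at by simp
    have "((\<lambda>x. integral {0..x} h) has_real_derivative h x) (at x)"
      using integral_has_real_derivative[OF h, of x] x at by simp
    then have "((\<lambda>x. (integral {0..T} (\<lambda>y. integral {0..y} h) / T - integral {0..x} h) / 2) has_real_derivative (0 - h x) / 2) (at x)"
      by (intro DERIV_cdivide DERIV_diff DERIV_const)
    then have dS: "(slope h has_real_derivative - (h x / 2)) (at x)" unfolding slope_def[abs_def] by simp
    have "((\<lambda>x. ?U x * slope h x) has_real_derivative (?U x * (- (h x / 2)) + slope g x * slope h x)) (at x)"
      by (rule DERIV_mult'[OF dU dS])
    then show "((\<lambda>x. ?U x * slope h x) has_vector_derivative (?U x * (- (h x / 2)) + slope g x * slope h x)) (at x)"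
      by (simp add: has_real_derivative_iff_has_vector_derivative)
  qed (use T_pos in \<open>auto intro!: continuous_intros cU continuous_slope h\<close>)
  then have 1: "((\<lambda>x. ?U x * (- (h x / 2)) + slope g x * slope h x) has_integral 0) {0..T}"
    using integral_slope[OF cg] by simp
  have 2: "((\<lambda>x. slope g x * slope h x) has_integral integral {0..T} (\<lambda>x. slope g x * slope h x)) {0..T}"
    by (intro integrable_integral integrable_continuous_real continuous_intros continuous_slope cg h)
  have "((\<lambda>x. ?U x * (- (h x / 2))) has_integral (0 - integral {0..T} (\<lambda>x. slope g x * slope h x))) {0..T}"
    using has_integral_diff[OF 1 2] by simp
  then have "((\<lambda>x. (-2) * (?U x * (- (h x / 2)))) has_integral (-2) * (0 - integral {0..T} (\<lambda>x. slope g x * slope h x))) {0..T}"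
    by (rule has_integral_mult_right)
  then have "((\<lambda>x. u x * h x) has_integral (-2) * (0 - integral {0..T} (\<lambda>x. slope g x * slope h x))) {0..T}"
    by (rule has_integral_eq[rotated]) (simp add: u)
  then show ?thesis by (simp add: integral_unique)
qed

text \<open>Cauchy-Schwarz on [0,t] gives u(t)^2 \<le> t times the integral of the squared slope,
  and the energy is twice that integral over [0,T]. The constant T/2 is \<kappa>/(2T), as \<kappa> =
  T^2 for \<alpha> = 1.\<close>

lemma sol_bound:
  assumes g: "sol g u" and t: "t \<in> {0..T}"
  shows "(u t)\<^sup>2 \<le> T / 2 * integral {0..T} (\<lambda>x. u x * g x)"
proof -
  have cg: "continuous_on {0..T} g" and u: "\<And>t. t \<in> {0..T} \<Longrightarrow> u t = integral {0..t} (slope g)" using g by (auto simp: sol_def)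
  note cs = continuous_slope[OF cg]
  let ?E = "integral {0..T} (\<lambda>x. slope g x * slope g x)"
  have E: "integral {0..T} (\<lambda>x. u x * g x) = 2 * ?E" by (rule sol_pairing[OF g cg])
  have "(u t)\<^sup>2 \<le> T * ?E"
  proof (cases "t = 0")
    case True
    have "0 \<le> ?E" by (intro integral_nonneg integrable_continuous_real continuous_intros cs) auto
    then show ?thesis using u[of 0] True T_pos by simp
  next
    case False
    then have t0: "0 < t" using t by simp
    \<comment> \<open>The average slope on [0,t], the best constant to subtract in the nonnegative
      integral of (slope - s)^2.\<close>
    let ?s = "u t / t"
    have ct: "continuous_on {0..t} (slope g)" by (rule continuous_on_subset[OF cs]) (use t in auto)
    let ?Et = "integral {0..t} (\<lambda>x. slope g x * slope g x)"
    have "((\<lambda>x. slope g x * slope g x - (2 * ?s) * slope g x + ?s\<^sup>2) has_integral (?Et - (2 * ?s) * u t + (t - 0) *\<^sub>R ?s\<^sup>2)) {0..t}"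
    proof (intro has_integral_add has_integral_diff has_integral_mult_right)
      show "((\<lambda>x. slope g x * slope g x) has_integral ?Et) {0..t}"
        by (intro integrable_integral integrable_continuous_real continuous_intros ct)
      show "(slope g has_integral u t) {0..t}"
        unfolding u[OF t] by (intro integrable_integral integrable_continuous_real ct)
      show "((\<lambda>x. ?s\<^sup>2) has_integral (t - 0) *\<^sub>R ?s\<^sup>2) {0..t}"
        using has_integral_const_real[of "?s\<^sup>2" 0 t] t0 by simp
    qed
    then have "0 \<le> ?Et - (2 * ?s) * u t + (t - 0) *\<^sub>R ?s\<^sup>2"
    proof (rule has_integral_nonneg)
      fix x
      have "a * a - (2 * s) * a + s\<^sup>2 = (a - s)\<^sup>2" for a s :: real
        by (simp add: power2_eq_square algebra_simps)
      from this[of "slope g x" ?s] show "0 \<le> slope g x * slope g x - (2 * ?s) * slope g x + ?s\<^sup>2" by simp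
    qed
    also have "\<dots> = ?Et - (u t)\<^sup>2 / t" using t0 by (simp add: power2_eq_square field_simps)
    finally have "(u t)\<^sup>2 \<le> t * ?Et" using t0 by (simp add: pos_divide_le_eq mult.commute)
    also have "?Et \<le> ?E"
    proof (rule integral_subset_le)
      show "{0..t} \<subseteq> {0..T}" using t by auto
    qed (intro integrable_continuous_real continuous_intros ct cs | simp)+
    then have "t * ?Et \<le> T * ?E"
    proof (rule mult_mono[rotated])
      show "0 \<le> ?Et" by (intro integral_nonneg integrable_continuous_real continuous_intros ct) auto
    qed (use t T_pos in auto)
    finally show ?thesis .
  qed
  then show ?thesis unfolding E by simp
qed

lemma nonlinear_problem_sol:
  assumes f: "continuous_on UNIV f" and \<mu>: "0 < \<mu>" and c: "0 < c" "kappa T 1 * \<mu> * max_primitive f c < c\<^sup>2"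
  shows "nonlinear_problem T (T / 2) \<mu> c (max_primitive f c) f (primitive f) (\<lambda>x. T * x) sol"
proof
  have "kappa T 1 = T\<^sup>2" using T_pos by (simp add: kappa_def powr_numeral)
  then show "2 * (T / 2) * \<mu> * T * max_primitive f c < c\<^sup>2" using c by (simp add: power2_eq_square mult_ac)
  show "continuous_on {0..T} (\<lambda>x. T * x)" by (intro continuous_intros)
  fix g u assume gu: "sol g u"
  then have cg: "continuous_on {0..T} g" and u: "\<And>t. t \<in> {0..T} \<Longrightarrow> u t = integral {0..t} (slope g)" by (auto simp: sol_def)
  show "continuous_on {0..T} g" by (rule cg)
  show "continuous_on {0..T} u"
    using continuous_integral[OF continuous_slope[OF cg]] u continuous_on_cong[of "{0..T}" "{0..T}" u "\<lambda>t. integral {0..t} (slope g)"] by simp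
  show "u 0 = 0" using u[of 0] T_pos by simp
  show "(u t)\<^sup>2 \<le> T / 2 * integral {0..T} (\<lambda>x. u x * g x)" if "t \<in> {0..T}" for t
    by (rule sol_bound[OF gu that])
  show "\<bar>u x - u y\<bar> \<le> b * \<bar>T * x - T * y\<bar>"
    if b: "\<And>x. x \<in> {0..T} \<Longrightarrow> \<bar>g x\<bar> \<le> b" and xy: "x \<in> {0..T}" "y \<in> {0..T}" for b x y
    using xy
  proof (induction x y rule: linorder_wlog)
    case (le x y)
    have "integral {0..x} (slope g) + integral {x..y} (slope g) = integral {0..y} (slope g)"
      by (rule Henstock_Kurzweil_Integration.integral_combine)
         (use le in \<open>auto intro!: integrable_continuous_real continuous_on_subset[OF continuous_slope[OF cg]]\<close>)
    moreover have "norm (integral {x..y} (slope g)) \<le> (b * T) * (y - x)"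
      by (rule integral_bound) (use le slope_bound[OF cg b] in \<open>auto intro!: continuous_on_subset[OF continuous_slope[OF cg]]\<close>)
    moreover have "\<bar>T * x - T * y\<bar> = T * (y - x)"
      using T_pos le(1) by (simp add: right_diff_distrib[symmetric] abs_mult)
    ultimately show ?case using u[OF le(2)] u[OF le(3)] by (simp add: mult.assoc)
  next
    case (sym x y)
    then show ?case by (simp add: abs_minus_commute)
  qed
  fix h v assume hv: "sol h v"
  then have ch: "continuous_on {0..T} h" and v: "\<And>t. t \<in> {0..T} \<Longrightarrow> v t = integral {0..t} (slope h)" by (auto simp: sol_def)
  show "integral {0..T} (\<lambda>x. u x * h x) = integral {0..T} (\<lambda>x. v x * g x)"
    unfolding sol_pairing[OF gu ch] sol_pairing[OF hv cg] by (simp add: mult.commute)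
  show "sol (\<lambda>x. a * g x + b * h x) (\<lambda>x. a * u x + b * v x)" for a b
    unfolding sol_def
  proof (intro conjI ballI)
    show "continuous_on {0..T} (\<lambda>x. a * g x + b * h x)" by (intro continuous_intros cg ch)
    fix t assume t: "t \<in> {0..T}"
    have "integral {0..t} (slope (\<lambda>x. a * g x + b * h x)) = integral {0..t} (\<lambda>x. a * slope g x + b * slope h x)"
      by (rule integral_cong) (use t slope_lincomb[OF cg ch] in auto)
    also have "\<dots> = a * integral {0..t} (slope g) + b * integral {0..t} (slope h)"
      using t by (intro integral_unique has_integral_add has_integral_mult_right integrable_integral integrable_continuous_real
        continuous_on_subset[OF continuous_slope[OF cg]] continuous_on_subset[OF continuous_slope[OF ch]]) auto
    finally show "a * u t + b * v t = integral {0..t} (slope (\<lambda>x. a * g x + b * h x))" using u[OF t] v[OF t] by simp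
  qed
next
  fix g :: "real \<Rightarrow> real" assume g: "continuous_on {0..T} g"
  then show "\<exists>u. sol g u" unfolding sol_def by auto
qed (use f \<mu> c T_pos primitive_deriv primitive_0 primitive_le_max in auto)

lemma solution_1:
  assumes f: "continuous_on UNIV f" and \<mu>: "0 < \<mu>" and c: "0 < c" "kappa T 1 * \<mu> * max_primitive f c < c\<^sup>2"
  shows "\<exists>u. u \<in> E_space T 1 \<and> is_solution T 1 \<mu> f u"
proof -
  interpret N: nonlinear_problem T "T / 2" \<mu> c "max_primitive f c" f "primitive f" "\<lambda>x. T * x" sol
    by (rule nonlinear_problem_sol[OF assms])
  interpret W: weighted_interval T 1 using T_pos by unfold_locales auto
  obtain g u where gu: "sol g u" "\<forall>x\<in>{0..T}. g x = \<mu> * f (u x)" using N.solution_exists by blast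
  then have cg: "continuous_on {0..T} g" and u: "\<And>t. t \<in> {0..T} \<Longrightarrow> u t = integral {0..t} (slope g)" by (auto simp: sol_def)
  define P where "P x = slope g (max 0 (min T x))" for x
  have Pc: "continuous_on UNIV P"
    unfolding P_def[abs_def] using T_pos
    by (intro continuous_on_compose2[OF continuous_slope[OF cg]]) (auto intro!: continuous_intros)
  have P: "P x = slope g x" if "x \<in> {0..T}" for x using that by (simp add: P_def)
  have wP: "W.primitive_of P t = u t" if t: "t \<in> {0..T}" for t
  proof -
    \<comment> \<open>For \<alpha> = 1 the weight is 1 inside the interval and 0 at the points 0 and
      T, which are negligible for the integral.\<close>
    have "W.primitive_of P t = integral {0..t} (slope g)"
      unfolding W.primitive_of_def
      by (rule integral_spike[of "{0, T}"]) (use t P in \<open>auto simp: weight_def tpow_def\<close>)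
    then show ?thesis using u[OF t] by simp
  qed
  have P0: "(\<integral>y. weight T 1 y * P y \<partial>lborel) = 0"
    using W.primitive_of_T[OF Pc] wP[of T] u[of T] integral_slope[OF cg] T_pos by simp
  let ?C = "integral {0..T} (\<lambda>y. integral {0..y} g) / T"
  have "is_solution T 1 \<mu> f (W.primitive_of P)"
  proof (rule W.is_solution_primitive_of[OF Pc P0 cg, where C = ?C])
    show "g x = \<mu> * f (W.primitive_of P x)" if "x \<in> {0..T}" for x using gu(2) wP[OF that] that by simp
    fix x assume x: "x \<in> {0<..<T}"
    have "deriv (W.primitive_of P) x = slope g x"
      using W.deriv_primitive_of[OF Pc x] x P[of x] by (simp add: weight_def tpow_def)
    then show "flux T 1 (W.primitive_of P) x = ?C - integral {0..x} g"
      by (simp add: flux_def frac_integral_left_def frac_integral_right_def caputo_left_def caputo_right_def slope_def field_simps)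
  qed
  then show ?thesis using W.primitive_of_in_E_space[OF Pc P0] by blast
qed

end

theorem theorem3p2:
  fixes T \<alpha> \<mu> :: real and f :: "real \<Rightarrow> real"
  assumes "T > 0"
    and "continuous_on UNIV f"
    and "1 / 2 < \<alpha>" and "\<alpha> \<le> 1"
    and "0 < \<mu>"
    and "ereal \<mu> < ereal (1 / kappa T \<alpha>) * (SUP \<gamma>\<in>{0<..}. growth_quotient f \<gamma>)"
  shows "\<exists>u. u \<in> E_space T \<alpha> \<and> is_solution T \<alpha> \<mu> f u"
proof -
  obtain c where c: "0 < c" "kappa T \<alpha> * \<mu> * max_primitive f c < c\<^sup>2"
    using growth_quotient_bound[OF assms(2) kappa_pos[OF assms(1,3,4)] assms(6)] by blast
  show ?thesis
  proof (cases "\<alpha> = 1")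
    case True
    interpret classical_interval T using assms by unfold_locales
    show ?thesis using solution_1[OF assms(2,5) c(1)] c(2) True by simp
  next
    case False
    interpret riesz_interval T \<alpha> using assms False by unfold_locales auto
    show ?thesis by (rule solution_lt_1[OF assms(2,5) c])
  qed
qed

end
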